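(* Let $k$ be a field of arbitrary characteristic, let $G$ be a finite group acting linearly on a finite-dimensional $k$-vector space $V$, and let $\lambda: kG\otimes V\to kG$ and $\kappa: V\otimes V\to kG$ be $k$-linear maps with $\kappa$ alternating. If $\mathcal{H}_{\lambda,\kappa}$ exhibits the PBW property, then there is a graded deformation $A_t$ of $A=S(V)\# G$ over $k[t]$ for which $$\mathcal{H}_{\lambda,\kappa}\cong A_t|_{t=1}$$ and whose first and second multiplication maps $\mu_1$ and $\mu_2$ satisfy $$\lambda(g,v)=\mu_1(g\otimes v)-\mu_1({}^gv\otimes g)\quad\text{and}\quad \kappa(v,w)=\mu_2(v\otimes w)-\mu_2(w\otimes v)$$ for all $v,w\in V$ and $g\in G$.
   Context: Notation: $\otimes=\otimes_k$; ${}^gv$ denotes the action of $g\in G$ on $v$; $\lambda(g,v)=\lambda(g\otimes v)$ and $\kappa(v,w)=\kappa(v\otimes w)$. The skew group algebra $A=S(V)\# G$ is the vector space $S(V)\otimes kG$ with product $(r\otimes g)(s\otimes h)=r({}^gs)\otimes gh$; it is $\mathbb{N}$-graded with $V$ in degree 1 and $G$ in degree 0. $\mathcal{H}_{\lambda,\kappa}$ is the associative unital $k$-algebra generated by a basis of $V$ together with the group algebra $kG$, subject to the relations in $kG$ and $vw-wv=\kappa(v,w)$, $gv-{}^gv\,g=\lambda(g,v)$ for all $v,w\in V$, $g\in G$. It is filtered by $\deg v=1$ ($v\in V$), $\deg g=0$ ($g\in G$), and exhibits the PBW property when $\mathrm{gr}(\mathcal{H}_{\lambda,\kappa})\cong S(V)\#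 G$ as graded algebras; equivalently, when $\{v_1^{i_1}\cdots v_m^{i_m}g: i_j\in\mathbb{Z}_{\ge 0},\ g\in G\}$ is a $k$-basis for $v_1,\dots,v_m$ any basis of $V$. A deformation of a $k$-algebra $A$ over $k[t]$ is an associative $k[t]$-algebra structure on $A[t]$ whose product $*$ is determined by $a_1*a_2=a_1a_2+\mu_1(a_1\otimes a_2)t+\mu_2(a_1\otimes a_2)t^2+\cdots$ for $a_1,a_2\in A$, where $a_1a_2$ is the product in $A$, each $\mu_j:A\otimes A\to A$ (the $j$-th multiplication map) is $k$-linear and extended $k[t]$-linearly, only finitely many terms are nonzero for each pair $a_1,a_2$, and $1_A$ is the multiplicative identity for $*$. If $A$ is $\mathbb{N}$-graded, the deformation is graded if each $\mu_j$ is homogeneous of degree $-j$ (equivalently, $A[t]$ is a graded algebra under $*$ with $\deg t=1$). The fiber at $t=1$ is $A_t|_{t=1}=A_t/(t-1)A_t$. *)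

theory Defs
  imports
    "HOL-Library.Poly_Mapping"
    "HOL-Computational_Algebra.Polynomial"
    "HOL-Algebra.Algebraic_Closure_Type"
    "HOL-Algebra.QuotRing"
    "HOL-Algebra.Group_Action"
    "HOL-Algebra.UnivPoly"
begin

section \<open>Algebras over a commutative ring\<close>

text \<open>
  Algebras are \<^type>\<open>module\<close> records whose scalars form a whole type of class
  \<^class>\<open>comm_ring_1\<close>; the locale \<^locale>\<open>algebra\<close> of HOL-Algebra covers only commutative algebras.
\<close>

definition assoc_algebra :: "('r::comm_ring_1, 'b) module \<Rightarrow> bool" where
  "assoc_algebra B \<longleftrightarrow> ring B \<and> Module.module (ring_of_type_algebra :: 'r ring) B \<and>
     (\<forall>c. \<forall>x\<in>carrier B. \<forall>y\<in>carrier B.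
        (c \<odot>\<^bsub>B\<^esub> x) \<otimes>\<^bsub>B\<^esub> y = c \<odot>\<^bsub>B\<^esub> (x \<otimes>\<^bsub>B\<^esub> y) \<and>
        x \<otimes>\<^bsub>B\<^esub> (c \<odot>\<^bsub>B\<^esub> y) = c \<odot>\<^bsub>B\<^esub> (x \<otimes>\<^bsub>B\<^esub> y))"

definition alg_iso :: "('r, 'b) module \<Rightarrow> ('r, 'c) module \<Rightarrow> ('b \<Rightarrow> 'c) set" where
  "alg_iso B C = {f \<in> ring_iso B C. \<forall>c. \<forall>x\<in>carrier B. f (c \<odot>\<^bsub>B\<^esub> x) = c \<odot>\<^bsub>C\<^esub> f x}"

definition alg_isomorphic :: "('r, 'b) module \<Rightarrow> ('r, 'c) module \<Rightarrow> bool" where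
  "alg_isomorphic B C \<longleftrightarrow> alg_iso B C \<noteq> {}"

text \<open>In the next definition, \<open>gB d\<close> and \<open>gC d\<close> are the homogeneous components of degree \<open>d\<close>.\<close>

definition graded_alg_isomorphic ::
    "('r, 'b) module \<Rightarrow> (nat \<Rightarrow> 'b set) \<Rightarrow> ('r, 'c) module \<Rightarrow> (nat \<Rightarrow> 'c set) \<Rightarrow> bool" where
  "graded_alg_isomorphic B gB C gC \<longleftrightarrow> (\<exists>f \<in> alg_iso B C. \<forall>d. f ` gB d = gC d)"

text \<open>Linear maps \<open>M \<otimes> N \<rightarrow> P\<close> are represented by the corresponding bilinear maps.\<close>

definition bilinear_map ::
    "('r, 'a) module \<Rightarrow> ('r, 'b) module \<Rightarrow> ('r, 'c) module \<Rightarrow> ('a \<Rightarrow> 'b \<Rightarrow> 'c) \<Rightarrow> bool" where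
  "bilinear_map M N P f \<longleftrightarrow>
     (\<forall>x\<in>carrier M. \<forall>y\<in>carrier N. f x y \<in> carrier P) \<and>
     (\<forall>x\<in>carrier M. \<forall>x'\<in>carrier M. \<forall>y\<in>carrier N.
        f (x \<oplus>\<^bsub>M\<^esub> x') y = f x y \<oplus>\<^bsub>P\<^esub> f x' y) \<and>
     (\<forall>x\<in>carrier M. \<forall>y\<in>carrier N. \<forall>y'\<in>carrier N.
        f x (y \<oplus>\<^bsub>N\<^esub> y') = f x y \<oplus>\<^bsub>P\<^esub> f x y') \<and>
     (\<forall>c. \<forall>x\<in>carrier M. \<forall>y\<in>carrier N.
        f (c \<odot>\<^bsub>M\<^esub> x) y = c \<odot>\<^bsub>P\<^esub> f x y \<and> f x (c \<odot>\<^bsub>N\<^esub> y) = c \<odot>\<^bsub>P\<^esub> f x y)"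

definition quotient_algebra :: "('r, 'b) module \<Rightarrow> 'b set \<Rightarrow> ('r, 'b set) module" where
  "quotient_algebra B I =
     ring.extend (B Quot I) (module.fields (\<lambda>c Z. \<Union>x\<in>Z. I +>\<^bsub>B\<^esub> (c \<odot>\<^bsub>B\<^esub> x)))"


section \<open>Free algebras\<close>

text \<open>
  Words under concatenation form a monoid, written additively so that \<open>'x list \<Rightarrow>\<^sub>0 'k\<close> with the
  convolution product of \<^theory>\<open>HOL-Library.Poly_Mapping\<close> is the free algebra on \<open>'x\<close>.
\<close>

instantiation list :: (type) monoid_add
begin
definition "0 = []"
definition "xs + ys = xs @ ys"
instance by standard (auto simp: zero_list_def plus_list_def)
end

definition free_algebra :: "'x set \<Rightarrow> ('k::field, 'x list \<Rightarrow>\<^sub>0 'k) module" where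
  "free_algebra L =
     \<lparr>carrier = {p. Poly_Mapping.keys p \<subseteq> lists L}, monoid.mult = (*), one = 1, zero = 0, add = (+),
      module.smult = (\<lambda>c p. Poly_Mapping.single 0 c * p)\<rparr>"

definition letter :: "'x \<Rightarrow> 'x list \<Rightarrow>\<^sub>0 'k::field" where
  "letter x = Poly_Mapping.single [x] 1"

definition free_map :: "('x \<Rightarrow> 'y) \<Rightarrow> ('x list \<Rightarrow>\<^sub>0 'k::field) \<Rightarrow> ('y list \<Rightarrow>\<^sub>0 'k)" where
  "free_map f p =
     (\<Sum>w\<in>Poly_Mapping.keys p. Poly_Mapping.single (map f w) (Poly_Mapping.lookup p w))"


section \<open>The symmetric algebra\<close>

text \<open>
  \<open>V\<close> is the type \<open>'v\<close> with scalar multiplication \<open>scale\<close>. Every vector is a free generator, and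
  the first two families of relations make the free algebra into the tensor algebra of \<open>V\<close>.
\<close>

definition sym_relations :: "('k::field \<Rightarrow> 'v::ab_group_add \<Rightarrow> 'v) \<Rightarrow> ('v list \<Rightarrow>\<^sub>0 'k) set" where
  "sym_relations scale =
     {letter (v + w) - letter v - letter w | v w. True} \<union>
     {letter (scale c v) - Poly_Mapping.single 0 c * letter v | c v. True} \<union>
     {letter v * letter w - letter w * letter v | v w. True}"

definition sym_ideal :: "('k::field \<Rightarrow> 'v::ab_group_add \<Rightarrow> 'v) \<Rightarrow> ('v list \<Rightarrow>\<^sub>0 'k) set" where
  "sym_ideal scale = genideal (free_algebra UNIV) (sym_relations scale)"

definition sym_algebra ::
    "('k::field \<Rightarrow> 'v::ab_group_add \<Rightarrow> 'v) \<Rightarrow> ('k, ('v list \<Rightarrow>\<^sub>0 'k) set) module" where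
  "sym_algebra scale = quotient_algebra (free_algebra UNIV) (sym_ideal scale)"

definition sym_class ::
    "('k::field \<Rightarrow> 'v::ab_group_add \<Rightarrow> 'v) \<Rightarrow> ('v list \<Rightarrow>\<^sub>0 'k) \<Rightarrow> ('v list \<Rightarrow>\<^sub>0 'k) set" where
  "sym_class scale p = sym_ideal scale +>\<^bsub>free_algebra UNIV\<^esub> p"

definition sym_component ::
    "('k::field \<Rightarrow> 'v::ab_group_add \<Rightarrow> 'v) \<Rightarrow> nat \<Rightarrow> ('v list \<Rightarrow>\<^sub>0 'k) set set" where
  "sym_component scale d = {sym_class scale p | p. \<forall>w\<in>Poly_Mapping.keys p. length w = d}"


section \<open>The group algebra and the skew group algebra\<close>

text \<open>Here \<open>G\<close> is a finite group, so elements of \<open>kG\<close> are arbitrary families of coefficients.\<close>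

definition group_algebra :: "('g, 'm) monoid_scheme \<Rightarrow> ('k::field, 'g \<Rightarrow> 'k) module" where
  "group_algebra G =
     \<lparr>carrier = carrier G \<rightarrow>\<^sub>E UNIV,
      monoid.mult = (\<lambda>a b. \<lambda>x\<in>carrier G. \<Sum>g\<in>carrier G. a g * b (inv\<^bsub>G\<^esub> g \<otimes>\<^bsub>G\<^esub> x)),
      one = (\<lambda>x\<in>carrier G. if x = \<one>\<^bsub>G\<^esub> then 1 else 0),
      zero = (\<lambda>x\<in>carrier G. 0),
      add = (\<lambda>a b. \<lambda>x\<in>carrier G. a x + b x),
      module.smult = (\<lambda>c a. \<lambda>x\<in>carrier G. c * a x)\<rparr>"

definition group_elt :: "('g, 'm) monoid_scheme \<Rightarrow> 'g \<Rightarrow> 'g \<Rightarrow> 'k::field" where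
  "group_elt G g = (\<lambda>x\<in>carrier G. if x = g then 1 else 0)"

text \<open>\<open>V\<close> as a module record; it carries no product, so those two fields are left unspecified.\<close>

definition vector_module ::
    "('k::field \<Rightarrow> 'v::ab_group_add \<Rightarrow> 'v) \<Rightarrow> ('k, 'v) module" where
  "vector_module scale =
     \<lparr>carrier = UNIV, monoid.mult = undefined, one = undefined, zero = 0, add = (+),
      module.smult = scale\<rparr>"

text \<open>
  An element \<open>\<Sum>g. r\<^sub>g \<otimes> g\<close> of \<open>S(V) \<otimes> kG\<close> is the family \<open>(r\<^sub>g)\<close>. The action of \<open>g\<close> on \<open>S(V)\<close>
  applies \<open>\<rho> g\<close> to every letter; this is an automorphism of the free algebra preserving
  \<^const>\<open>sym_ideal\<close>, so the image of a residue class is a residue class. Collecting the terms of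
  \<open>(r \<otimes> g)(s \<otimes> h) = r(\<^sup>gs) \<otimes> gh\<close> with \<open>gh = x\<close> gives the formula for the product.
\<close>

definition skew_group_algebra ::
    "('g, 'm) monoid_scheme \<Rightarrow> ('k::field \<Rightarrow> 'v::ab_group_add \<Rightarrow> 'v) \<Rightarrow> ('g \<Rightarrow> 'v \<Rightarrow> 'v) \<Rightarrow>
     ('k, 'g \<Rightarrow> ('v list \<Rightarrow>\<^sub>0 'k) set) module" where
  "skew_group_algebra G scale \<rho> = (let S = sym_algebra scale in
     \<lparr>carrier = carrier G \<rightarrow>\<^sub>E carrier S,
      monoid.mult = (\<lambda>r s. \<lambda>x\<in>carrier G.
        \<Oplus>\<^bsub>S\<^esub>g\<in>carrier G. r g \<otimes>\<^bsub>S\<^esub> (free_map (\<rho> g) ` s (inv\<^bsub>G\<^esub> g \<otimes>\<^bsub>G\<^esub> x))),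
      one = (\<lambda>x\<in>carrier G. if x = \<one>\<^bsub>G\<^esub> then \<one>\<^bsub>S\<^esub> else \<zero>\<^bsub>S\<^esub>),
      zero = (\<lambda>x\<in>carrier G. \<zero>\<^bsub>S\<^esub>),
      add = (\<lambda>r s. \<lambda>x\<in>carrier G. r x \<oplus>\<^bsub>S\<^esub> s x),
      module.smult = (\<lambda>c r. \<lambda>x\<in>carrier G. c \<odot>\<^bsub>S\<^esub> r x)\<rparr>)"

definition skew_component ::
    "('g, 'm) monoid_scheme \<Rightarrow> ('k::field \<Rightarrow> 'v::ab_group_add \<Rightarrow> 'v) \<Rightarrow> nat \<Rightarrow>
     ('g \<Rightarrow> ('v list \<Rightarrow>\<^sub>0 'k) set) set" where
  "skew_component G scale d = (carrier G \<rightarrow>\<^sub>E sym_component scale d)"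

text \<open>The embeddings of \<open>V\<close> and \<open>kG\<close> into the skew group algebra.\<close>

definition skew_vector ::
    "('g, 'm) monoid_scheme \<Rightarrow> ('k::field \<Rightarrow> 'v::ab_group_add \<Rightarrow> 'v) \<Rightarrow> 'v \<Rightarrow>
     'g \<Rightarrow> ('v list \<Rightarrow>\<^sub>0 'k) set" where
  "skew_vector G scale v =
     (\<lambda>x\<in>carrier G. if x = \<one>\<^bsub>G\<^esub> then sym_class scale (letter v) else \<zero>\<^bsub>sym_algebra scale\<^esub>)"

definition skew_group ::
    "('g, 'm) monoid_scheme \<Rightarrow> ('k::field \<Rightarrow> 'v::ab_group_add \<Rightarrow> 'v) \<Rightarrow> ('g \<Rightarrow> 'k) \<Rightarrow>
     'g \<Rightarrow> ('v list \<Rightarrow>\<^sub>0 'k) set" where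
  "skew_group G scale a =
     (\<lambda>x\<in>carrier G. a x \<odot>\<^bsub>sym_algebra scale\<^esub> \<one>\<^bsub>sym_algebra scale\<^esub>)"


section \<open>The algebra H and the PBW property\<close>

text \<open>The generators are \<open>Inl v\<close> for \<open>v\<close> in \<open>V\<close> and \<open>Inr g\<close> for \<open>g\<close> in \<open>G\<close>.\<close>

definition H_generators :: "('g, 'm) monoid_scheme \<Rightarrow> ('v + 'g) set" where
  "H_generators G = range Inl \<union> Inr ` carrier G"

definition free_group_part ::
    "('g, 'm) monoid_scheme \<Rightarrow> ('g \<Rightarrow> 'k::field) \<Rightarrow> ('v + 'g) list \<Rightarrow>\<^sub>0 'k" where
  "free_group_part G a = (\<Sum>g\<in>carrier G. Poly_Mapping.single [Inr g] (a g))"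

text \<open>
  The first two families make the free algebra on the \<open>Inl v\<close> into the tensor algebra of \<open>V\<close> (the
  free algebra on a basis of \<open>V\<close>); the next two are the relations in \<open>kG\<close>.
\<close>

definition H_relations ::
    "('g, 'm) monoid_scheme \<Rightarrow> ('k::field \<Rightarrow> 'v::ab_group_add \<Rightarrow> 'v) \<Rightarrow> ('g \<Rightarrow> 'v \<Rightarrow> 'v) \<Rightarrow>
     (('g \<Rightarrow> 'k) \<Rightarrow> 'v \<Rightarrow> ('g \<Rightarrow> 'k)) \<Rightarrow> ('v \<Rightarrow> 'v \<Rightarrow> ('g \<Rightarrow> 'k)) \<Rightarrow>
     (('v + 'g) list \<Rightarrow>\<^sub>0 'k) set" where
  "H_relations G scale \<rho> lam kap =
     {letter (Inl (v + w)) - letter (Inl v) - letter (Inl w) | v w. True} \<union>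
     {letter (Inl (scale c v)) - Poly_Mapping.single 0 c * letter (Inl v) | c v. True} \<union>
     {letter (Inr \<one>\<^bsub>G\<^esub>) - 1} \<union>
     {letter (Inr g) * letter (Inr h) - letter (Inr (g \<otimes>\<^bsub>G\<^esub> h)) | g h.
        g \<in> carrier G \<and> h \<in> carrier G} \<union>
     {letter (Inl v) * letter (Inl w) - letter (Inl w) * letter (Inl v)
        - free_group_part G (kap v w) | v w. True} \<union>
     {letter (Inr g) * letter (Inl v) - letter (Inl (\<rho> g v)) * letter (Inr g)
        - free_group_part G (lam (group_elt G g) v) | g v. g \<in> carrier G}"

definition H_ideal ::
    "('g, 'm) monoid_scheme \<Rightarrow> ('k::field \<Rightarrow> 'v::ab_group_add \<Rightarrow> 'v) \<Rightarrow> ('g \<Rightarrow> 'v \<Rightarrow> 'v) \<Rightarrow>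
     (('g \<Rightarrow> 'k) \<Rightarrow> 'v \<Rightarrow> ('g \<Rightarrow> 'k)) \<Rightarrow> ('v \<Rightarrow> 'v \<Rightarrow> ('g \<Rightarrow> 'k)) \<Rightarrow>
     (('v + 'g) list \<Rightarrow>\<^sub>0 'k) set" where
  "H_ideal G scale \<rho> lam kap =
     genideal (free_algebra (H_generators G)) (H_relations G scale \<rho> lam kap)"

definition H_algebra ::
    "('g, 'm) monoid_scheme \<Rightarrow> ('k::field \<Rightarrow> 'v::ab_group_add \<Rightarrow> 'v) \<Rightarrow> ('g \<Rightarrow> 'v \<Rightarrow> 'v) \<Rightarrow>
     (('g \<Rightarrow> 'k) \<Rightarrow> 'v \<Rightarrow> ('g \<Rightarrow> 'k)) \<Rightarrow> ('v \<Rightarrow> 'v \<Rightarrow> ('g \<Rightarrow> 'k)) \<Rightarrow>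
     ('k, (('v + 'g) list \<Rightarrow>\<^sub>0 'k) set) module" where
  "H_algebra G scale \<rho> lam kap =
     quotient_algebra (free_algebra (H_generators G)) (H_ideal G scale \<rho> lam kap)"

text \<open>
  The filtration with \<open>V\<close> in degree 1 and \<open>G\<close> in degree 0: the degree of a word is the number of
  its letters in \<open>V\<close>.
\<close>

definition H_filtration ::
    "('g, 'm) monoid_scheme \<Rightarrow> ('k::field \<Rightarrow> 'v::ab_group_add \<Rightarrow> 'v) \<Rightarrow> ('g \<Rightarrow> 'v \<Rightarrow> 'v) \<Rightarrow>
     (('g \<Rightarrow> 'k) \<Rightarrow> 'v \<Rightarrow> ('g \<Rightarrow> 'k)) \<Rightarrow> ('v \<Rightarrow> 'v \<Rightarrow> ('g \<Rightarrow> 'k)) \<Rightarrow>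
     nat \<Rightarrow> (('v + 'g) list \<Rightarrow>\<^sub>0 'k) set set" where
  "H_filtration G scale \<rho> lam kap d =
     {H_ideal G scale \<rho> lam kap +>\<^bsub>free_algebra (H_generators G)\<^esub> p | p.
        p \<in> carrier (free_algebra (H_generators G)) \<and>
        (\<forall>w\<in>Poly_Mapping.keys p. length (filter isl w) \<le> d)}"

text \<open>
  The associated graded algebra of an algebra \<open>B\<close> with filtration \<open>F\<close> is the direct sum of the
  quotients \<open>F d / F (d - 1)\<close>, where \<open>F (-1) = 0\<close>. Its elements are finitely supported families of
  cosets; the zero of the \<open>d\<close>-th summand is the coset \<open>F (d - 1)\<close>. The set on the right of \<open>mult\<close>
  is the coset of \<open>\<Sum>i\<le>d. a\<^sub>i b\<^sub>d\<^sub>-\<^sub>i\<close> for any representatives \<open>a\<^sub>i\<close> of \<open>x i\<close> and \<open>b\<^sub>j\<close> of \<open>y j\<close>.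
\<close>

definition filt_below :: "('r, 'b) module \<Rightarrow> (nat \<Rightarrow> 'b set) \<Rightarrow> nat \<Rightarrow> 'b set" where
  "filt_below B F d = (case d of 0 \<Rightarrow> {\<zero>\<^bsub>B\<^esub>} | Suc e \<Rightarrow> F e)"

definition assoc_graded :: "('r, 'b) module \<Rightarrow> (nat \<Rightarrow> 'b set) \<Rightarrow> ('r, nat \<Rightarrow> 'b set) module" where
  "assoc_graded B F =
     \<lparr>carrier = {x. (\<forall>d. x d \<in> {filt_below B F d +>\<^bsub>B\<^esub> a | a. a \<in> F d}) \<and>
                    finite {d. x d \<noteq> filt_below B F d}},
      monoid.mult = (\<lambda>x y d. filt_below B F d <+>\<^bsub>B\<^esub>
        {\<Oplus>\<^bsub>B\<^esub>i\<in>{..d}. a i \<otimes>\<^bsub>B\<^esub> b (d - i) | a b. (\<forall>i. a i \<in> x i) \<and> (\<forall>i. b i \<in> y i)}),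
      one = (\<lambda>d. if d = 0 then filt_below B F 0 +>\<^bsub>B\<^esub> \<one>\<^bsub>B\<^esub> else filt_below B F d),
      zero = filt_below B F,
      add = (\<lambda>x y d. x d <+>\<^bsub>B\<^esub> y d),
      module.smult = (\<lambda>c x d. filt_below B F d <+>\<^bsub>B\<^esub> {c \<odot>\<^bsub>B\<^esub> a | a. a \<in> x d})\<rparr>"

definition assoc_graded_component ::
    "('r, 'b) module \<Rightarrow> (nat \<Rightarrow> 'b set) \<Rightarrow> nat \<Rightarrow> (nat \<Rightarrow> 'b set) set" where
  "assoc_graded_component B F d =
     {x \<in> carrier (assoc_graded B F). \<forall>e. e \<noteq> d \<longrightarrow> x e = filt_below B F e}"

definition PBW_property ::
    "('g, 'm) monoid_scheme \<Rightarrow> ('k::field \<Rightarrow> 'v::ab_group_add \<Rightarrow> 'v) \<Rightarrow> ('g \<Rightarrow> 'v \<Rightarrow> 'v) \<Rightarrow>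
     (('g \<Rightarrow> 'k) \<Rightarrow> 'v \<Rightarrow> ('g \<Rightarrow> 'k)) \<Rightarrow> ('v \<Rightarrow> 'v \<Rightarrow> ('g \<Rightarrow> 'k)) \<Rightarrow> bool" where
  "PBW_property G scale \<rho> lam kap \<longleftrightarrow>
     graded_alg_isomorphic
       (assoc_graded (H_algebra G scale \<rho> lam kap) (H_filtration G scale \<rho> lam kap))
       (assoc_graded_component (H_algebra G scale \<rho> lam kap) (H_filtration G scale \<rho> lam kap))
       (skew_group_algebra G scale \<rho>) (skew_component G scale)"


section \<open>Deformations\<close>

text \<open>
  The space \<open>A[t]\<close> is the carrier of \<^term>\<open>UP A\<close> (coefficient sequences), with the
  \<open>k[t]\<close>-bilinear product given on \<open>a, b \<in> A\<close> by \<open>a * b = \<Sum>j. \<mu> j a b t\<^sup>j\<close>: the coefficient of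
  \<open>t\<^sup>n\<close> in \<open>p * q\<close> is the sum of \<open>\<mu> l (p i) (q j)\<close> over \<open>i + j + l = n\<close>.
\<close>

definition deformation_algebra ::
    "('k::field, 'a) module \<Rightarrow> (nat \<Rightarrow> 'a \<Rightarrow> 'a \<Rightarrow> 'a) \<Rightarrow> ('k poly, nat \<Rightarrow> 'a) module" where
  "deformation_algebra A \<mu> =
     \<lparr>carrier = carrier (UP A),
      monoid.mult = (\<lambda>p\<in>carrier (UP A). \<lambda>q\<in>carrier (UP A). \<lambda>n.
        \<Oplus>\<^bsub>A\<^esub>i\<in>{..n}. \<Oplus>\<^bsub>A\<^esub>j\<in>{..n - i}. \<mu> (n - i - j) (p i) (q j)),
      one = \<one>\<^bsub>UP A\<^esub>, zero = \<zero>\<^bsub>UP A\<^esub>, add = ring.add (UP A),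
      module.smult = (\<lambda>c. \<lambda>p\<in>carrier (UP A). \<lambda>n.
        \<Oplus>\<^bsub>A\<^esub>i\<in>{..n}. Polynomial.coeff c i \<odot>\<^bsub>A\<^esub> p (n - i))\<rparr>"

text \<open>A deformation is determined by its multiplication maps, where \<open>\<mu> 0\<close> is the product of \<open>A\<close>.\<close>

definition deformation :: "('k::field, 'a) module \<Rightarrow> (nat \<Rightarrow> 'a \<Rightarrow> 'a \<Rightarrow> 'a) \<Rightarrow> bool" where
  "deformation A \<mu> \<longleftrightarrow>
     (\<forall>a\<in>carrier A. \<forall>b\<in>carrier A. \<mu> 0 a b = a \<otimes>\<^bsub>A\<^esub> b) \<and>
     (\<forall>j. bilinear_map A A A (\<mu> j)) \<and>
     (\<forall>a\<in>carrier A. \<forall>b\<in>carrier A. finite {j. \<mu> j a b \<noteq> \<zero>\<^bsub>A\<^esub>}) \<and>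
     assoc_algebra (deformation_algebra A \<mu>)"

definition graded_deformation ::
    "('k::field, 'a) module \<Rightarrow> (nat \<Rightarrow> 'a set) \<Rightarrow> (nat \<Rightarrow> 'a \<Rightarrow> 'a \<Rightarrow> 'a) \<Rightarrow> bool" where
  "graded_deformation A gA \<mu> \<longleftrightarrow> deformation A \<mu> \<and>
     (\<forall>j d e. \<forall>a\<in>gA d. \<forall>b\<in>gA e.
        if j \<le> d + e then \<mu> j a b \<in> gA (d + e - j) else \<mu> j a b = \<zero>\<^bsub>A\<^esub>)"

text \<open>The quotient \<open>B / (t - 1) B\<close>, regarded as an algebra over \<open>k\<close>; \<open>[:-1, 1:]\<close> is \<open>t - 1\<close>.\<close>

definition fiber_at_one :: "('k::field poly, 'b) module \<Rightarrow> ('k, 'b set) module" where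
  "fiber_at_one B =
     (let Q = quotient_algebra B ((\<lambda>x. [:-1, 1:] \<odot>\<^bsub>B\<^esub> x) ` carrier B) in
      \<lparr>carrier = carrier Q, monoid.mult = monoid.mult Q, one = \<one>\<^bsub>Q\<^esub>, zero = \<zero>\<^bsub>Q\<^esub>, add = ring.add Q,
       module.smult = (\<lambda>c. module.smult Q [:c:])\<rparr>)"

end

theory Submission
  imports Defs "HOL-Computational_Algebra.Formal_Power_Series"
begin

text \<open>
  Rees's construction. Choose a graded linear normal form on \<open>S(V)\<close> by words in \<open>V\<close>; it yields a
  linear section \<open>\<theta>\<close> of \<open>A = S(V) # G\<close> into the free algebra that presents \<open>H\<close>. The PBW property
  makes \<open>\<theta>\<close> a filtered linear isomorphism \<open>A \<cong> H\<close>. For \<open>a\<close>, \<open>b\<close> homogeneous of degrees \<open>d\<close>, \<open>e\<close>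
  let \<open>\<mu> j a b\<close> be the component of degree \<open>d + e - j\<close> of the product of \<open>\<theta> a\<close> and \<open>\<theta> b\<close>
  in \<open>H\<close>. Then \<open>A[t]\<close> is the Rees algebra of \<open>H\<close>, which gives associativity, and setting \<open>t = 1\<close> recovers
  \<open>H\<close>. As \<open>\<theta>\<close> is the identity on \<open>V\<close> and on \<open>G\<close> modulo the relations, the commutators of \<open>\<mu> 1\<close> and
  \<open>\<mu> 2\<close> are \<open>\<lambda>\<close> and \<open>\<kappa>\<close>.
\<close>


section \<open>Deformations from filtered linear sections\<close>

text \<open>In characteristic 0 symmetrization is a canonical section from S(V) to words, but it
  divides by d! in degree d and so breaks down in positive characteristic. The section is therefore
  chosen by linear algebra; nothing makes it G-equivariant or multiplicative, it only respects
  degrees. That suffices because the relations of H agree with those of A up to terms of lower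
  degree: the leading terms of two section values multiply in H as in A, which forces
  \<open>\<mu> 0\<close> to be the product of A, and every correction lowers the degree, which makes
  the sum over j finite.

  The argument has two halves. The abstract one knows only a ring P, an ideal J, the section, and
  maps \<open>\<nu> m\<close> that give the degree m part of a normal form modulo J. It computes
  with representatives in P; as \<open>\<nu> m\<close> kills J, it turns congruences into equations.
  The concrete half builds these data from words. Straightening shows that the section is onto
  modulo J; its injectivity modulo J is what the PBW property has to deliver.\<close>

locale filtered_section =
  fixes A :: "('k::field, 'a) module"
    and P J :: "'p::ring_1 set"
    and \<iota> :: "'k \<Rightarrow> 'p"
    and \<theta> :: "'a \<Rightarrow> 'p"
    and \<nu> :: "nat \<Rightarrow> 'p \<Rightarrow> 'p"
  assumes abelian_A: "abelian_group A"
    and A_smult: "x \<in> carrier A \<Longrightarrow> c \<odot>\<^bsub>A\<^esub> x \<in> carrier A"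
    and A_mult: "x \<in> carrier A \<Longrightarrow> y \<in> carrier A \<Longrightarrow> x \<otimes>\<^bsub>A\<^esub> y \<in> carrier A"
    and A_one: "\<one>\<^bsub>A\<^esub> \<in> carrier A"
    and P_1: "1 \<in> P" and P_add: "p \<in> P \<Longrightarrow> q \<in> P \<Longrightarrow> p + q \<in> P"
    and P_uminus: "p \<in> P \<Longrightarrow> - p \<in> P" and P_mult: "p \<in> P \<Longrightarrow> q \<in> P \<Longrightarrow> p * q \<in> P"
    and P_\<iota>: "\<iota> c \<in> P"
    and \<iota>_1: "\<iota> 1 = 1" and \<iota>_add: "\<iota> (c + c') = \<iota> c + \<iota> c'"
    and \<iota>_mult: "\<iota> (c * c') = \<iota> c * \<iota> c'" and \<iota>_comm: "\<iota> c * p = p * \<iota> c"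
    and J_P: "J \<subseteq> P" and J_0: "0 \<in> J" and J_add: "p \<in> J \<Longrightarrow> q \<in> J \<Longrightarrow> p + q \<in> J"
    and J_uminus: "p \<in> J \<Longrightarrow> - p \<in> J"
    and J_l: "p \<in> P \<Longrightarrow> q \<in> J \<Longrightarrow> p * q \<in> J" and J_r: "p \<in> J \<Longrightarrow> q \<in> P \<Longrightarrow> p * q \<in> J"
    and \<theta>_P: "a \<in> carrier A \<Longrightarrow> \<theta> a \<in> P"
    and \<theta>_add: "a \<in> carrier A \<Longrightarrow> b \<in> carrier A \<Longrightarrow> \<theta> (a \<oplus>\<^bsub>A\<^esub> b) = \<theta> a + \<theta> b"
    and \<theta>_smult: "a \<in> carrier A \<Longrightarrow> \<theta> (c \<odot>\<^bsub>A\<^esub> a) = \<iota> c * \<theta> a"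
    and \<theta>_one: "\<theta> \<one>\<^bsub>A\<^esub> - 1 \<in> J"
    and \<theta>_surj: "p \<in> P \<Longrightarrow> \<exists>a\<in>carrier A. \<theta> a - p \<in> J"
    and \<theta>_inj: "a \<in> carrier A \<Longrightarrow> \<theta> a \<in> J \<Longrightarrow> a = \<zero>\<^bsub>A\<^esub>"
    and \<nu>_P: "p \<in> P \<Longrightarrow> \<nu> m p \<in> P"
    and \<nu>_add: "p \<in> P \<Longrightarrow> q \<in> P \<Longrightarrow> \<nu> m (p + q) = \<nu> m p + \<nu> m q"
    and \<nu>_scale: "p \<in> P \<Longrightarrow> \<nu> m (\<iota> c * p) = \<iota> c * \<nu> m p"
    and \<nu>_finite: "p \<in> P \<Longrightarrow> finite {m. \<nu> m p \<noteq> 0}"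
    and \<nu>_sum: "p \<in> P \<Longrightarrow> p - (\<Sum>m | \<nu> m p \<noteq> 0. \<nu> m p) \<in> J"
    and \<nu>_J: "p \<in> J \<Longrightarrow> \<nu> m p = 0"
    and \<nu>_\<nu>: "p \<in> P \<Longrightarrow> \<nu> m (\<nu> d p) = (if m = d then \<nu> d p else 0)"
    and \<nu>_one: "m \<noteq> 0 \<Longrightarrow> \<nu> m 1 = 0"
    and \<nu>_filtered: "p \<in> P \<Longrightarrow> q \<in> P \<Longrightarrow> d + e < m \<Longrightarrow> \<nu> m (\<nu> d p * \<nu> e q) = 0"
    and \<theta>_mult: "a \<in> carrier A \<Longrightarrow> b \<in> carrier A \<Longrightarrow>
      \<nu> m (\<theta> (a \<otimes>\<^bsub>A\<^esub> b)) = (\<Sum>d\<le>m. \<nu> m (\<nu> d (\<theta> a) * \<nu> (m - d) (\<theta> b)))"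
begin

sublocale A: abelian_group A
  by (rule abelian_A)

text \<open>The maps \<open>\<nu> m\<close> vanish on J, are orthogonal idempotents and add up to
  the identity modulo J. So this is the degree m part of a, recorded in P; the grading of A enters
  the abstract half in no other form.\<close>

definition comp :: "nat \<Rightarrow> 'a \<Rightarrow> 'p" where
  "comp m a = \<nu> m (\<theta> a)"

definition lift :: "'p \<Rightarrow> 'a" where
  "lift p = (SOME a. a \<in> carrier A \<and> \<theta> a - p \<in> J)"

text \<open>Factors of degrees d and e contribute their product's degree m part to the
  multiplication map with index j = d + e - m. For given j and m the degrees of the factors thus add
  up to m + j.\<close>

definition star_comp :: "nat \<Rightarrow> nat \<Rightarrow> 'p \<Rightarrow> 'p \<Rightarrow> 'p" where
  "star_comp j m p q = (\<Sum>d\<le>m + j. \<nu> m (\<nu> d p * \<nu> (m + j - d) q))"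

text \<open>The index set is finite by \<open>star_comp_finite\<close>; over an infinite set the sum
  would be 0 by convention.\<close>

definition star :: "nat \<Rightarrow> 'p \<Rightarrow> 'p \<Rightarrow> 'p" where
  "star j p q = (\<Sum>m | star_comp j m p q \<noteq> 0. star_comp j m p q)"

definition \<mu> :: "nat \<Rightarrow> 'a \<Rightarrow> 'a \<Rightarrow> 'a" where
  "\<mu> j a b = lift (star j (\<theta> a) (\<theta> b))"

lemma P_0 [simp]: "0 \<in> P"
  using J_0 J_P by blast

lemma P_diff: "p \<in> P \<Longrightarrow> q \<in> P \<Longrightarrow> p - q \<in> P"
  using P_add[of p "- q"] P_uminus by simp

lemma P_sum: "(\<And>i. i \<in> S \<Longrightarrow> f i \<in> P) \<Longrightarrow> sum f S \<in> P"
  by (induction S rule: infinite_finite_induct) (auto intro: P_add)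

lemma J_diff: "p \<in> J \<Longrightarrow> q \<in> J \<Longrightarrow> p - q \<in> J"
  using J_add[of p "- q"] J_uminus by simp

lemma J_sum: "(\<And>i. i \<in> S \<Longrightarrow> f i \<in> J) \<Longrightarrow> sum f S \<in> J"
  by (induction S rule: infinite_finite_induct) (auto intro: J_add J_0)

lemma \<iota>_0 [simp]: "\<iota> 0 = 0"
  using \<iota>_add[of 0 0] by simp

lemma \<nu>_0 [simp]: "\<nu> m 0 = 0"
  using J_0 \<nu>_J by blast

lemma \<nu>_uminus: "p \<in> P \<Longrightarrow> \<nu> m (- p) = - \<nu> m p"
  using \<nu>_add[of p "- p" m] P_uminus by (simp add: eq_neg_iff_add_eq_0 add.commute)

lemma \<nu>_diff: "p \<in> P \<Longrightarrow> q \<in> P \<Longrightarrow> \<nu> m (p - q) = \<nu> m p - \<nu> m q"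
  using \<nu>_add[of p "- q" m] P_uminus \<nu>_uminus by simp

lemma \<nu>_sum_distrib: "(\<And>i. i \<in> S \<Longrightarrow> f i \<in> P) \<Longrightarrow> \<nu> m (sum f S) = (\<Sum>i\<in>S. \<nu> m (f i))"
  by (induction S rule: infinite_finite_induct) (auto simp: \<nu>_add P_sum)

lemma \<nu>_cong: "p \<in> P \<Longrightarrow> q \<in> P \<Longrightarrow> p - q \<in> J \<Longrightarrow> \<nu> m p = \<nu> m q"
  using \<nu>_J \<nu>_diff by (metis right_minus_eq)

text \<open>An element is congruent to the sum of its components, so it lies in J once they all
  vanish. Congruences can thus be tested degree by degree.\<close>

lemma J_iff: "p \<in> P \<Longrightarrow> p \<in> J \<longleftrightarrow> (\<forall>m. \<nu> m p = 0)"
  using \<nu>_sum[of p] by (auto simp: \<nu>_J)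

lemma \<nu>_sum_superset:
  assumes "p \<in> P" "finite S" "\<And>m. m \<notin> S \<Longrightarrow> \<nu> m p = 0"
  shows "p - (\<Sum>m\<in>S. \<nu> m p) \<in> J"
proof -
  have "(\<Sum>m | \<nu> m p \<noteq> 0. \<nu> m p) = (\<Sum>m\<in>S. \<nu> m p)"
    by (rule sum.mono_neutral_left) (use assms in auto)
  with \<nu>_sum[OF assms(1)] show ?thesis
    by simp
qed

lemma \<theta>_zero: "\<theta> \<zero>\<^bsub>A\<^esub> = 0"
  using \<theta>_add[of "\<zero>\<^bsub>A\<^esub>" "\<zero>\<^bsub>A\<^esub>"] by simp

lemma \<theta>_uminus: "a \<in> carrier A \<Longrightarrow> \<theta> (\<ominus>\<^bsub>A\<^esub> a) = - \<theta> a"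
  using \<theta>_add[of a "\<ominus>\<^bsub>A\<^esub> a"] by (simp add: A.r_neg \<theta>_zero eq_neg_iff_add_eq_0 add.commute)

lemma \<theta>_finsum: "f \<in> S \<rightarrow> carrier A \<Longrightarrow> \<theta> (\<Oplus>\<^bsub>A\<^esub>i\<in>S. f i) = (\<Sum>i\<in>S. \<theta> (f i))"
  by (induction S rule: infinite_finite_induct)
     (auto simp: \<theta>_zero A.finsum_insert \<theta>_add A.finsum_closed)

lemma comp_P: "a \<in> carrier A \<Longrightarrow> comp m a \<in> P"
  by (simp add: comp_def \<theta>_P \<nu>_P)

lemma comp_add: "a \<in> carrier A \<Longrightarrow> b \<in> carrier A \<Longrightarrow> comp m (a \<oplus>\<^bsub>A\<^esub> b) = comp m a + comp m b"
  by (simp add: comp_def \<theta>_add \<theta>_P \<nu>_add)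

lemma comp_zero [simp]: "comp m \<zero>\<^bsub>A\<^esub> = 0"
  by (simp add: comp_def \<theta>_zero)

lemma comp_smult: "a \<in> carrier A \<Longrightarrow> comp m (c \<odot>\<^bsub>A\<^esub> a) = \<iota> c * comp m a"
  by (simp add: comp_def \<theta>_smult \<theta>_P \<nu>_scale)

lemma comp_uminus: "a \<in> carrier A \<Longrightarrow> comp m (\<ominus>\<^bsub>A\<^esub> a) = - comp m a"
  by (simp add: comp_def \<theta>_uminus \<theta>_P \<nu>_uminus)

lemma comp_minus: "a \<in> carrier A \<Longrightarrow> b \<in> carrier A \<Longrightarrow> comp m (a \<ominus>\<^bsub>A\<^esub> b) = comp m a - comp m b"
  by (simp add: a_minus_def comp_add comp_uminus)

lemma comp_finsum: "f \<in> S \<rightarrow> carrier A \<Longrightarrow> comp m (\<Oplus>\<^bsub>A\<^esub>i\<in>S. f i) = (\<Sum>i\<in>S. comp m (f i))"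
  unfolding comp_def by (subst \<theta>_finsum) (auto intro!: \<nu>_sum_distrib \<theta>_P)

lemma comp_finite: "a \<in> carrier A \<Longrightarrow> finite {m. comp m a \<noteq> 0}"
  by (simp add: comp_def \<theta>_P \<nu>_finite)

lemma \<nu>_comp: "a \<in> carrier A \<Longrightarrow> \<nu> m (comp d a) = (if m = d then comp d a else 0)"
  by (simp add: comp_def \<theta>_P \<nu>_\<nu>)

text \<open>Equal components put the section value of the difference into J, where the section is
  injective. Identities in A are proved below through their components.\<close>

lemma comp_eqI:
  assumes "a \<in> carrier A" "b \<in> carrier A" "\<And>m. comp m a = comp m b"
  shows "a = b"
proof -
  have "\<theta> (a \<ominus>\<^bsub>A\<^esub> b) \<in> J"
    using assms by (subst J_iff) (auto simp: \<theta>_P comp_minus comp_def[symmetric])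
  then have "a \<ominus>\<^bsub>A\<^esub> b = \<zero>\<^bsub>A\<^esub>"
    using assms by (intro \<theta>_inj) auto
  with assms show ?thesis
    by (metis A.a_inv_closed A.minus_eq A.minus_equality A.minus_minus)
qed

lemma lift_props:
  assumes "p \<in> P"
  shows lift_A: "lift p \<in> carrier A" and \<theta>_lift: "\<theta> (lift p) - p \<in> J"
  using someI_ex[of "\<lambda>a. a \<in> carrier A \<and> \<theta> a - p \<in> J"] \<theta>_surj[OF assms]
  unfolding lift_def by blast+

lemma comp_lift: "p \<in> P \<Longrightarrow> comp m (lift p) = \<nu> m p"
  unfolding comp_def by (rule \<nu>_cong) (simp_all add: lift_A \<theta>_lift \<theta>_P)

lemma star_comp_P: "p \<in> P \<Longrightarrow> q \<in> P \<Longrightarrow> star_comp j m p q \<in> P"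
  by (auto simp: star_comp_def intro!: P_sum \<nu>_P P_mult)

text \<open>Beyond the top degrees of p and q one of the two factors is 0. The bound is uniform in j
  and m, so it gives finiteness in m for \<open>star_comp_finite\<close> and finiteness in j for
  \<open>\<mu>_finite\<close>.\<close>

lemma star_comp_bound:
  assumes "p \<in> P" "q \<in> P"
  obtains N where "\<And>j m. N < m + j \<Longrightarrow> star_comp j m p q = 0"
proof -
  obtain D E where D: "\<And>d. D < d \<Longrightarrow> \<nu> d p = 0" and E: "\<And>e. E < e \<Longrightarrow> \<nu> e q = 0"
    using \<nu>_finite[OF assms(1)] \<nu>_finite[OF assms(2)]
    by (metis (mono_tags, lifting) finite_nat_set_iff_bounded mem_Collect_eq not_less_iff_gr_or_eq)
  have "star_comp j m p q = 0" if "D + E < m + j" for j m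
    unfolding star_comp_def
  proof (rule sum.neutral, rule ballI)
    fix d
    have "D < d \<or> E < m + j - d"
      using that by linarith
    then show "\<nu> m (\<nu> d p * \<nu> (m + j - d) q) = 0"
      using D E by auto
  qed
  then show thesis
    using that by blast
qed

lemma star_comp_finite:
  assumes "p \<in> P" "q \<in> P"
  shows "finite {m. star_comp j m p q \<noteq> 0}"
proof -
  obtain N where "\<And>j m. N < m + j \<Longrightarrow> star_comp j m p q = 0"
    using star_comp_bound[OF assms] by metis
  then have "{m. star_comp j m p q \<noteq> 0} \<subseteq> {..N}"
    using not_le_imp_less trans_less_add1 by blast
  then show ?thesis
    using finite_subset by blast
qed

lemma \<nu>_star_comp:
  assumes "p \<in> P" "q \<in> P"
  shows "\<nu> n (star_comp j m p q) = (if n = m then star_comp j m p q else 0)"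
  using assms unfolding star_comp_def
  by (subst \<nu>_sum_distrib) (auto simp: \<nu>_P P_mult \<nu>_\<nu>)

lemma star_P: "p \<in> P \<Longrightarrow> q \<in> P \<Longrightarrow> star j p q \<in> P"
  by (auto simp: star_def intro!: P_sum star_comp_P)

lemma \<nu>_star:
  assumes "p \<in> P" "q \<in> P"
  shows "\<nu> m (star j p q) = star_comp j m p q"
proof -
  have "\<nu> m (star j p q) = (\<Sum>n | star_comp j n p q \<noteq> 0. if m = n then star_comp j n p q else 0)"
    unfolding star_def using assms
    by (subst \<nu>_sum_distrib) (auto simp: star_comp_P \<nu>_star_comp)
  also have "\<dots> = star_comp j m p q"
    using star_comp_finite[OF assms] by (subst sum.delta') auto
  finally show ?thesis .
qed

lemma \<mu>_A: "a \<in> carrier A \<Longrightarrow> b \<in> carrier A \<Longrightarrow> \<mu> j a b \<in> carrier A"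
  by (simp add: \<mu>_def lift_A star_P \<theta>_P)

lemma comp_\<mu>:
  assumes "a \<in> carrier A" "b \<in> carrier A"
  shows "comp m (\<mu> j a b) = (\<Sum>d\<le>m + j. \<nu> m (comp d a * comp (m + j - d) b))"
  using assms
  by (simp add: \<mu>_def comp_lift star_P \<theta>_P \<nu>_star star_comp_def comp_def[symmetric])

text \<open>For j = 0 the component formula \<open>comp_\<mu>\<close> is the right-hand side of
  \<open>\<theta>_mult\<close>, the compatibility of leading terms with the product of A.\<close>

lemma \<mu>_0: "a \<in> carrier A \<Longrightarrow> b \<in> carrier A \<Longrightarrow> \<mu> 0 a b = a \<otimes>\<^bsub>A\<^esub> b"
  by (rule comp_eqI) (simp_all add: \<mu>_A A_mult comp_\<mu>, simp add: comp_def \<theta>_mult)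

lemma \<mu>_bilinear: "bilinear_map A A A (\<mu> j)"
proof -
  have "\<mu> j (a \<oplus>\<^bsub>A\<^esub> a') b = \<mu> j a b \<oplus>\<^bsub>A\<^esub> \<mu> j a' b"
    if "a \<in> carrier A" "a' \<in> carrier A" "b \<in> carrier A" for a a' b
    by (rule comp_eqI) (use that in \<open>simp_all add: \<mu>_A comp_\<mu> comp_add distrib_right \<nu>_add
      comp_P P_mult sum.distrib\<close>)
  moreover have "\<mu> j b (a \<oplus>\<^bsub>A\<^esub> a') = \<mu> j b a \<oplus>\<^bsub>A\<^esub> \<mu> j b a'"
    if "a \<in> carrier A" "a' \<in> carrier A" "b \<in> carrier A" for a a' b
    by (rule comp_eqI) (use that in \<open>simp_all add: \<mu>_A comp_\<mu> comp_add distrib_left \<nu>_add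
      comp_P P_mult sum.distrib\<close>)
  moreover have "\<mu> j (c \<odot>\<^bsub>A\<^esub> a) b = c \<odot>\<^bsub>A\<^esub> \<mu> j a b"
    if "a \<in> carrier A" "b \<in> carrier A" for c a b
    by (rule comp_eqI) (use that in \<open>simp_all add: \<mu>_A A_smult comp_\<mu> comp_smult mult.assoc \<nu>_scale
      comp_P P_mult sum_distrib_left\<close>)
  moreover have "\<mu> j a (c \<odot>\<^bsub>A\<^esub> b) = c \<odot>\<^bsub>A\<^esub> \<mu> j a b"
    if "a \<in> carrier A" "b \<in> carrier A" for c a b
  proof (rule comp_eqI)
    have "x * (\<iota> c * y) = \<iota> c * (x * y)" for x y
      by (metis \<iota>_comm mult.assoc)
    then show "comp m (\<mu> j a (c \<odot>\<^bsub>A\<^esub> b)) = comp m (c \<odot>\<^bsub>A\<^esub> \<mu> j a b)" for m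
      using that by (simp add: \<mu>_A A_smult comp_\<mu> comp_smult \<nu>_scale comp_P P_mult sum_distrib_left)
  qed (use that in \<open>simp_all add: \<mu>_A A_smult\<close>)
  ultimately show ?thesis
    unfolding bilinear_map_def by (simp add: \<mu>_A)
qed

lemma \<mu>_finite:
  assumes "a \<in> carrier A" "b \<in> carrier A"
  shows "finite {j. \<mu> j a b \<noteq> \<zero>\<^bsub>A\<^esub>}"
proof -
  obtain N where N: "\<And>j m. N < m + j \<Longrightarrow> star_comp j m (\<theta> a) (\<theta> b) = 0"
    using star_comp_bound[OF assms[THEN \<theta>_P]] by metis
  have "\<mu> j a b = \<zero>\<^bsub>A\<^esub>" if "N < j" for j
    by (rule comp_eqI)
       (use assms that N in \<open>simp_all add: \<mu>_def lift_A comp_lift star_P \<theta>_P \<nu>_star\<close>)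
  then have "{j. \<mu> j a b \<noteq> \<zero>\<^bsub>A\<^esub>} \<subseteq> {..N}"
    using not_le_imp_less by blast
  then show ?thesis
    using finite_subset by blast
qed

text \<open>Only the summand with index d survives, and its second factor forces m + j = d + e. This
  is where the degree -j of the j-th multiplication map comes from.\<close>

lemma comp_\<mu>_homogeneous:
  assumes "a \<in> carrier A" "b \<in> carrier A"
    and "\<And>m. m \<noteq> d \<Longrightarrow> comp m a = 0" "\<And>m. m \<noteq> e \<Longrightarrow> comp m b = 0"
  shows "comp m (\<mu> j a b) = (if m + j = d + e then \<nu> m (comp d a * comp e b) else 0)"
proof -
  have "comp m (\<mu> j a b) = (\<Sum>i\<le>m + j. if i = d then \<nu> m (comp d a * comp (m + j - d) b) else 0)"
    unfolding comp_\<mu>[OF assms(1,2)] by (rule sum.cong) (use assms(3) in auto)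
  also have "\<dots> = (if d \<le> m + j then \<nu> m (comp d a * comp (m + j - d) b) else 0)"
    by simp
  also have "\<dots> = (if m + j = d + e then \<nu> m (comp d a * comp e b) else 0)"
    using assms(4) by auto
  finally show ?thesis .
qed

end

text \<open>Setting t = 1 is a ring homomorphism on polynomials. With power series in their place,
  bounds on the degrees stand in for polynomiality.\<close>

lemma sum_fps_mult:
  fixes F G :: "'a::ring_1 fps"
  assumes F: "\<And>n. a < n \<Longrightarrow> F $ n = 0" and G: "\<And>n. b < n \<Longrightarrow> G $ n = 0" and "a + b \<le> N"
  shows "(\<Sum>n\<le>N. (F * G) $ n) = (\<Sum>n\<le>a. F $ n) * (\<Sum>n\<le>b. G $ n)"
proof -
  have "(\<Sum>n\<le>N. (F * G) $ n) = (\<Sum>n\<le>N. \<Sum>i\<le>n. F $ i * G $ (n - i))"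
    by (simp add: fps_mult_nth atMost_atLeast0)
  also have "\<dots> = (\<Sum>i\<le>N. \<Sum>j\<le>N - i. F $ i * G $ j)"
    by (simp add: sum.Sigma, rule sum.reindex_bij_witness
      [where i = "\<lambda>(i, j). (i + j, i)" and j = "\<lambda>(n, i). (i, n - i)"]) auto
  also have "\<dots> = (\<Sum>i\<le>N. F $ i * (\<Sum>j\<le>b. G $ j))"
  proof (rule sum.cong)
    fix i
    show "(\<Sum>j\<le>N - i. F $ i * G $ j) = F $ i * (\<Sum>j\<le>b. G $ j)"
    \<comment> \<open>For i at most a the hypothesis a + b \<le> N leaves room for every j up to b;
      for larger i the factor \<open>F $ i\<close> is 0.\<close>
    proof (cases "i \<le> a")
      case True
      have "(\<Sum>j\<le>N - i. G $ j) = (\<Sum>j\<le>b. G $ j)"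
        by (rule sum.mono_neutral_right) (use True assms in auto)
      then show ?thesis
        by (simp add: sum_distrib_left[symmetric])
    qed (simp add: F)
  qed simp
  also have "\<dots> = (\<Sum>i\<le>a. F $ i * (\<Sum>j\<le>b. G $ j))"
    by (rule sum.mono_neutral_right) (use assms in auto)
  finally show ?thesis
    by (simp add: sum_distrib_right)
qed

section \<open>The deformation as a Rees algebra modulo J\<close>

context filtered_section
begin

abbreviation D :: "('k poly, nat \<Rightarrow> 'a) module" where
  "D \<equiv> deformation_algebra A \<mu>"

text \<open>
  The map \<open>a t\<^sup>i \<mapsto> \<theta> a t\<^sup>i\<^sup>+\<^sup>d\<close>, for \<open>a\<close> homogeneous of degree \<open>d\<close>, identifies the deformation
  with the Rees algebra of the filtered algebra \<open>P / J\<close>. As \<open>P\<close> is noncommutative, power series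
  take the place of polynomials.
\<close>

definition rees :: "(nat \<Rightarrow> 'a) \<Rightarrow> 'p fps" where
  "rees p = Abs_fps (\<lambda>n. \<Sum>i\<le>n. comp (n - i) (p i))"

definition P_fps :: "'p fps set" where
  "P_fps = {F. \<forall>n. F $ n \<in> P}"

definition J_fps :: "'p fps set" where
  "J_fps = {F. \<forall>n. F $ n \<in> J}"

definition \<iota>_poly :: "'k poly \<Rightarrow> 'p fps" where
  "\<iota>_poly c = Abs_fps (\<lambda>n. \<iota> (Polynomial.coeff c n))"

lemma up_iff: "p \<in> up A \<longleftrightarrow> (\<forall>i. p i \<in> carrier A) \<and> (\<exists>N. \<forall>i>N. p i = \<zero>\<^bsub>A\<^esub>)"
  unfolding up_def bound_def by auto

lemma up_A [simp]: "p \<in> up A \<Longrightarrow> p i \<in> carrier A"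
  by (simp add: up_iff)

lemma D_carrier: "carrier D = up A"
  by (simp add: deformation_algebra_def UP_def)

lemma D_mult: "p \<in> up A \<Longrightarrow> q \<in> up A \<Longrightarrow> p \<otimes>\<^bsub>D\<^esub> q =
    (\<lambda>n. \<Oplus>\<^bsub>A\<^esub>i\<in>{..n}. \<Oplus>\<^bsub>A\<^esub>j\<in>{..n - i}. \<mu> (n - i - j) (p i) (q j))"
  by (simp add: deformation_algebra_def UP_def)

lemma D_add: "p \<in> up A \<Longrightarrow> q \<in> up A \<Longrightarrow> p \<oplus>\<^bsub>D\<^esub> q = (\<lambda>n. p n \<oplus>\<^bsub>A\<^esub> q n)"
  by (simp add: deformation_algebra_def UP_def)

lemma D_zero: "\<zero>\<^bsub>D\<^esub> = (\<lambda>n. \<zero>\<^bsub>A\<^esub>)"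
  by (simp add: deformation_algebra_def UP_def)

lemma D_one: "\<one>\<^bsub>D\<^esub> = (\<lambda>n. if n = 0 then \<one>\<^bsub>A\<^esub> else \<zero>\<^bsub>A\<^esub>)"
  by (simp add: deformation_algebra_def UP_def)

lemma D_smult: "p \<in> up A \<Longrightarrow>
    c \<odot>\<^bsub>D\<^esub> p = (\<lambda>n. \<Oplus>\<^bsub>A\<^esub>i\<in>{..n}. Polynomial.coeff c i \<odot>\<^bsub>A\<^esub> p (n - i))"
  by (simp add: deformation_algebra_def UP_def)

lemma rees_nth: "rees p $ n = (\<Sum>i\<le>n. comp (n - i) (p i))"
  by (simp add: rees_def)

lemma rees_P: "p \<in> up A \<Longrightarrow> rees p \<in> P_fps"
  by (simp add: P_fps_def rees_nth P_sum comp_P)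

lemma P_fps_mult: "F \<in> P_fps \<Longrightarrow> G \<in> P_fps \<Longrightarrow> F * G \<in> P_fps"
  by (simp add: P_fps_def fps_mult_nth P_sum P_mult)

lemma J_fps_0: "0 \<in> J_fps"
  by (simp add: J_fps_def J_0)

lemma J_fps_add: "F \<in> J_fps \<Longrightarrow> G \<in> J_fps \<Longrightarrow> F + G \<in> J_fps"
  by (simp add: J_fps_def J_add)

lemma J_fps_diff: "F \<in> J_fps \<Longrightarrow> G \<in> J_fps \<Longrightarrow> F - G \<in> J_fps"
  by (simp add: J_fps_def J_diff)

lemma J_fps_l: "F \<in> P_fps \<Longrightarrow> G \<in> J_fps \<Longrightarrow> F * G \<in> J_fps"
  by (simp add: J_fps_def P_fps_def fps_mult_nth J_sum J_l)

lemma J_fps_r: "F \<in> J_fps \<Longrightarrow> G \<in> P_fps \<Longrightarrow> F * G \<in> J_fps"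
  by (simp add: J_fps_def P_fps_def fps_mult_nth J_sum J_r)

text \<open>A coefficient of \<open>rees p\<close> mixes contributions from several positions, but
  they have different degrees: the degree m component of coefficient i + m comes from position i
  alone. So \<open>rees\<close> is injective modulo \<open>J_fps\<close>.\<close>

lemma rees_eqI:
  assumes p: "p \<in> up A" and q: "q \<in> up A" and J: "rees p - rees q \<in> J_fps"
  shows "p = q"
proof (rule ext, rule comp_eqI)
  fix i m
  have "0 = \<nu> m ((rees p - rees q) $ (i + m))"
    using J by (simp add: J_fps_def \<nu>_J)
  also have "\<dots> = (\<Sum>l\<le>i + m. \<nu> m (comp (i + m - l) (p l) - comp (i + m - l) (q l)))"
    using p q by (simp add: rees_nth sum_subtractf[symmetric] \<nu>_sum_distrib P_diff comp_P)
  also have "\<dots> = (\<Sum>l\<le>i + m. if l = i then comp m (p l) - comp m (q l) else 0)"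
    using p q by (intro sum.cong) (auto simp: \<nu>_diff comp_P \<nu>_comp)
  finally show "comp m (p i) = comp m (q i)"
    by simp
qed (use p q in auto)

lemma \<iota>_poly_nth: "\<iota>_poly c $ n = \<iota> (Polynomial.coeff c n)"
  by (simp add: \<iota>_poly_def)

lemma \<iota>_poly_P: "\<iota>_poly c \<in> P_fps"
  by (simp add: P_fps_def \<iota>_poly_nth P_\<iota>)

lemma \<iota>_poly_1: "\<iota>_poly 1 = 1"
  by (rule fps_ext) (simp add: \<iota>_poly_nth \<iota>_1)

lemma \<iota>_poly_add: "\<iota>_poly (c + d) = \<iota>_poly c + \<iota>_poly d"
  by (rule fps_ext) (simp add: \<iota>_poly_nth \<iota>_add)

lemma \<iota>_sum: "\<iota> (sum f S) = (\<Sum>i\<in>S. \<iota> (f i))"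
  by (induction S rule: infinite_finite_induct) (auto simp: \<iota>_add)

lemma \<iota>_poly_mult: "\<iota>_poly (c * d) = \<iota>_poly c * \<iota>_poly d"
  by (rule fps_ext)
     (simp add: \<iota>_poly_nth fps_mult_nth Polynomial.coeff_mult \<iota>_sum \<iota>_mult atMost_atLeast0)

lemma \<iota>_poly_comm: "\<iota>_poly c * F = F * \<iota>_poly c"
proof (rule fps_ext)
  fix n
  have "(\<iota>_poly c * F) $ n = (\<Sum>i\<le>n. F $ (n - i) * \<iota>_poly c $ i)"
    by (simp add: fps_mult_nth \<iota>_poly_nth \<iota>_comm atMost_atLeast0)
  also have "\<dots> = (\<Sum>i\<le>n. F $ i * \<iota>_poly c $ (n - i))"
    by (rule sum.reindex_bij_witness[where i = "\<lambda>i. n - i" and j = "\<lambda>i. n - i"]) auto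
  finally show "(\<iota>_poly c * F) $ n = (F * \<iota>_poly c) $ n"
    by (simp add: fps_mult_nth atMost_atLeast0)
qed

lemma D_add_closed:
  assumes "p \<in> up A" "q \<in> up A"
  shows "p \<oplus>\<^bsub>D\<^esub> q \<in> up A"
proof -
  obtain M N where "\<forall>i>M. p i = \<zero>\<^bsub>A\<^esub>" "\<forall>i>N. q i = \<zero>\<^bsub>A\<^esub>"
    using assms by (auto simp: up_iff)
  then have "\<forall>i>M + N. (p \<oplus>\<^bsub>D\<^esub> q) i = \<zero>\<^bsub>A\<^esub>"
    using assms by (simp add: D_add)
  moreover have "(p \<oplus>\<^bsub>D\<^esub> q) i \<in> carrier A" for i
    using assms by (simp add: D_add)
  ultimately show ?thesis
    unfolding up_iff by blast
qed

lemma D_smult_closed: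
  assumes p: "p \<in> up A"
  shows "c \<odot>\<^bsub>D\<^esub> p \<in> up A"
proof -
  obtain N where N: "\<forall>i>N. p i = \<zero>\<^bsub>A\<^esub>"
    using p by (auto simp: up_iff)
  have "(c \<odot>\<^bsub>D\<^esub> p) n = \<zero>\<^bsub>A\<^esub>" if "degree c + N < n" for n
  proof (rule comp_eqI)
    have "\<iota> (Polynomial.coeff c i) * comp m (p (n - i)) = 0" for m i
      using that N by (cases "degree c < i") (auto simp: coeff_eq_0)
    then show "comp m ((c \<odot>\<^bsub>D\<^esub> p) n) = comp m \<zero>\<^bsub>A\<^esub>" for m
      using p by (simp add: D_smult comp_finsum comp_smult A_smult Pi_def)
  qed (use p in \<open>auto simp: D_smult A_smult intro!: A.finsum_closed\<close>)
  moreover have "(c \<odot>\<^bsub>D\<^esub> p) n \<in> carrier A" for n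
    using p by (auto simp: D_smult A_smult intro!: A.finsum_closed)
  ultimately show ?thesis
    unfolding up_iff by blast
qed

lemma D_mult_A: "p \<in> up A \<Longrightarrow> q \<in> up A \<Longrightarrow> (p \<otimes>\<^bsub>D\<^esub> q) n \<in> carrier A"
  by (auto simp: D_mult \<mu>_A intro!: A.finsum_closed)

lemma comp_D_mult:
  assumes "p \<in> up A" "q \<in> up A"
  shows "comp m ((p \<otimes>\<^bsub>D\<^esub> q) n) = (\<Sum>i\<le>n. \<Sum>j\<le>n - i. comp m (\<mu> (n - i - j) (p i) (q j)))"
  using assms by (simp add: D_mult comp_finsum \<mu>_A Pi_def A.finsum_closed)

lemma D_mult_closed:
  assumes p: "p \<in> up A" and q: "q \<in> up A"
  shows "p \<otimes>\<^bsub>D\<^esub> q \<in> up A"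
proof -
  obtain M N where M: "\<And>i. M < i \<Longrightarrow> p i = \<zero>\<^bsub>A\<^esub>" and N: "\<And>i. N < i \<Longrightarrow> q i = \<zero>\<^bsub>A\<^esub>"
    using assms unfolding up_iff by blast
  \<comment> \<open>\<open>\<mu>_finite\<close> bounds l separately for each pair of arguments. Only
    the finitely many pairs with i \<le> M and j \<le> N matter, so a common bound K exists.\<close>
  have "finite (\<Union>i\<le>M. \<Union>j\<le>N. {l. \<mu> l (p i) (q j) \<noteq> \<zero>\<^bsub>A\<^esub>})"
    using p q by (auto simp: \<mu>_finite)
  then obtain K where "(\<Union>i\<le>M. \<Union>j\<le>N. {l. \<mu> l (p i) (q j) \<noteq> \<zero>\<^bsub>A\<^esub>}) \<subseteq> {..K}"
    by (meson finite_nat_iff_bounded_le)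
  then have K: "\<And>l i j. K < l \<Longrightarrow> i \<le> M \<Longrightarrow> j \<le> N \<Longrightarrow> \<mu> l (p i) (q j) = \<zero>\<^bsub>A\<^esub>"
    by fastforce
  have z: "comp m (\<mu> l (p i) (q j)) = 0" if "M + N + K < i + j + l" for m i j l
  proof (cases "i \<le> M \<and> j \<le> N")
    case True
    then show ?thesis
      using that K by simp
  next
    case False
    then show ?thesis
      using p q M[of i] N[of j] by (auto simp: comp_\<mu> not_le)
  qed
  have "(p \<otimes>\<^bsub>D\<^esub> q) n = \<zero>\<^bsub>A\<^esub>" if "M + N + K < n" for n
    by (rule comp_eqI) (use p q that in \<open>auto simp: D_mult_A comp_D_mult z intro!: sum.neutral\<close>)
  then show ?thesis
    using D_mult_A[OF p q] unfolding up_iff by blast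
qed

lemma D_one_closed: "\<one>\<^bsub>D\<^esub> \<in> up A"
  unfolding up_iff by (auto simp: D_one A_one)

lemma rees_add: "p \<in> up A \<Longrightarrow> q \<in> up A \<Longrightarrow> rees (p \<oplus>\<^bsub>D\<^esub> q) = rees p + rees q"
  by (rule fps_ext) (simp add: rees_nth D_add comp_add sum.distrib)

text \<open>The section respects the unit only modulo J, hence a congruence. In coefficient 0 it
  uses that 1 is congruent to \<open>\<nu> 0 1\<close>, since its other components vanish.\<close>

lemma rees_one: "rees \<one>\<^bsub>D\<^esub> - 1 \<in> J_fps"
proof -
  have "comp m \<one>\<^bsub>A\<^esub> = \<nu> m 1" for m
    unfolding comp_def by (rule \<nu>_cong) (simp_all add: \<theta>_P A_one P_1 \<theta>_one)
  then have *: "rees \<one>\<^bsub>D\<^esub> $ n = \<nu> n 1" for n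
  proof -
    have "rees \<one>\<^bsub>D\<^esub> $ n = (\<Sum>i\<le>n. if i = 0 then comp n \<one>\<^bsub>A\<^esub> else 0)"
      unfolding rees_nth D_one by (rule sum.cong) auto
    then show ?thesis
      using \<open>\<And>m. comp m \<one>\<^bsub>A\<^esub> = \<nu> m 1\<close> by simp
  qed
  have "1 - (\<Sum>m\<in>{0}. \<nu> m 1) \<in> J"
    by (rule \<nu>_sum_superset) (auto simp: P_1 \<nu>_one)
  then have "- (1 - \<nu> 0 1) \<in> J"
    by (intro J_uminus) simp
  then show ?thesis
    by (auto simp: J_fps_def * \<nu>_one J_0)
qed

lemma rees_smult:
  assumes p: "p \<in> up A"
  shows "rees (c \<odot>\<^bsub>D\<^esub> p) = \<iota>_poly c * rees p"
proof (rule fps_ext)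
  fix n
  have "rees (c \<odot>\<^bsub>D\<^esub> p) $ n =
      (\<Sum>i\<le>n. \<Sum>l\<le>i. \<iota> (Polynomial.coeff c l) * comp (n - i) (p (i - l)))"
    using p by (simp add: rees_nth D_smult comp_finsum A_smult Pi_def comp_smult)
  also have "\<dots> = (\<Sum>l\<le>n. \<Sum>i\<le>n - l. \<iota> (Polynomial.coeff c l) * comp (n - l - i) (p i))"
    by (simp add: sum.Sigma, rule sum.reindex_bij_witness
      [where i = "\<lambda>(l, i). (l + i, l)" and j = "\<lambda>(i, l). (l, i - l)"]) auto
  also have "\<dots> = (\<iota>_poly c * rees p) $ n"
    by (simp add: fps_mult_nth \<iota>_poly_nth rees_nth sum_distrib_left atMost_atLeast0)
  finally show "rees (c \<odot>\<^bsub>D\<^esub> p) $ n = (\<iota>_poly c * rees p) $ n" .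
qed

text \<open>The part of total degree n of the product of two section values, multiplied in P and not
  yet normalized. The degree m component of \<open>\<mu> j a b\<close> is \<open>\<nu> m\<close> of
  \<open>conv (m + j) a b\<close>.\<close>

definition conv :: "nat \<Rightarrow> 'a \<Rightarrow> 'a \<Rightarrow> 'p" where
  "conv n a b = (\<Sum>d\<le>n. comp d a * comp (n - d) b)"

text \<open>Both coefficients of degree n are sums over positions a and b of p and q. For the
  product of series the summand is \<open>conv (n - a - b)\<close> itself, for the deformed product
  it is the sum of its components of degree at most n - a - b. By \<open>\<nu>_filtered\<close>
  there are no higher components, so the two agree modulo J.\<close>

lemma rees_mult:
  assumes p: "p \<in> up A" and q: "q \<in> up A"
  shows "rees (p \<otimes>\<^bsub>D\<^esub> q) - rees p * rees q \<in> J_fps"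
proof -
  have "(rees (p \<otimes>\<^bsub>D\<^esub> q) - rees p * rees q) $ n \<in> J" for n
  proof -
    let ?X = "\<lambda>a b. conv (n - a - b) (p a) (q b)"
    have X_P: "conv k (p a) (q b) \<in> P" for k a b
      using p q by (auto simp: conv_def intro!: P_sum P_mult comp_P)
    have X_high: "\<nu> m (conv k (p a) (q b)) = 0" if "k < m" for k a b m
      unfolding conv_def using p q that
      by (subst \<nu>_sum_distrib) (auto simp: P_mult comp_P, auto simp: comp_def \<theta>_P \<nu>_filtered)
    have "rees (p \<otimes>\<^bsub>D\<^esub> q) $ n =
        (\<Sum>i\<le>n. \<Sum>a\<le>i. \<Sum>b\<le>i - a. comp (n - i) (\<mu> (i - a - b) (p a) (q b)))"
      using p q by (simp add: rees_nth comp_D_mult)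
    also have "\<dots> = (\<Sum>i\<le>n. \<Sum>a\<le>i. \<Sum>b\<le>i - a. \<nu> (n - i) (?X a b))"
    proof (intro sum.cong refl)
      fix i a b
      assume "i \<in> {..n}" "a \<in> {..i}" "b \<in> {..i - a}"
      then have "n - i + (i - a - b) = n - a - b"
        by simp
      then show "comp (n - i) (\<mu> (i - a - b) (p a) (q b)) = \<nu> (n - i) (?X a b)"
        using p q by (simp add: comp_\<mu> conv_def \<nu>_sum_distrib P_mult comp_P)
    qed
    \<comment> \<open>For fixed a and b the position i of the product runs from a + b to n, so the
      degree m = n - i of the component runs from 0 to n - a - b.\<close>
    also have "\<dots> = (\<Sum>a\<le>n. \<Sum>b\<le>n - a. \<Sum>m\<le>n - a - b. \<nu> m (?X a b))"
      by (simp add: sum.Sigma, rule sum.reindex_bij_witness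
        [where i = "\<lambda>(a, b, m). (n - m, a, b)" and j = "\<lambda>(i, a, b). (a, b, n - i)"]) auto
    finally have l: "rees (p \<otimes>\<^bsub>D\<^esub> q) $ n = (\<Sum>a\<le>n. \<Sum>b\<le>n - a. \<Sum>m\<le>n - a - b. \<nu> m (?X a b))" .
    have "(rees p * rees q) $ n =
        (\<Sum>l\<le>n. \<Sum>a\<le>l. \<Sum>b\<le>n - l. comp (l - a) (p a) * comp (n - l - b) (q b))"
      by (simp add: fps_mult_nth rees_nth sum_product atMost_atLeast0)
    also have "\<dots> = (\<Sum>a\<le>n. \<Sum>b\<le>n - a. \<Sum>d\<le>n - a - b. comp d (p a) * comp (n - a - b - d) (q b))"
      by (simp add: sum.Sigma, rule sum.reindex_bij_witness
        [where i = "\<lambda>(a, b, d). (a + d, a, b)" and j = "\<lambda>(l, a, b). (a, b, l - a)"])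
         (auto intro!: arg_cong2[of _ _ _ _ "(*)"] arg_cong[of _ _ "\<lambda>i. comp i _"])
    finally have r: "(rees p * rees q) $ n = (\<Sum>a\<le>n. \<Sum>b\<le>n - a. ?X a b)"
      unfolding conv_def .
    have "(rees p * rees q - rees (p \<otimes>\<^bsub>D\<^esub> q)) $ n =
        (\<Sum>a\<le>n. \<Sum>b\<le>n - a. ?X a b - (\<Sum>m\<le>n - a - b. \<nu> m (?X a b)))"
      by (simp add: l r sum_subtractf)
    also have "\<dots> \<in> J"
      by (intro J_sum \<nu>_sum_superset) (auto simp: X_P X_high)
    finally have "- ((rees p * rees q - rees (p \<otimes>\<^bsub>D\<^esub> q)) $ n) \<in> J"
      by (rule J_uminus)
    then show ?thesis
      by simp
  qed
  then show ?thesis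
    by (simp add: J_fps_def)
qed

lemma J_fps_mult_cong:
  assumes "F - F' \<in> J_fps" "G - G' \<in> J_fps" "F \<in> P_fps" "G' \<in> P_fps"
  shows "F * G - F' * G' \<in> J_fps"
proof -
  have "F * G - F' * G' = F * (G - G') + (F - F') * G'"
    by (simp add: algebra_simps)
  then show ?thesis
    using assms by (simp add: J_fps_add J_fps_l J_fps_r)
qed

lemma J_fps_trans: "F - G \<in> J_fps \<Longrightarrow> G - H \<in> J_fps \<Longrightarrow> F - H \<in> J_fps"
  using J_fps_add[of "F - G" "G - H"] by simp

lemma J_fps_trans': "F - H \<in> J_fps \<Longrightarrow> G - H \<in> J_fps \<Longrightarrow> F - G \<in> J_fps"
  using J_fps_diff[of "F - H" "G - H"] by simp

lemma D_abelian_group: "abelian_group D"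
proof (rule abelian_groupI)
  fix x
  assume "x \<in> carrier D"
  then have x: "x \<in> up A"
    by (simp add: D_carrier)
  have inv: "(\<lambda>n. \<ominus>\<^bsub>A\<^esub> x n) \<in> up A"
    using x by (auto simp: up_iff)
  have "(\<lambda>n. \<ominus>\<^bsub>A\<^esub> x n) \<oplus>\<^bsub>D\<^esub> x = \<zero>\<^bsub>D\<^esub>"
    using x inv by (simp add: D_add D_zero A.l_neg)
  with inv show "\<exists>y\<in>carrier D. y \<oplus>\<^bsub>D\<^esub> x = \<zero>\<^bsub>D\<^esub>"
    by (auto simp: D_carrier)
next
  fix x y z
  assume "x \<in> carrier D" "y \<in> carrier D" "z \<in> carrier D"
  then have "x \<in> up A" "y \<in> up A" "z \<in> up A"
    by (simp_all add: D_carrier)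
  moreover from this have "x \<oplus>\<^bsub>D\<^esub> y \<in> up A" "y \<oplus>\<^bsub>D\<^esub> z \<in> up A"
    by (simp_all add: D_add_closed)
  ultimately show "x \<oplus>\<^bsub>D\<^esub> y \<oplus>\<^bsub>D\<^esub> z = x \<oplus>\<^bsub>D\<^esub> (y \<oplus>\<^bsub>D\<^esub> z)"
    by (simp add: D_add A.a_assoc)
qed (simp_all add: D_carrier D_add_closed, simp_all add: up_iff D_add D_zero A.a_comm)

text \<open>Modulo \<open>J_fps\<close> both bracketings have the same image, a product of three
  power series over an associative ring, and \<open>rees\<close> is injective there. The remaining
  ring axioms are transported in the same way.\<close>

lemma D_assoc:
  assumes "x \<in> up A" "y \<in> up A" "z \<in> up A"
  shows "x \<otimes>\<^bsub>D\<^esub> y \<otimes>\<^bsub>D\<^esub> z = x \<otimes>\<^bsub>D\<^esub> (y \<otimes>\<^bsub>D\<^esub> z)"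
proof (rule rees_eqI)
  have "rees (x \<otimes>\<^bsub>D\<^esub> y \<otimes>\<^bsub>D\<^esub> z) - rees x * rees y * rees z \<in> J_fps"
    by (rule J_fps_trans[OF rees_mult J_fps_mult_cong])
       (use assms in \<open>auto simp: D_mult_closed rees_mult rees_P J_fps_0\<close>)
  moreover have "rees (x \<otimes>\<^bsub>D\<^esub> (y \<otimes>\<^bsub>D\<^esub> z)) - rees x * (rees y * rees z) \<in> J_fps"
    by (rule J_fps_trans[OF rees_mult J_fps_mult_cong])
       (use assms in \<open>auto simp: D_mult_closed rees_mult rees_P J_fps_0 P_fps_mult\<close>)
  ultimately show "rees (x \<otimes>\<^bsub>D\<^esub> y \<otimes>\<^bsub>D\<^esub> z) - rees (x \<otimes>\<^bsub>D\<^esub> (y \<otimes>\<^bsub>D\<^esub> z)) \<in> J_fps"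
    by (auto intro: J_fps_trans' simp: mult.assoc)
qed (use assms in \<open>auto simp: D_mult_closed\<close>)

lemma D_ring: "ring D"
proof (rule ringI)
  show "abelian_group D"
    by (rule D_abelian_group)
  show "Group.monoid D"
  proof (rule monoidI)
    fix x y z
    assume "x \<in> carrier D" "y \<in> carrier D" "z \<in> carrier D"
    then show "x \<otimes>\<^bsub>D\<^esub> y \<otimes>\<^bsub>D\<^esub> z = x \<otimes>\<^bsub>D\<^esub> (y \<otimes>\<^bsub>D\<^esub> z)"
      by (simp add: D_carrier D_assoc)
  next
    fix x
    assume "x \<in> carrier D"
    then have x: "x \<in> up A"
      by (simp add: D_carrier)
    have "rees (\<one>\<^bsub>D\<^esub> \<otimes>\<^bsub>D\<^esub> x) - 1 * rees x \<in> J_fps"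
      by (rule J_fps_trans[OF rees_mult J_fps_mult_cong])
         (use x in \<open>auto simp: D_one_closed rees_one rees_P J_fps_0\<close>)
    then show "\<one>\<^bsub>D\<^esub> \<otimes>\<^bsub>D\<^esub> x = x"
      using x by (intro rees_eqI) (simp_all add: D_one_closed D_mult_closed)
    have "1 \<in> P_fps"
      by (simp add: P_fps_def P_1)
    then have "rees (x \<otimes>\<^bsub>D\<^esub> \<one>\<^bsub>D\<^esub>) - rees x * 1 \<in> J_fps"
      by (intro J_fps_trans[OF rees_mult J_fps_mult_cong])
         (use x in \<open>auto simp: D_one_closed rees_one rees_P J_fps_0\<close>)
    then show "x \<otimes>\<^bsub>D\<^esub> \<one>\<^bsub>D\<^esub> = x"
      using x by (intro rees_eqI) (simp_all add: D_one_closed D_mult_closed)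
  qed (simp_all add: D_carrier D_one_closed D_mult_closed)
  fix x y z
  assume "x \<in> carrier D" "y \<in> carrier D" "z \<in> carrier D"
  then have xyz: "x \<in> up A" "y \<in> up A" "z \<in> up A"
    by (simp_all add: D_carrier)
  show "(x \<oplus>\<^bsub>D\<^esub> y) \<otimes>\<^bsub>D\<^esub> z = x \<otimes>\<^bsub>D\<^esub> z \<oplus>\<^bsub>D\<^esub> y \<otimes>\<^bsub>D\<^esub> z"
  proof (rule rees_eqI)
    have "rees ((x \<oplus>\<^bsub>D\<^esub> y) \<otimes>\<^bsub>D\<^esub> z) - (rees x + rees y) * rees z \<in> J_fps"
      using xyz rees_mult[of "x \<oplus>\<^bsub>D\<^esub> y" z] by (simp add: D_add_closed rees_add)
    moreover have "rees (x \<otimes>\<^bsub>D\<^esub> z \<oplus>\<^bsub>D\<^esub> y \<otimes>\<^bsub>D\<^esub> z) - (rees x + rees y) * rees z \<in> J_fps"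
      using xyz J_fps_add[OF rees_mult[of x z] rees_mult[of y z]]
      by (simp add: rees_add D_mult_closed algebra_simps)
    ultimately show "rees ((x \<oplus>\<^bsub>D\<^esub> y) \<otimes>\<^bsub>D\<^esub> z) - rees (x \<otimes>\<^bsub>D\<^esub> z \<oplus>\<^bsub>D\<^esub> y \<otimes>\<^bsub>D\<^esub> z) \<in> J_fps"
      by (rule J_fps_trans')
  qed (use xyz in \<open>auto simp: D_mult_closed D_add_closed\<close>)
  show "z \<otimes>\<^bsub>D\<^esub> (x \<oplus>\<^bsub>D\<^esub> y) = z \<otimes>\<^bsub>D\<^esub> x \<oplus>\<^bsub>D\<^esub> z \<otimes>\<^bsub>D\<^esub> y"
  proof (rule rees_eqI)
    have "rees (z \<otimes>\<^bsub>D\<^esub> (x \<oplus>\<^bsub>D\<^esub> y)) - rees z * (rees x + rees y) \<in> J_fps"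
      using xyz rees_mult[of z "x \<oplus>\<^bsub>D\<^esub> y"] by (simp add: D_add_closed rees_add)
    moreover have "rees (z \<otimes>\<^bsub>D\<^esub> x \<oplus>\<^bsub>D\<^esub> z \<otimes>\<^bsub>D\<^esub> y) - rees z * (rees x + rees y) \<in> J_fps"
      using xyz J_fps_add[OF rees_mult[of z x] rees_mult[of z y]]
      by (simp add: rees_add D_mult_closed algebra_simps)
    ultimately show "rees (z \<otimes>\<^bsub>D\<^esub> (x \<oplus>\<^bsub>D\<^esub> y)) - rees (z \<otimes>\<^bsub>D\<^esub> x \<oplus>\<^bsub>D\<^esub> z \<otimes>\<^bsub>D\<^esub> y) \<in> J_fps"
      by (rule J_fps_trans')
  qed (use xyz in \<open>auto simp: D_mult_closed D_add_closed\<close>)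
qed

lemma D_smult_mult:
  assumes "x \<in> up A" "y \<in> up A"
  shows "(c \<odot>\<^bsub>D\<^esub> x) \<otimes>\<^bsub>D\<^esub> y = c \<odot>\<^bsub>D\<^esub> (x \<otimes>\<^bsub>D\<^esub> y)" (is ?l)
    and "x \<otimes>\<^bsub>D\<^esub> (c \<odot>\<^bsub>D\<^esub> y) = c \<odot>\<^bsub>D\<^esub> (x \<otimes>\<^bsub>D\<^esub> y)" (is ?r)
proof -
  have s: "rees (c \<odot>\<^bsub>D\<^esub> (x \<otimes>\<^bsub>D\<^esub> y)) - \<iota>_poly c * (rees x * rees y) \<in> J_fps"
    using assms J_fps_l[OF \<iota>_poly_P rees_mult, of x y c]
    by (simp add: rees_smult D_mult_closed algebra_simps)
  have "rees ((c \<odot>\<^bsub>D\<^esub> x) \<otimes>\<^bsub>D\<^esub> y) - \<iota>_poly c * (rees x * rees y) \<in> J_fps"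
    using assms rees_mult[of "c \<odot>\<^bsub>D\<^esub> x" y] by (simp add: rees_smult D_smult_closed mult.assoc)
  from J_fps_trans'[OF this s] show ?l
    using assms by (intro rees_eqI) (auto simp: D_smult_closed D_mult_closed)
  have "rees x * (\<iota>_poly c * rees y) = \<iota>_poly c * (rees x * rees y)"
    by (metis \<iota>_poly_comm mult.assoc)
  then have "rees (x \<otimes>\<^bsub>D\<^esub> (c \<odot>\<^bsub>D\<^esub> y)) - \<iota>_poly c * (rees x * rees y) \<in> J_fps"
    using assms rees_mult[of x "c \<odot>\<^bsub>D\<^esub> y"] by (simp add: rees_smult D_smult_closed)
  from J_fps_trans'[OF this s] show ?r
    using assms by (intro rees_eqI) (auto simp: D_smult_closed D_mult_closed)
qed

lemma D_module: "Module.module (ring_of_type_algebra :: 'k poly ring) D"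
proof (rule moduleI)
  show "cring (ring_of_type_algebra :: 'k poly ring)"
    by (rule cring_from_type_algebra)
qed (auto simp: D_abelian_group D_carrier D_smult_closed ring_of_type_algebra_def rees_smult
      rees_add D_add_closed \<iota>_poly_add \<iota>_poly_mult \<iota>_poly_1 algebra_simps J_fps_0 intro!: rees_eqI)

lemma D_algebra: "assoc_algebra D"
  by (simp add: assoc_algebra_def D_ring D_module D_carrier D_smult_mult)

lemma deformation_\<mu>: "deformation A \<mu>"
  by (simp add: deformation_def \<mu>_0 \<mu>_bilinear \<mu>_finite D_algebra)

end

section \<open>The fiber at t = 1\<close>

locale filtered_presentation = filtered_section A P J \<iota> \<theta> \<nu>
  for A :: "('k::field, 'a) module" and P J :: "'p::ring_1 set"
    and \<iota> :: "'k \<Rightarrow> 'p" and \<theta> :: "'a \<Rightarrow> 'p" and \<nu> :: "nat \<Rightarrow> 'p \<Rightarrow> 'p" +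
  fixes H :: "('k, 'h) module" and cl :: "'p \<Rightarrow> 'h"
  assumes H_carrier: "carrier H = cl ` P"
    and cl_eq: "p \<in> P \<Longrightarrow> q \<in> P \<Longrightarrow> cl p = cl q \<longleftrightarrow> p - q \<in> J"
    and cl_add: "p \<in> P \<Longrightarrow> q \<in> P \<Longrightarrow> cl p \<oplus>\<^bsub>H\<^esub> cl q = cl (p + q)"
    and cl_mult: "p \<in> P \<Longrightarrow> q \<in> P \<Longrightarrow> cl p \<otimes>\<^bsub>H\<^esub> cl q = cl (p * q)"
    and cl_one: "\<one>\<^bsub>H\<^esub> = cl 1"
    and cl_smult: "p \<in> P \<Longrightarrow> c \<odot>\<^bsub>H\<^esub> cl p = cl (\<iota> c * p)"
begin

text \<open>Setting t = 1 in A[t] adds up the coefficients; this is the section value of that sum.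
  On classes it induces the isomorphism from the fiber to H.\<close>

definition ev :: "(nat \<Rightarrow> 'a) \<Rightarrow> 'p" where
  "ev p = (\<Sum>i | p i \<noteq> \<zero>\<^bsub>A\<^esub>. \<theta> (p i))"

lemma ev_eq:
  assumes "p \<in> up A" "\<And>i. N < i \<Longrightarrow> p i = \<zero>\<^bsub>A\<^esub>"
  shows "ev p = (\<Sum>i\<le>N. \<theta> (p i))"
  unfolding ev_def
  by (rule sum.mono_neutral_left) (use assms in \<open>auto simp: \<theta>_zero not_less[symmetric]\<close>)

text \<open>A bound on position plus degree makes \<open>rees p\<close> a polynomial, so that its
  value at 1 is a finite sum.\<close>

lemma up_bound:
  assumes "p \<in> up A"
  shows "\<exists>N. \<forall>i m. N < i + m \<longrightarrow> comp m (p i) = 0"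
proof -
  obtain M where M: "\<And>i. M < i \<Longrightarrow> p i = \<zero>\<^bsub>A\<^esub>"
    using assms unfolding up_iff by blast
  have "finite (\<Union>i\<le>M. {m. comp m (p i) \<noteq> 0})"
    using assms by (auto simp: comp_finite)
  then obtain K where "(\<Union>i\<le>M. {m. comp m (p i) \<noteq> 0}) \<subseteq> {..K}"
    by (meson finite_nat_iff_bounded_le)
  then have K: "\<And>i m. K < m \<Longrightarrow> i \<le> M \<Longrightarrow> comp m (p i) = 0"
    by fastforce
  have "comp m (p i) = 0" if "M + K < i + m" for i m
    using that K[of m i] M[of i] by (cases "i \<le> M") auto
  then show ?thesis
    by blast
qed

lemma up_bound_zero:
  assumes "p \<in> up A" "\<forall>i m. N < i + m \<longrightarrow> comp m (p i) = 0" "N < i"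
  shows "p i = \<zero>\<^bsub>A\<^esub>"
  by (rule comp_eqI) (use assms in auto)

lemma rees_bound_zero:
  assumes "\<forall>i m. N < i + m \<longrightarrow> comp m (p i) = 0" "N < n"
  shows "rees p $ n = 0"
  unfolding rees_nth by (rule sum.neutral) (use assms in auto)

lemma ev_P: "p \<in> up A \<Longrightarrow> ev p \<in> P"
  by (auto simp: ev_def \<theta>_P intro!: P_sum)

text \<open>At t = 1 the shift of the exponent by the degree disappears, and the components of each
  coefficient add up to its section value modulo J.\<close>

lemma ev_rees:
  assumes p: "p \<in> up A" and N: "\<forall>i m. N < i + m \<longrightarrow> comp m (p i) = 0"
  shows "ev p - (\<Sum>n\<le>N. rees p $ n) \<in> J"
proof -
  have "(\<Sum>n\<le>N. rees p $ n) = (\<Sum>i\<le>N. \<Sum>m\<le>N - i. comp m (p i))"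
    by (simp add: rees_nth sum.Sigma, rule sum.reindex_bij_witness
      [where i = "\<lambda>(i, m). (i + m, i)" and j = "\<lambda>(n, i). (i, n - i)"]) auto
  moreover have "ev p = (\<Sum>i\<le>N. \<theta> (p i))"
    using p up_bound_zero[OF p N] by (rule ev_eq)
  moreover have "\<theta> (p i) - (\<Sum>m\<le>N - i. comp m (p i)) \<in> J" for i
    unfolding comp_def by (rule \<nu>_sum_superset) (use p N in \<open>auto simp: \<theta>_P comp_def\<close>)
  ultimately show ?thesis
    by (simp add: sum_subtractf[symmetric] J_sum)
qed

lemma J_trans: "p - q \<in> J \<Longrightarrow> q - r \<in> J \<Longrightarrow> p - r \<in> J"
  using J_add[of "p - q" "q - r"] by simp

lemma J_sym: "p - q \<in> J \<Longrightarrow> q - p \<in> J"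
  using J_uminus[of "p - q"] by simp

lemma J_mult_cong:
  assumes "p - p' \<in> J" "q - q' \<in> J" "p \<in> P" "q' \<in> P"
  shows "p * q - p' * q' \<in> J"
proof -
  have "p * q - p' * q' = p * (q - q') + (p - p') * q'"
    by (simp add: algebra_simps)
  then show ?thesis
    using assms by (simp add: J_add J_l J_r)
qed

lemma ev_add:
  assumes p: "p \<in> up A" and q: "q \<in> up A"
  shows "ev (p \<oplus>\<^bsub>D\<^esub> q) = ev p + ev q"
proof -
  obtain M N where M: "\<And>i. M < i \<Longrightarrow> p i = \<zero>\<^bsub>A\<^esub>" and N: "\<And>i. N < i \<Longrightarrow> q i = \<zero>\<^bsub>A\<^esub>"
    using assms unfolding up_iff by blast
  have "ev p = (\<Sum>i\<le>M + N. \<theta> (p i))" "ev q = (\<Sum>i\<le>M + N. \<theta> (q i))"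
    by (rule ev_eq, use assms M N in auto)+
  moreover have "ev (p \<oplus>\<^bsub>D\<^esub> q) = (\<Sum>i\<le>M + N. \<theta> ((p \<oplus>\<^bsub>D\<^esub> q) i))"
    using D_add_closed[OF p q] by (rule ev_eq) (simp add: D_add p q M N)
  ultimately show ?thesis
    using assms by (simp add: D_add \<theta>_add sum.distrib)
qed

lemma sum_J_fps: "F - G \<in> J_fps \<Longrightarrow> (\<Sum>n\<le>N. F $ n) - (\<Sum>n\<le>N. G $ n) \<in> J"
  by (simp add: J_fps_def sum_subtractf[symmetric] J_sum)

text \<open>The section need not be multiplicative, so the comparison goes through
  \<open>rees\<close>: it is multiplicative modulo J, and evaluating polynomials at 1 is
  multiplicative as well.\<close>

lemma ev_mult:
  assumes p: "p \<in> up A" and q: "q \<in> up A"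
  shows "ev (p \<otimes>\<^bsub>D\<^esub> q) - ev p * ev q \<in> J"
proof -
  obtain a b c where a: "\<forall>i m. a < i + m \<longrightarrow> comp m (p i) = 0"
    and b: "\<forall>i m. b < i + m \<longrightarrow> comp m (q i) = 0"
    and c: "\<forall>i m. c < i + m \<longrightarrow> comp m ((p \<otimes>\<^bsub>D\<^esub> q) i) = 0"
    using up_bound[OF p] up_bound[OF q] up_bound[OF D_mult_closed[OF p q]] by blast
  \<comment> \<open>The summand a + b is the room that \<open>sum_fps_mult\<close> asks for, and c
    makes the same bound valid for the deformed product in \<open>ev_rees\<close>.\<close>
  let ?N = "a + b + c"
  have "ev (p \<otimes>\<^bsub>D\<^esub> q) - (\<Sum>n\<le>?N. rees (p \<otimes>\<^bsub>D\<^esub> q) $ n) \<in> J"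
    by (rule ev_rees) (use p q c in \<open>auto simp: D_mult_closed\<close>)
  moreover have "(\<Sum>n\<le>?N. rees (p \<otimes>\<^bsub>D\<^esub> q) $ n) - (\<Sum>n\<le>?N. (rees p * rees q) $ n) \<in> J"
    by (rule sum_J_fps) (rule rees_mult[OF p q])
  moreover have "(\<Sum>n\<le>?N. (rees p * rees q) $ n) = (\<Sum>n\<le>a. rees p $ n) * (\<Sum>n\<le>b. rees q $ n)"
    by (rule sum_fps_mult) (use rees_bound_zero a b in auto)
  moreover have "(\<Sum>n\<le>a. rees p $ n) * (\<Sum>n\<le>b. rees q $ n) - ev p * ev q \<in> J"
    by (rule J_mult_cong)
       (use p q a b ev_rees J_sym rees_P in \<open>auto simp: ev_P P_fps_def intro!: P_sum\<close>)
  ultimately show ?thesis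
    using J_trans by metis
qed

lemma ev_smult:
  assumes p: "p \<in> up A"
  shows "ev (c \<odot>\<^bsub>D\<^esub> p) - \<iota> (poly c 1) * ev p \<in> J"
proof -
  obtain a b where a: "\<forall>i m. a < i + m \<longrightarrow> comp m (p i) = 0"
    and b: "\<forall>i m. b < i + m \<longrightarrow> comp m ((c \<odot>\<^bsub>D\<^esub> p) i) = 0"
    using up_bound[OF p] up_bound[OF D_smult_closed[OF p]] by blast
  let ?N = "degree c + a + b"
  have "ev (c \<odot>\<^bsub>D\<^esub> p) - (\<Sum>n\<le>?N. rees (c \<odot>\<^bsub>D\<^esub> p) $ n) \<in> J"
    by (rule ev_rees) (use p b in \<open>auto simp: D_smult_closed\<close>)
  moreover have "(\<Sum>n\<le>?N. rees (c \<odot>\<^bsub>D\<^esub> p) $ n) =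
      (\<Sum>n\<le>degree c. \<iota>_poly c $ n) * (\<Sum>n\<le>a. rees p $ n)"
    unfolding rees_smult[OF p]
    by (rule sum_fps_mult) (use rees_bound_zero a in \<open>auto simp: \<iota>_poly_nth coeff_eq_0\<close>)
  moreover have "(\<Sum>n\<le>degree c. \<iota>_poly c $ n) = \<iota> (poly c 1)"
    by (simp add: \<iota>_poly_nth \<iota>_sum[symmetric] poly_altdef)
  moreover have "\<iota> (poly c 1) * (\<Sum>n\<le>a. rees p $ n) - \<iota> (poly c 1) * ev p \<in> J"
    by (rule J_mult_cong) (use p a ev_rees J_sym in \<open>auto simp: ev_P J_0 P_\<iota>\<close>)
  ultimately show ?thesis
    using J_trans by metis
qed

lemma ev_one: "ev \<one>\<^bsub>D\<^esub> - 1 \<in> J"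
proof -
  have "ev \<one>\<^bsub>D\<^esub> = (\<Sum>i\<le>0. \<theta> (\<one>\<^bsub>D\<^esub> i))"
    by (rule ev_eq) (simp add: D_one_closed, simp add: D_one)
  then show ?thesis
    by (simp add: D_one \<theta>_one)
qed

lemma ev_surj:
  assumes "p \<in> P"
  shows "\<exists>q\<in>up A. ev q - p \<in> J"
proof
  let ?q = "\<lambda>n. if n = 0 then lift p else \<zero>\<^bsub>A\<^esub>"
  show q: "?q \<in> up A"
    unfolding up_iff using lift_A[OF assms] by auto
  have "ev ?q = \<theta> (lift p)"
    using ev_eq[OF q, of 0] by simp
  then show "ev ?q - p \<in> J"
    using \<theta>_lift[OF assms] by simp
qed

text \<open>If \<open>p = (t - 1) q\<close>, the coefficients of \<open>- q\<close> are the partial sums of those of \<open>p\<close>.\<close>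

lemma ev_kernel: "{p \<in> up A. ev p \<in> J} = (\<lambda>x. [:- 1, 1:] \<odot>\<^bsub>D\<^esub> x) ` up A"
proof (intro equalityI subsetI)
  fix p
  assume "p \<in> (\<lambda>x. [:- 1, 1:] \<odot>\<^bsub>D\<^esub> x) ` up A"
  then show "p \<in> {p \<in> up A. ev p \<in> J}"
    using ev_smult[of _ "[:- 1, 1:]"] by (auto simp: D_smult_closed)
next
  fix p
  assume "p \<in> {p \<in> up A. ev p \<in> J}"
  then have p: "p \<in> up A" and ev: "ev p \<in> J"
    by auto
  obtain N where N: "\<And>i. N < i \<Longrightarrow> p i = \<zero>\<^bsub>A\<^esub>"
    using p unfolding up_iff by blast
  define q where "q n = \<ominus>\<^bsub>A\<^esub> (\<Oplus>\<^bsub>A\<^esub>i\<in>{..n}. p i)" for n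
  have sum_A: "(\<Oplus>\<^bsub>A\<^esub>i\<in>{..n}. p i) \<in> carrier A" for n
    using p by (auto intro!: A.finsum_closed)
  have q_A: "q n \<in> carrier A" for n
    by (simp add: q_def sum_A)
  have comp_q: "comp m (q n) = - (\<Sum>i\<le>n. comp m (p i))" for m n
    using p by (simp add: q_def comp_uminus sum_A comp_finsum Pi_def)
  \<comment> \<open>From N on the partial sum is the value of p at t = 1. Its section value lies in
    J, so it vanishes by injectivity, and q is a polynomial.\<close>
  have "q n = \<zero>\<^bsub>A\<^esub>" if "N < n" for n
  proof -
    have "\<theta> (\<Oplus>\<^bsub>A\<^esub>i\<in>{..n}. p i) = ev p"
      using p that N by (subst ev_eq[of p n]) (auto simp: \<theta>_finsum)
    then have "(\<Oplus>\<^bsub>A\<^esub>i\<in>{..n}. p i) = \<zero>\<^bsub>A\<^esub>"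
      using ev sum_A by (intro \<theta>_inj) auto
    then show ?thesis
      by (simp add: q_def)
  qed
  then have q: "q \<in> up A"
    unfolding up_iff using q_A by blast
  have "p = [:- 1, 1:] \<odot>\<^bsub>D\<^esub> q"
  proof (rule ext, rule comp_eqI)
    fix n m
    have m1: "\<iota> (- 1) = - 1"
      using \<iota>_add[of 1 "- 1"] by (simp add: \<iota>_1 eq_neg_iff_add_eq_0 add.commute)
    have "comp m (([:- 1, 1:] \<odot>\<^bsub>D\<^esub> q) n) =
        (\<Sum>i\<le>n. \<iota> (Polynomial.coeff [:- 1, 1:] i) * comp m (q (n - i)))"
      using q by (simp add: D_smult comp_finsum A_smult Pi_def comp_smult)
    also have "\<dots> = comp m (p n)"
    proof (cases n)
      case 0
      then show ?thesis
        by (simp add: comp_q m1)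
    next
      case (Suc k)
      have "(\<Sum>i\<le>n. \<iota> (Polynomial.coeff [:- 1, 1:] i) * comp m (q (n - i))) =
          (\<Sum>i\<in>{0, 1}. \<iota> (Polynomial.coeff [:- 1, 1:] i) * comp m (q (n - i)))"
      proof (rule sum.mono_neutral_right)
        show "\<forall>i\<in>{..n} - {0, 1}. \<iota> (Polynomial.coeff [:- 1, 1:] i) * comp m (q (n - i)) = 0"
          by (auto simp: coeff_pCons split: nat.splits)
      qed (use Suc in auto)
      also have "\<dots> = comp m (p n)"
        by (simp add: comp_q m1 \<iota>_1 Suc)
      finally show ?thesis .
    qed
    finally show "comp m (p n) = comp m (([:- 1, 1:] \<odot>\<^bsub>D\<^esub> q) n)"
      by simp
  qed (use p D_smult_closed[OF q] in auto)
  with q show "p \<in> (\<lambda>x. [:- 1, 1:] \<odot>\<^bsub>D\<^esub> x) ` up A"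
    by blast
qed

text \<open>By \<open>ev_kernel\<close> this is the submodule by which \<open>fiber_at_one\<close>
  divides; as a kernel modulo J it is easily seen to be an ideal.\<close>

abbreviation I_fiber :: "(nat \<Rightarrow> 'a) set" where
  "I_fiber \<equiv> {p \<in> up A. ev p \<in> J}"

lemma ev_uminus: "p \<in> up A \<Longrightarrow> ev (\<ominus>\<^bsub>D\<^esub> p) = - ev p"
proof -
  interpret D: ring D
    by (rule D_ring)
  assume p: "p \<in> up A"
  have "\<ominus>\<^bsub>D\<^esub> p \<in> up A"
    using p D.a_inv_closed by (simp add: D_carrier)
  then have "ev (\<ominus>\<^bsub>D\<^esub> p) + ev p = ev \<zero>\<^bsub>D\<^esub>"
    using p D.l_neg by (simp add: ev_add[symmetric] D_carrier)
  also have "ev \<zero>\<^bsub>D\<^esub> = 0"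
    by (simp add: ev_def D_zero)
  finally show ?thesis
    by (simp add: eq_neg_iff_add_eq_0)
qed

lemma ideal_fiber: "ideal I_fiber D"
proof (rule idealI)
  interpret D: ring D
    by (rule D_ring)
  show "ring D"
    by (rule D_ring)
  show "subgroup I_fiber (add_monoid D)"
  proof (rule D.add.subgroupI)
    show "I_fiber \<subseteq> carrier D"
      by (auto simp: D_carrier)
    have "\<zero>\<^bsub>D\<^esub> \<in> I_fiber"
      using D.zero_closed by (auto simp: D_carrier ev_def D_zero J_0)
    then show "I_fiber \<noteq> {}"
      by blast
  next
    fix a
    assume "a \<in> I_fiber"
    then show "\<ominus>\<^bsub>D\<^esub> a \<in> I_fiber"
      using D.a_inv_closed by (auto simp: D_carrier ev_uminus J_uminus)
  qed (auto simp: D_add_closed ev_add J_add)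
  fix a x
  assume "a \<in> I_fiber" "x \<in> carrier D"
  then have a: "a \<in> up A" "ev a \<in> J" and x: "x \<in> up A"
    by (auto simp: D_carrier)
  have "ev (x \<otimes>\<^bsub>D\<^esub> a) - 0 \<in> J"
    using a x by (intro J_trans[OF ev_mult]) (simp_all add: J_l ev_P)
  moreover have "ev (a \<otimes>\<^bsub>D\<^esub> x) - 0 \<in> J"
    using a x by (intro J_trans[OF ev_mult]) (simp_all add: J_r ev_P)
  ultimately have "ev (x \<otimes>\<^bsub>D\<^esub> a) \<in> J" "ev (a \<otimes>\<^bsub>D\<^esub> x) \<in> J"
    by simp_all
  with a x show "x \<otimes>\<^bsub>D\<^esub> a \<in> I_fiber" "a \<otimes>\<^bsub>D\<^esub> x \<in> I_fiber"
    by (auto simp: D_mult_closed)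
qed

lemma fiber_coset:
  assumes p: "p \<in> up A"
  shows "I_fiber +>\<^bsub>D\<^esub> p = {q \<in> up A. cl (ev q) = cl (ev p)}"
proof -
  interpret I: ideal I_fiber D
    by (rule ideal_fiber)
  have "q \<in> I_fiber +>\<^bsub>D\<^esub> p \<longleftrightarrow> q \<in> up A \<and> ev q - ev p \<in> J" for q
  proof
    assume "q \<in> I_fiber +>\<^bsub>D\<^esub> p"
    then show "q \<in> up A \<and> ev q - ev p \<in> J"
      using p by (auto simp: a_r_coset_def' D_add_closed ev_add)
  next
    assume q: "q \<in> up A \<and> ev q - ev p \<in> J"
    then have "q \<ominus>\<^bsub>D\<^esub> p \<in> I_fiber"
      using p I.minus_closed[of q p] I.a_inv_closed[of p]
      by (simp add: D_carrier a_minus_def ev_add ev_uminus)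
    then show "q \<in> I_fiber +>\<^bsub>D\<^esub> p"
      using p q I.a_rcos_module_minus[OF D_ring, of p q] by (simp add: D_carrier)
  qed
  then show ?thesis
    using p by (auto simp: cl_eq ev_P)
qed

lemma fiber_at_one_simps:
  "carrier (fiber_at_one D) = (\<lambda>p. I_fiber +>\<^bsub>D\<^esub> p) ` up A"
  "x \<oplus>\<^bsub>fiber_at_one D\<^esub> y = x <+>\<^bsub>D\<^esub> y"
  "x \<otimes>\<^bsub>fiber_at_one D\<^esub> y = rcoset_mult D I_fiber x y"
  "\<one>\<^bsub>fiber_at_one D\<^esub> = I_fiber +>\<^bsub>D\<^esub> \<one>\<^bsub>D\<^esub>"
  "c \<odot>\<^bsub>fiber_at_one D\<^esub> Z = (\<Union>x\<in>Z. I_fiber +>\<^bsub>D\<^esub> ([:c:] \<odot>\<^bsub>D\<^esub> x))"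
  by (auto simp: fiber_at_one_def quotient_algebra_def Let_def ring.extend_def module.fields_def
      FactRing_def A_RCOSETS_def' D_carrier ev_kernel[symmetric])

lemma H_isomorphic_fiber: "alg_isomorphic H (fiber_at_one D)"
proof -
  interpret I: ideal I_fiber D
    by (rule ideal_fiber)
  \<comment> \<open>By \<open>fiber_coset\<close> the cosets of the kernel are the fibers of the map
    taking q to \<open>cl (ev q)\<close>. Sending x to the fiber over it is the inverse of the
    induced map from the fiber at t = 1 to H.\<close>
  define f where "f x = {q \<in> up A. cl (ev q) = x}" for x
  have f_cl: "f (cl (ev q)) = I_fiber +>\<^bsub>D\<^esub> q" if "q \<in> up A" for q
    using that by (simp add: f_def fiber_coset)
  have ex: "\<exists>q\<in>up A. x = cl (ev q)" if x: "x \<in> carrier H" for x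
  proof -
    obtain p where "p \<in> P" "x = cl p"
      using x unfolding H_carrier by blast
    with ev_surj show ?thesis
      by (metis cl_eq ev_P)
  qed
  have cl_ev: "cl (ev q) \<in> carrier H" if "q \<in> up A" for q
    using that by (auto simp: H_carrier ev_P)
  have "f \<in> ring_hom H (fiber_at_one D)"
  proof (rule ring_hom_memI)
    fix x
    assume "x \<in> carrier H"
    with ex f_cl show "f x \<in> carrier (fiber_at_one D)"
      by (force simp: fiber_at_one_simps)
  next
    fix x y
    assume "x \<in> carrier H" "y \<in> carrier H"
    then obtain p q where p: "p \<in> up A" "x = cl (ev p)" and q: "q \<in> up A" "y = cl (ev q)"
      using ex by meson
    have "x \<otimes>\<^bsub>H\<^esub> y = cl (ev (p \<otimes>\<^bsub>D\<^esub> q))"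
      using p q J_sym[OF ev_mult]
      by (simp add: cl_mult ev_P cl_eq D_mult_closed P_mult)
    then show "f (x \<otimes>\<^bsub>H\<^esub> y) = f x \<otimes>\<^bsub>fiber_at_one D\<^esub> f y"
      using p q by (simp add: f_cl D_mult_closed fiber_at_one_simps I.rcoset_mult_add D_carrier)
    have "x \<oplus>\<^bsub>H\<^esub> y = cl (ev (p \<oplus>\<^bsub>D\<^esub> q))"
      using p q by (simp add: cl_add ev_P ev_add)
    then show "f (x \<oplus>\<^bsub>H\<^esub> y) = f x \<oplus>\<^bsub>fiber_at_one D\<^esub> f y"
      using p q by (simp add: f_cl D_add_closed fiber_at_one_simps I.a_rcos_sum D_carrier)
  next
    have "\<one>\<^bsub>H\<^esub> = cl (ev \<one>\<^bsub>D\<^esub>)"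
      using J_sym[OF ev_one] by (simp add: cl_one cl_eq P_1 ev_P D_one_closed)
    then show "f \<one>\<^bsub>H\<^esub> = \<one>\<^bsub>fiber_at_one D\<^esub>"
      by (simp add: f_cl D_one_closed fiber_at_one_simps)
  qed
  moreover have "inj_on f (carrier H)"
  proof (rule inj_onI)
    fix x y
    assume "x \<in> carrier H" "y \<in> carrier H" "f x = f y"
    moreover from this obtain q where "q \<in> f x"
      using ex unfolding f_def by blast
    ultimately have "q \<in> f x" "q \<in> f y"
      by auto
    then show "x = y"
      by (simp add: f_def)
  qed
  moreover have "carrier (fiber_at_one D) \<subseteq> f ` carrier H"
    using f_cl cl_ev by (force simp: fiber_at_one_simps)
  moreover have "f (c \<odot>\<^bsub>H\<^esub> x) = c \<odot>\<^bsub>fiber_at_one D\<^esub> f x" if x: "x \<in> carrier H" for c x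
  proof -
    obtain q where q: "q \<in> up A" "x = cl (ev q)"
      using ex[OF x] by blast
    \<comment> \<open>The scalar multiple of a coset is defined as a union over its elements, so
      every representative p of the coset has to be treated.\<close>
    have *: "f (c \<odot>\<^bsub>H\<^esub> x) = I_fiber +>\<^bsub>D\<^esub> ([:c:] \<odot>\<^bsub>D\<^esub> p)" if "p \<in> f x" for p
    proof -
      have p: "p \<in> up A" "cl (ev p) = x"
        using that by (auto simp: f_def)
      have "cl (\<iota> c * ev p) = cl (ev ([:c:] \<odot>\<^bsub>D\<^esub> p))"
        using p J_sym[OF ev_smult[of p "[:c:]"]]
        by (simp add: cl_eq ev_P D_smult_closed P_mult P_\<iota>)
      then show ?thesis
        using p f_cl[of "[:c:] \<odot>\<^bsub>D\<^esub> p"] by (auto simp: cl_smult ev_P D_smult_closed)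
    qed
    moreover have "q \<in> f x"
      using q by (simp add: f_def)
    ultimately show ?thesis
      unfolding fiber_at_one_simps by auto
  qed
  ultimately have "f \<in> alg_iso H (fiber_at_one D)"
    unfolding alg_iso_def ring_iso_def bij_betw_def
    by (auto simp: ring_hom_def)
  then show ?thesis
    unfolding alg_isomorphic_def by blast
qed

end

section \<open>Free algebras\<close>

lemma single_Nil_mult: "Poly_Mapping.single [] c * Poly_Mapping.single w d = Poly_Mapping.single w (c * d)"
  by (simp add: mult_single plus_list_def)

lemma single_mult: "Poly_Mapping.single u c * Poly_Mapping.single w d = Poly_Mapping.single (u @ w) (c * d)"
  by (simp add: mult_single plus_list_def)

lemma one_eq_single: "1 = Poly_Mapping.single [] 1"
  by (metis single_one zero_list_def)

lemma sum_single_lookup: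
  "(\<Sum>w\<in>Poly_Mapping.keys p. Poly_Mapping.single w (Poly_Mapping.lookup p w)) = p"
proof (rule poly_mapping_eqI)
  fix u
  have "Poly_Mapping.lookup (\<Sum>w\<in>Poly_Mapping.keys p. Poly_Mapping.single w (Poly_Mapping.lookup p w)) u =
      (\<Sum>w\<in>Poly_Mapping.keys p. if w = u then Poly_Mapping.lookup p w else 0)"
    by (simp add: lookup_sum lookup_single when_def)
  then show "Poly_Mapping.lookup (\<Sum>w\<in>Poly_Mapping.keys p. Poly_Mapping.single w (Poly_Mapping.lookup p w)) u =
      Poly_Mapping.lookup p u"
    by (simp add: in_keys_iff)
qed

lemma poly_mapping_words_induct [consumes 1, case_names single zero add]:
  fixes p :: "'x \<Rightarrow>\<^sub>0 'b::comm_monoid_add"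
  assumes "Poly_Mapping.keys p \<subseteq> S"
    and single: "\<And>w c. w \<in> S \<Longrightarrow> Q (Poly_Mapping.single w c)"
    and zero: "Q 0"
    and add: "\<And>p q. Q p \<Longrightarrow> Q q \<Longrightarrow> Q (p + q)"
  shows "Q p"
proof -
  have "Q (\<Sum>w\<in>W. Poly_Mapping.single w (Poly_Mapping.lookup p w))" if "W \<subseteq> S" for W
    using that by (induction W rule: infinite_finite_induct) (auto intro: single zero add)
  from this[OF assms(1)] show ?thesis
    by (simp add: sum_single_lookup)
qed

lemma poly_mapping_single_induct [case_names single zero add]:
  fixes p :: "'x \<Rightarrow>\<^sub>0 'b::comm_monoid_add"
  assumes "\<And>w c. Q (Poly_Mapping.single w c)" "Q 0" "\<And>p q. Q p \<Longrightarrow> Q q \<Longrightarrow> Q (p + q)"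
  shows "Q p"
  using subset_UNIV by (rule poly_mapping_words_induct) (use assms in auto)

lemma scalar_comm:
  fixes p :: "'x list \<Rightarrow>\<^sub>0 'k::field"
  shows "Poly_Mapping.single 0 c * p = p * Poly_Mapping.single 0 c"
  by (induction p rule: poly_mapping_single_induct)
     (simp_all add: mult_single mult.commute distrib_left distrib_right)

lemma lookup_scalar [simp]:
  fixes p :: "'x list \<Rightarrow>\<^sub>0 'k::field"
  shows "Poly_Mapping.lookup (Poly_Mapping.single 0 c * p) w = c * Poly_Mapping.lookup p w"
  by (induction p rule: poly_mapping_single_induct)
     (simp_all add: mult_single lookup_single when_def distrib_left lookup_add)

lemma vector_space_free: "vector_space (\<lambda>c (p :: 'x list \<Rightarrow>\<^sub>0 'k::field). Poly_Mapping.single 0 c * p)"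
  by unfold_locales
     (simp_all add: distrib_left distrib_right single_add mult.assoc[symmetric] mult_single)

interpretation free: vector_space "\<lambda>c (p :: 'x list \<Rightarrow>\<^sub>0 'k::field). Poly_Mapping.single 0 c * p"
  by (rule vector_space_free)

interpretation free_pair: vector_space_pair
  "\<lambda>c (p :: 'x list \<Rightarrow>\<^sub>0 'k::field). Poly_Mapping.single 0 c * p"
  "\<lambda>c (p :: 'y list \<Rightarrow>\<^sub>0 'k::field). Poly_Mapping.single 0 c * p"
  by unfold_locales

lemma sum_keys_superset:
  assumes "finite S" "Poly_Mapping.keys p \<subseteq> S" "\<And>w. g w 0 = 0"
  shows "(\<Sum>w\<in>Poly_Mapping.keys p. g w (Poly_Mapping.lookup p w)) =
    (\<Sum>w\<in>S. g w (Poly_Mapping.lookup p w))"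
  by (rule sum.mono_neutral_left) (use assms in \<open>auto simp: in_keys_iff\<close>)

text \<open>Cancellation may make the keys of p + q fewer than those of p and q. As g vanishes on
  the coefficient 0, all three sums can be extended to the union of the keys of p and q.\<close>

lemma sum_keys_add:
  fixes g :: "'w \<Rightarrow> 'k::comm_monoid_add \<Rightarrow> 'b::comm_monoid_add"
  assumes z: "\<And>w. g w 0 = 0" and a: "\<And>w c d. g w (c + d) = g w c + g w d"
  shows "(\<Sum>w\<in>Poly_Mapping.keys (p + q). g w (Poly_Mapping.lookup (p + q) w)) =
    (\<Sum>w\<in>Poly_Mapping.keys p. g w (Poly_Mapping.lookup p w)) +
    (\<Sum>w\<in>Poly_Mapping.keys q. g w (Poly_Mapping.lookup q w))"
proof -
  let ?S = "Poly_Mapping.keys p \<union> Poly_Mapping.keys q"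
  have "(\<Sum>w\<in>Poly_Mapping.keys (p + q). g w (Poly_Mapping.lookup (p + q) w)) =
      (\<Sum>w\<in>?S. g w (Poly_Mapping.lookup (p + q) w))"
    "(\<Sum>w\<in>Poly_Mapping.keys p. g w (Poly_Mapping.lookup p w)) = (\<Sum>w\<in>?S. g w (Poly_Mapping.lookup p w))"
    "(\<Sum>w\<in>Poly_Mapping.keys q. g w (Poly_Mapping.lookup q w)) = (\<Sum>w\<in>?S. g w (Poly_Mapping.lookup q w))"
    by (rule sum_keys_superset; use keys_add[of p q] z in auto)+
  then show ?thesis
    by (simp add: lookup_add a sum.distrib)
qed

lemma free_map_add: "free_map f (p + q) = free_map f p + free_map f q"
  unfolding free_map_def by (rule sum_keys_add) (simp_all add: single_add)

lemma free_map_single [simp]: "free_map f (Poly_Mapping.single w c) = Poly_Mapping.single (map f w) c"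
  by (cases "c = 0") (auto simp: free_map_def)

lemma free_map_0 [simp]: "free_map f 0 = 0"
  by (simp add: free_map_def)

lemma free_map_uminus: "free_map f (- p) = - free_map f p"
  using free_map_add[of f p "- p"] by (simp add: eq_neg_iff_add_eq_0 add.commute)

lemma free_map_diff: "free_map f (p - q) = free_map f p - free_map f q"
  using free_map_add[of f p "- q"] by (simp add: free_map_uminus)

lemma free_map_sum: "free_map f (sum h S) = (\<Sum>i\<in>S. free_map f (h i))"
  by (induction S rule: infinite_finite_induct) (auto simp: free_map_add)

lemma free_map_mult: "free_map f (p * q) = free_map f p * free_map f q"
proof (induction p rule: poly_mapping_single_induct)
  case (single w c)
  show ?case
    by (induction q rule: poly_mapping_single_induct)
       (simp_all add: single_mult free_map_add distrib_left)
qed (simp_all add: free_map_add distrib_right)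

lemma free_map_letter [simp]: "free_map f (letter v) = letter (f v)"
  by (simp add: letter_def)

lemma free_map_one [simp]: "free_map f 1 = 1"
  by (simp add: one_eq_single)

lemma free_map_scalar: "free_map f (Poly_Mapping.single 0 c * p) = Poly_Mapping.single 0 c * free_map f p"
  by (simp add: free_map_mult zero_list_def)

lemma free_map_compose: "free_map f (free_map h p) = free_map (\<lambda>v. f (h v)) p"
  by (induction p rule: poly_mapping_single_induct) (simp_all add: free_map_add comp_def)

lemma free_map_id [simp]: "free_map (\<lambda>v. v) p = p"
  by (induction p rule: poly_mapping_single_induct) (simp_all add: free_map_add)

lemma letter_mult_single: "letter v * Poly_Mapping.single w c = Poly_Mapping.single (v # w) c"
  by (simp add: letter_def single_mult)

section \<open>Homogeneous components of free algebras\<close>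

definition hcomp :: "nat \<Rightarrow> ('v list \<Rightarrow>\<^sub>0 'k::field) \<Rightarrow> 'v list \<Rightarrow>\<^sub>0 'k" where
  "hcomp d p = Poly_Mapping.mapp (\<lambda>w c. if length w = d then c else 0) p"

lemma lookup_hcomp [simp]:
  "Poly_Mapping.lookup (hcomp d p) w = (if length w = d then Poly_Mapping.lookup p w else 0)"
  by (auto simp: hcomp_def lookup_mapp in_keys_iff when_def)

lemma hcomp_add: "hcomp d (p + q) = hcomp d p + hcomp d q"
  by (rule poly_mapping_eqI) (simp add: lookup_add)

lemma hcomp_0 [simp]: "hcomp d 0 = 0"
  by (rule poly_mapping_eqI) simp

lemma hcomp_diff: "hcomp d (p - q) = hcomp d p - hcomp d q"
  by (rule poly_mapping_eqI) (simp add: lookup_minus)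

lemma hcomp_sum: "hcomp d (sum f S) = (\<Sum>i\<in>S. hcomp d (f i))"
  by (induction S rule: infinite_finite_induct) (auto simp: hcomp_add)

lemma hcomp_scalar: "hcomp d (Poly_Mapping.single 0 c * p) = Poly_Mapping.single 0 c * hcomp d p"
  by (rule poly_mapping_eqI) simp

lemma hcomp_single: "hcomp d (Poly_Mapping.single w c) = (if length w = d then Poly_Mapping.single w c else 0)"
  by (rule poly_mapping_eqI) (auto simp: lookup_single when_def)

lemma hcomp_hcomp: "hcomp d (hcomp e p) = (if d = e then hcomp e p else 0)"
  by (rule poly_mapping_eqI) auto

lemma hcomp_free_map: "hcomp d (free_map f p) = free_map f (hcomp d p)"
  by (induction p rule: poly_mapping_single_induct) (auto simp: hcomp_add free_map_add hcomp_single)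

lemma hcomp_eq_self: "(\<And>w. w \<in> Poly_Mapping.keys p \<Longrightarrow> length w = d) \<Longrightarrow> hcomp d p = p"
  by (rule poly_mapping_eqI) (auto simp: in_keys_iff)

lemma keys_hcomp: "w \<in> Poly_Mapping.keys (hcomp d p) \<longleftrightarrow> w \<in> Poly_Mapping.keys p \<and> length w = d"
  by (simp add: in_keys_iff)

lemma hcomp_single_mult:
  "hcomp d (Poly_Mapping.single w c * p) =
    (if length w \<le> d then Poly_Mapping.single w c * hcomp (d - length w) p else 0)"
  by (induction p rule: poly_mapping_single_induct)
     (auto simp: single_mult hcomp_single hcomp_add distrib_left)

lemma hcomp_mult_single:
  "hcomp d (p * Poly_Mapping.single w c) =
    (if length w \<le> d then hcomp (d - length w) p * Poly_Mapping.single w c else 0)"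
  by (induction p rule: poly_mapping_single_induct)
     (auto simp: single_mult hcomp_single hcomp_add distrib_right)

lemma hcomp_mult: "hcomp m (p * q) = (\<Sum>d\<le>m. hcomp d p * hcomp (m - d) q)"
proof (induction p rule: poly_mapping_single_induct)
  case (single w c)
  have "(\<Sum>d\<le>m. hcomp d (Poly_Mapping.single w c) * hcomp (m - d) q) =
      (\<Sum>d\<le>m. if d = length w then Poly_Mapping.single w c * hcomp (m - length w) q else 0)"
    by (rule sum.cong) (auto simp: hcomp_single)
  then show ?case
    by (simp add: hcomp_single_mult)
qed (simp_all add: hcomp_add distrib_right sum.distrib)

lemma free_algebra_simps:
  "carrier (free_algebra L) = {p. Poly_Mapping.keys p \<subseteq> lists L}"
  "p \<otimes>\<^bsub>free_algebra L\<^esub> q = p * q" "\<one>\<^bsub>free_algebra L\<^esub> = 1"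
  "p \<oplus>\<^bsub>free_algebra L\<^esub> q = p + q" "\<zero>\<^bsub>free_algebra L\<^esub> = 0"
  "c \<odot>\<^bsub>free_algebra L\<^esub> p = Poly_Mapping.single 0 c * p"
  by (simp_all add: free_algebra_def)

lemma free_algebra_closed:
  "0 \<in> carrier (free_algebra L)" "1 \<in> carrier (free_algebra L)"
  "p \<in> carrier (free_algebra L) \<Longrightarrow> q \<in> carrier (free_algebra L) \<Longrightarrow> p + q \<in> carrier (free_algebra L)"
  "p \<in> carrier (free_algebra L) \<Longrightarrow> - p \<in> carrier (free_algebra L)"
  "p \<in> carrier (free_algebra L) \<Longrightarrow> q \<in> carrier (free_algebra L) \<Longrightarrow> p * q \<in> carrier (free_algebra L)"
  "Poly_Mapping.single 0 c \<in> carrier (free_algebra L)"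
proof -
  assume "p \<in> carrier (free_algebra L)" "q \<in> carrier (free_algebra L)"
  then show "p * q \<in> carrier (free_algebra L)"
    using keys_mult[of p q] by (fastforce simp: free_algebra_simps plus_list_def)
  from \<open>p \<in> _\<close> \<open>q \<in> _\<close> show "p + q \<in> carrier (free_algebra L)"
    using keys_add[of p q] by (fastforce simp: free_algebra_simps)
next
  assume "p \<in> carrier (free_algebra L)"
  then show "- p \<in> carrier (free_algebra L)"
    by (simp add: free_algebra_simps in_keys_iff subset_iff)
qed (auto simp: free_algebra_simps zero_list_def one_eq_single)

lemma ring_free_algebra: "ring (free_algebra L :: ('k::field, 'x list \<Rightarrow>\<^sub>0 'k) module)"
proof (rule ringI)
  show "abelian_group (free_algebra L :: ('k, 'x list \<Rightarrow>\<^sub>0 'k) module)"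
  proof (rule abelian_groupI)
    fix x
    assume "x \<in> carrier (free_algebra L :: ('k, 'x list \<Rightarrow>\<^sub>0 'k) module)"
    then show "\<exists>y\<in>carrier (free_algebra L). y \<oplus>\<^bsub>free_algebra L\<^esub> x = \<zero>\<^bsub>free_algebra L\<^esub>"
      by (intro bexI[of _ "- x"]) (simp_all add: free_algebra_closed free_algebra_simps(2-))
  qed (simp_all add: free_algebra_closed free_algebra_simps(2-) algebra_simps)
  show "Group.monoid (free_algebra L :: ('k, 'x list \<Rightarrow>\<^sub>0 'k) module)"
    by (rule monoidI) (simp_all add: free_algebra_closed free_algebra_simps(2-) mult.assoc)
qed (simp_all add: free_algebra_simps(2-) algebra_simps)

text \<open>An element of the free algebra is a sum of terms, so absorbing single terms from both
  sides is enough. Negatives arise from the empty word with coefficient -1.\<close>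

lemma ideal_free_algebraI:
  assumes "I \<subseteq> carrier (free_algebra L)" "0 \<in> I" "\<And>p q. p \<in> I \<Longrightarrow> q \<in> I \<Longrightarrow> p + q \<in> I"
    and l: "\<And>w c p. w \<in> lists L \<Longrightarrow> p \<in> I \<Longrightarrow> Poly_Mapping.single w c * p \<in> I"
    and r: "\<And>w c p. w \<in> lists L \<Longrightarrow> p \<in> I \<Longrightarrow> p * Poly_Mapping.single w c \<in> I"
  shows "ideal I (free_algebra L :: ('k::field, 'x list \<Rightarrow>\<^sub>0 'k) module)"
proof (rule idealI)
  interpret R: ring "free_algebra L :: ('k, 'x list \<Rightarrow>\<^sub>0 'k) module"
    by (rule ring_free_algebra)
  show "ring (free_algebra L :: ('k, 'x list \<Rightarrow>\<^sub>0 'k) module)"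
    by (rule ring_free_algebra)
  have mult: "q * p \<in> I" "p * q \<in> I" if "p \<in> I" "Poly_Mapping.keys q \<subseteq> lists L" for p q
    using that(2) by (induction q rule: poly_mapping_words_induct)
      (use that assms in \<open>auto simp: distrib_left distrib_right\<close>)
  show "subgroup I (add_monoid (free_algebra L))"
  proof (rule R.add.subgroupI)
    fix p
    assume p: "p \<in> I"
    have "Poly_Mapping.single [] (- 1) * p \<in> I"
      using p by (intro l) auto
    also have "Poly_Mapping.single [] (- 1) * p = - p"
      by (simp add: single_uminus one_eq_single[symmetric])
    also have "- p = \<ominus>\<^bsub>free_algebra L\<^esub> p"
      using p assms(1)
      by (intro R.minus_equality[symmetric]) (auto simp: free_algebra_closed free_algebra_simps(4,5))
    finally show "\<ominus>\<^bsub>free_algebra L\<^esub> p \<in> I" .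
  qed (use assms in \<open>auto simp: free_algebra_simps(4)\<close>)
  fix a x
  assume "a \<in> I" "x \<in> carrier (free_algebra L :: ('k, 'x list \<Rightarrow>\<^sub>0 'k) module)"
  with mult show "x \<otimes>\<^bsub>free_algebra L\<^esub> a \<in> I" "a \<otimes>\<^bsub>free_algebra L\<^esub> x \<in> I"
    by (auto simp: free_algebra_simps)
qed

section \<open>Quotients of free algebras in terms of representatives\<close>

locale free_quotient =
  fixes L :: "'x set" and I :: "('x list \<Rightarrow>\<^sub>0 'k::field) set"
  assumes ideal_I: "ideal I (free_algebra L)"
begin

sublocale ideal I "free_algebra L"
  by (rule ideal_I)

definition cls :: "('x list \<Rightarrow>\<^sub>0 'k) \<Rightarrow> ('x list \<Rightarrow>\<^sub>0 'k) set" where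
  "cls p = I +>\<^bsub>free_algebra L\<^esub> p"

lemma cls_eq_image: "cls p = (\<lambda>q. q + p) ` I"
  by (auto simp: cls_def a_r_coset_def' free_algebra_simps)

lemma I_0: "0 \<in> I"
  using additive_subgroup.zero_closed[OF is_additive_subgroup] by (simp add: free_algebra_simps(5))

lemma I_add: "p \<in> I \<Longrightarrow> q \<in> I \<Longrightarrow> p + q \<in> I"
  using additive_subgroup.a_closed[OF is_additive_subgroup, of p q]
  by (simp add: free_algebra_simps(4))

lemma I_carrier: "p \<in> I \<Longrightarrow> p \<in> carrier (free_algebra L)"
  by (rule Icarr)

lemma I_mult:
  assumes "p \<in> I" "q \<in> carrier (free_algebra L)"
  shows "q * p \<in> I" "p * q \<in> I"
  using I_l_closed[OF assms] I_r_closed[OF assms] by (simp_all add: free_algebra_simps)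

lemma I_scalar: "p \<in> I \<Longrightarrow> Poly_Mapping.single 0 c * p \<in> I"
  by (simp add: I_mult free_algebra_closed)

lemma I_uminus: "p \<in> I \<Longrightarrow> - p \<in> I"
  using I_scalar[of p "- 1"] by (simp add: single_uminus)

lemma I_diff: "p \<in> I \<Longrightarrow> q \<in> I \<Longrightarrow> p - q \<in> I"
  using I_add[of p "- q"] I_uminus by simp

lemma I_sym: "p - q \<in> I \<Longrightarrow> q - p \<in> I"
  using I_uminus[of "p - q"] by simp

lemma I_trans: "p - q \<in> I \<Longrightarrow> q - r \<in> I \<Longrightarrow> p - r \<in> I"
  using I_add[of "p - q" "q - r"] by simp

lemma mem_cls: "q \<in> cls p \<longleftrightarrow> q - p \<in> I"
proof
  assume "q - p \<in> I"
  then have "(q - p) + p \<in> cls p"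
    unfolding cls_eq_image by (rule imageI)
  then show "q \<in> cls p"
    by simp
qed (auto simp: cls_eq_image)

lemma cls_self: "p \<in> cls p"
  using I_0 by (simp add: mem_cls)

lemma cls_eq: "cls p = cls q \<longleftrightarrow> p - q \<in> I"
proof
  assume "cls p = cls q"
  then show "p - q \<in> I"
    using cls_self mem_cls by blast
next
  assume "p - q \<in> I"
  then have "x - p \<in> I \<longleftrightarrow> x - q \<in> I" for x
    using I_trans[of x p q] I_trans[of x q p] I_sym[of p q] by blast
  then show "cls p = cls q"
    by (auto simp: mem_cls)
qed

lemma quotient_simps:
  "carrier (quotient_algebra (free_algebra L) I) = cls ` carrier (free_algebra L)"
  "x \<oplus>\<^bsub>quotient_algebra (free_algebra L) I\<^esub> y = x <+>\<^bsub>free_algebra L\<^esub> y"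
  "x \<otimes>\<^bsub>quotient_algebra (free_algebra L) I\<^esub> y = rcoset_mult (free_algebra L) I x y"
  "\<one>\<^bsub>quotient_algebra (free_algebra L) I\<^esub> = cls \<one>\<^bsub>free_algebra L\<^esub>"
  "\<zero>\<^bsub>quotient_algebra (free_algebra L) I\<^esub> = I"
  "c \<odot>\<^bsub>quotient_algebra (free_algebra L) I\<^esub> Z = (\<Union>x\<in>Z. cls (c \<odot>\<^bsub>free_algebra L\<^esub> x))"
  unfolding quotient_algebra_def ring.extend_def module.fields_def FactRing_def A_RCOSETS_def' cls_def
  by (simp_all only: module.simps ring.simps monoid.simps partial_object.simps UNION_singleton_eq_range)

lemma quotient_add:
  assumes "p \<in> carrier (free_algebra L)" "q \<in> carrier (free_algebra L)"
  shows "cls p \<oplus>\<^bsub>quotient_algebra (free_algebra L) I\<^esub> cls q = cls (p + q)"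
  unfolding quotient_simps unfolding cls_def a_rcos_sum[OF assms] free_algebra_simps ..

lemma quotient_mult:
  assumes "p \<in> carrier (free_algebra L)" "q \<in> carrier (free_algebra L)"
  shows "cls p \<otimes>\<^bsub>quotient_algebra (free_algebra L) I\<^esub> cls q = cls (p * q)"
  unfolding quotient_simps unfolding cls_def rcoset_mult_add[OF assms] free_algebra_simps ..

lemma quotient_zero: "\<zero>\<^bsub>quotient_algebra (free_algebra L) I\<^esub> = cls 0"
  by (simp add: quotient_simps(5) cls_eq_image)

lemma quotient_one: "\<one>\<^bsub>quotient_algebra (free_algebra L) I\<^esub> = cls 1"
  unfolding quotient_simps free_algebra_simps ..

text \<open>The scalar multiple of a coset is a union of cosets, one for each element; they coincide
  because the ideal absorbs scalars.\<close>

lemma quotient_smult: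
  "c \<odot>\<^bsub>quotient_algebra (free_algebra L) I\<^esub> cls p = cls (Poly_Mapping.single 0 c * p)"
proof -
  have "cls (Poly_Mapping.single 0 c * x) = cls (Poly_Mapping.single 0 c * p)" if "x \<in> cls p" for x
    using I_scalar[OF that[unfolded mem_cls], of c] unfolding cls_eq right_diff_distrib .
  then have "(\<Union>x\<in>cls p. cls (Poly_Mapping.single 0 c * x)) = cls (Poly_Mapping.single 0 c * p)"
    using cls_self[of p] by blast
  then show ?thesis
    unfolding quotient_simps free_algebra_simps .
qed

lemma quotient_abelian_group:
  "abelian_group (quotient_algebra (free_algebra L) I)"
proof (rule abelian_groupI)
  fix x
  assume "x \<in> carrier (quotient_algebra (free_algebra L) I)"
  then obtain p where "x = cls p" "p \<in> carrier (free_algebra L)"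
    by (auto simp: quotient_simps(1))
  then show "\<exists>y\<in>carrier (quotient_algebra (free_algebra L) I).
      y \<oplus>\<^bsub>quotient_algebra (free_algebra L) I\<^esub> x = \<zero>\<^bsub>quotient_algebra (free_algebra L) I\<^esub>"
    by (intro bexI[of _ "cls (- p)"])
       (simp_all add: quotient_add quotient_zero quotient_simps(1) free_algebra_closed)
qed (auto simp: quotient_add quotient_zero quotient_simps(1) free_algebra_closed add_ac)

lemma quotient_finsum:
  assumes "\<And>i. i \<in> S \<Longrightarrow> f i \<in> carrier (free_algebra L)"
  shows "(\<Oplus>\<^bsub>quotient_algebra (free_algebra L) I\<^esub>i\<in>S. cls (f i)) = cls (\<Sum>i\<in>S. f i)"
proof -
  interpret Q: abelian_group "quotient_algebra (free_algebra L) I"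
    by (rule quotient_abelian_group)
  have "(\<Oplus>\<^bsub>quotient_algebra (free_algebra L) I\<^esub>i\<in>S. cls (f i)) = cls (\<Sum>i\<in>S. f i) \<and>
      (\<Sum>i\<in>S. f i) \<in> carrier (free_algebra L)"
    using assms
  proof (induction S rule: infinite_finite_induct)
    case (insert x S)
    then have "(\<lambda>i. cls (f i)) \<in> S \<rightarrow> carrier (quotient_algebra (free_algebra L) I)"
      by (auto simp: quotient_simps(1))
    with insert show ?case
      by (simp add: Q.finsum_insert quotient_simps(1) quotient_add free_algebra_closed)
  qed (simp_all add: quotient_zero free_algebra_closed)
  then show ?thesis
    by simp
qed

end

section \<open>The symmetric algebra\<close>

lemma ideal_genideal_free_algebra:
  "R \<subseteq> carrier (free_algebra L) \<Longrightarrow> ideal (genideal (free_algebra L) R) (free_algebra L)"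
  by (rule ring.genideal_ideal[OF ring_free_algebra])

text \<open>The members of the generated ideal that satisfy Q form an ideal containing the
  generators, and the generated ideal is the smallest such.\<close>

lemma genideal_free_algebra_induct [consumes 2, case_names rel zero add left right]:
  assumes R: "R \<subseteq> carrier (free_algebra L)" and p: "p \<in> genideal (free_algebra L) R"
    and Q: "\<And>r. r \<in> R \<Longrightarrow> Q r" "Q 0"
    "\<And>p q. Q p \<Longrightarrow> Q q \<Longrightarrow> Q (p + q)"
    "\<And>w c p. w \<in> lists L \<Longrightarrow> Q p \<Longrightarrow> Q (Poly_Mapping.single w c * p)"
    "\<And>w c p. w \<in> lists L \<Longrightarrow> Q p \<Longrightarrow> Q (p * Poly_Mapping.single w c)"
  shows "Q p"
proof -
  let ?I = "genideal (free_algebra L) R"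
  interpret free_quotient L ?I
    by (rule free_quotient.intro) (rule ideal_genideal_free_algebra[OF R])
  have sub: "w \<in> lists L \<Longrightarrow> Poly_Mapping.single w c \<in> carrier (free_algebra L)" for w c
    by (auto simp: free_algebra_simps)
  have "ideal {p \<in> ?I. Q p} (free_algebra L)"
    by (rule ideal_free_algebraI) (use Q I_carrier in \<open>auto intro: I_0 I_add I_mult sub\<close>)
  moreover have "R \<subseteq> {p \<in> ?I. Q p}"
    using Q(1) ring.genideal_self[OF ring_free_algebra R] by auto
  ultimately have "?I \<subseteq> {p \<in> ?I. Q p}"
    by (rule ring.genideal_minimal[OF ring_free_algebra])
  with p show ?thesis
    by blast
qed

locale sym_space = finite_dimensional_vector_space scale Basis
  for scale :: "'k::field \<Rightarrow> 'v::ab_group_add \<Rightarrow> 'v" and Basis :: "'v set"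
begin

abbreviation I :: "('v list \<Rightarrow>\<^sub>0 'k) set" where
  "I \<equiv> sym_ideal scale"

lemma sym_relations_carrier: "sym_relations scale \<subseteq> carrier (free_algebra UNIV)"
  by (simp add: free_algebra_simps)

sublocale S: free_quotient UNIV "sym_ideal scale"
  unfolding sym_ideal_def
  by (rule free_quotient.intro) (rule ideal_genideal_free_algebra[OF sym_relations_carrier])

lemma S_cls: "S.cls = sym_class scale"
  by (rule ext) (simp add: S.cls_def sym_class_def)

lemma carrier_free_UNIV [simp]: "p \<in> carrier (free_algebra UNIV)"
  by (simp add: free_algebra_simps)

lemma sym_ideal_induct [consumes 1, case_names vadd smult commute zero add left right]:
  assumes "p \<in> I"
    and "\<And>v w. Q (letter (v + w) - letter v - letter w)"
    and "\<And>c v. Q (letter (scale c v) - Poly_Mapping.single 0 c * letter v)"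
    and "\<And>v w. Q (letter v * letter w - letter w * letter v)"
    and "Q 0" "\<And>p q. Q p \<Longrightarrow> Q q \<Longrightarrow> Q (p + q)"
    and "\<And>w c p. Q p \<Longrightarrow> Q (Poly_Mapping.single w c * p)"
    and "\<And>w c p. Q p \<Longrightarrow> Q (p * Poly_Mapping.single w c)"
  shows "Q p"
  using sym_relations_carrier assms(1)[unfolded sym_ideal_def]
  by (rule genideal_free_algebra_induct) (use assms in \<open>auto simp: sym_relations_def\<close>)

lemma sym_relation_mem:
  "letter (v + w) - letter v - letter w \<in> I"
  "letter (scale c v) - Poly_Mapping.single 0 c * letter v \<in> I"
  "letter v * letter w - letter w * letter v \<in> I"
proof -
  have "sym_relations scale \<subseteq> I"
    unfolding sym_ideal_def by (rule ring.genideal_self[OF ring_free_algebra sym_relations_carrier])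
  moreover have "letter (v + w) - letter v - letter w \<in> sym_relations scale"
    "letter (scale c v) - Poly_Mapping.single 0 c * letter v \<in> sym_relations scale"
    "letter v * letter w - letter w * letter v \<in> sym_relations scale"
    unfolding sym_relations_def by blast+
  ultimately show "letter (v + w) - letter v - letter w \<in> I"
    "letter (scale c v) - Poly_Mapping.single 0 c * letter v \<in> I"
    "letter v * letter w - letter w * letter v \<in> I"
    by blast+
qed

lemma hcomp_sym_relation:
  "hcomp d (letter (v + w) - letter v - letter w :: 'v list \<Rightarrow>\<^sub>0 'k) =
    (if d = 1 then letter (v + w) - letter v - letter w else 0)"
  "hcomp d (letter (scale c v) - Poly_Mapping.single 0 c * letter v) =
    (if d = 1 then letter (scale c v) - Poly_Mapping.single 0 c * letter v else 0)"
  "hcomp d (letter v * letter w - letter w * letter v :: 'v list \<Rightarrow>\<^sub>0 'k) =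
    (if d = 2 then letter v * letter w - letter w * letter v else 0)"
  by (auto simp: letter_def hcomp_diff hcomp_single single_mult zero_list_def)

text \<open>The relations are homogeneous, and multiplying by a word shifts the degree by its
  length; because of this shift the induction runs over all d at once.\<close>

lemma sym_ideal_hcomp:
  assumes "p \<in> I"
  shows "hcomp d p \<in> I"
  using assms
proof (induction p arbitrary: d rule: sym_ideal_induct)
  case (left w c p)
  then show ?case
    by (simp add: hcomp_single_mult S.I_mult S.I_0)
next
  case (right w c p)
  then show ?case
    by (simp add: hcomp_mult_single S.I_mult S.I_0)
qed (auto simp: hcomp_sym_relation hcomp_add sym_relation_mem S.I_0 S.I_add)

text \<open>The linear part of a tensor, evaluated in V. It inverts \<open>letter\<close> and
  vanishes on the ideal, so V embeds into S(V).\<close>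

definition letter_sum :: "('v list \<Rightarrow>\<^sub>0 'k) \<Rightarrow> 'v" where
  "letter_sum p = (\<Sum>w\<in>Poly_Mapping.keys p.
     if length w = 1 then scale (Poly_Mapping.lookup p w) (hd w) else 0)"

lemma letter_sum_add: "letter_sum (p + q) = letter_sum p + letter_sum q"
  unfolding letter_sum_def
  by (rule sum_keys_add[where g = "\<lambda>w a. if length w = 1 then scale a (hd w) else 0"])
     (auto simp: scale_left_distrib)

lemma letter_sum_single: "letter_sum (Poly_Mapping.single w c) = (if length w = 1 then scale c (hd w) else 0)"
  by (cases "c = 0") (auto simp: letter_sum_def)

lemma letter_sum_0: "letter_sum 0 = 0"
  by (simp add: letter_sum_def)

lemma letter_sum_letter: "letter_sum (letter v) = v"
  by (simp add: letter_def letter_sum_single)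

lemma letter_sum_diff: "letter_sum (p - q) = letter_sum p - letter_sum q"
  using letter_sum_add[of "p - q" q] by simp

lemma lookup_Nil_single_mult:
  "Poly_Mapping.lookup (Poly_Mapping.single w c * p) [] = (if w = [] then c * Poly_Mapping.lookup p [] else 0)"
  by (induction p rule: poly_mapping_single_induct)
     (auto simp: single_mult lookup_single when_def distrib_left lookup_add)

lemma lookup_Nil_mult_single:
  "Poly_Mapping.lookup (p * Poly_Mapping.single w c) [] = (if w = [] then Poly_Mapping.lookup p [] * c else 0)"
  by (induction p rule: poly_mapping_single_induct)
     (auto simp: single_mult lookup_single when_def distrib_right lookup_add)

lemma letter_sum_single_mult:
  "letter_sum (Poly_Mapping.single w c * p) =
    (if w = [] then scale c (letter_sum p)
     else if length w = 1 then scale (c * Poly_Mapping.lookup p []) (hd w) else 0)"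
  by (induction p rule: poly_mapping_single_induct)
     (auto simp: single_mult lookup_single when_def distrib_left lookup_add letter_sum_single
       letter_sum_add letter_sum_0 scale_right_distrib scale_left_distrib)

lemma letter_sum_mult_single:
  "letter_sum (p * Poly_Mapping.single w c) =
    (if w = [] then scale c (letter_sum p)
     else if length w = 1 then scale (c * Poly_Mapping.lookup p []) (hd w) else 0)"
  by (induction p rule: poly_mapping_single_induct)
     (auto simp: single_mult lookup_single when_def distrib_right distrib_left lookup_add letter_sum_single
       letter_sum_add letter_sum_0 scale_right_distrib scale_left_distrib mult.commute)

text \<open>In degree 1 the ideal only contains consequences of the linearity relations, which
  evaluate to 0 in V. The two claims need a joint induction: multiplying by a letter turns the
  constant term into a linear one.\<close>

lemma sym_ideal_low:
  assumes "p \<in> I"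
  shows "Poly_Mapping.lookup p [] = 0 \<and> letter_sum p = 0"
  using assms
proof (induction p rule: sym_ideal_induct)
  case (smult c v)
  have "letter_sum (Poly_Mapping.single 0 c * letter v) = scale c v"
    by (simp add: letter_def single_Nil_mult zero_list_def letter_sum_single)
  then show ?case
    by (simp add: letter_sum_diff letter_sum_letter) (simp add: letter_def lookup_minus lookup_single)
next
  case (commute v w)
  show ?case
    by (simp add: letter_def single_mult letter_sum_diff letter_sum_single lookup_minus lookup_single)
next
  case (vadd v w)
  show ?case
    by (simp add: letter_sum_diff letter_sum_letter) (simp add: letter_def lookup_minus lookup_single)
qed (auto simp: letter_sum_add letter_sum_0 lookup_add lookup_Nil_single_mult letter_sum_single_mult
    lookup_Nil_mult_single letter_sum_mult_single)

text \<open>Letters from \<open>Basis\<close> leave only finitely many words of each length. This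
  makes the degree d part of the section finite-dimensional in \<open>W_finite_span\<close>.\<close>

definition basis_words :: "('v list \<Rightarrow>\<^sub>0 'k) set" where
  "basis_words = (\<lambda>w. Poly_Mapping.single w 1) ` lists Basis"

text \<open>Modulo the ideal each letter is a combination of letters from \<open>Basis\<close>, so
  left multiplication by any letter preserves the span. All words are then reached from the empty
  one.\<close>

lemma span_basis_words: "free.span (I \<union> basis_words) = UNIV"
proof -
  let ?E = "free.span (I \<union> basis_words)"
  have I_E: "p \<in> ?E" if "p \<in> I" for p
    using that by (auto intro: free.span_base)
  have word: "letter v * Poly_Mapping.single u 1 \<in> ?E" if u: "u \<in> lists Basis" for v u
  proof -
    have "v \<in> span Basis"
      by (simp add: span_Basis)
    then show ?thesis
    proof (induction rule: span_induct_alt)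
      case base
      \<comment> \<open>The generator attached to the zero vector is not 0 in the free algebra; the
        relation with c = 0 puts it into the ideal.\<close>
      have "letter (scale 0 0) - Poly_Mapping.single 0 0 * letter (0 :: 'v) \<in> I"
        by (rule sym_relation_mem)
      then have "letter 0 * Poly_Mapping.single u 1 \<in> I"
        by (simp add: S.I_mult)
      then show ?case
        by (rule I_E)
    next
      case (step c b y)
      let ?s = "Poly_Mapping.single u (1 :: 'k)"
      have "letter (scale c b + y) - Poly_Mapping.single 0 c * letter b - letter y \<in> I"
        using S.I_add[OF sym_relation_mem(1)[of "scale c b" y] sym_relation_mem(2)[of c b]]
        by (simp add: diff_diff_eq2 diff_diff_add add.commute)
      then have "(letter (scale c b + y) - Poly_Mapping.single 0 c * letter b - letter y) * ?s \<in> I"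
        by (simp add: S.I_mult)
      then have 1: "(letter (scale c b + y) - Poly_Mapping.single 0 c * letter b - letter y) * ?s \<in> ?E"
        by (rule I_E)
      have "Poly_Mapping.single (b # u) 1 \<in> basis_words"
        using step(1) u by (auto simp: basis_words_def)
      then have "Poly_Mapping.single 0 c * Poly_Mapping.single (b # u) 1 \<in> ?E"
        by (intro free.span_scale free.span_base) auto
      also have "Poly_Mapping.single 0 c * Poly_Mapping.single (b # u) 1 =
          Poly_Mapping.single 0 c * letter b * ?s"
        by (simp add: mult.assoc letter_mult_single)
      finally have 2: "Poly_Mapping.single 0 c * letter b * ?s + letter y * ?s \<in> ?E"
        using step(2) by (rule free.span_add)
      have "letter (scale c b + y) * ?s =
          (letter (scale c b + y) - Poly_Mapping.single 0 c * letter b - letter y) * ?s +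
          (Poly_Mapping.single 0 c * letter b * ?s + letter y * ?s)"
        by (simp add: left_diff_distrib)
      also have "\<dots> \<in> ?E"
        using 1 2 by (rule free.span_add)
      finally show ?case .
    qed
  qed
  have letter_E: "letter v * p \<in> ?E" if "p \<in> ?E" for v p
    using that
  proof (induction rule: free.span_induct_alt)
    case base
    show ?case
      by (simp add: free.span_zero)
  next
    case (step c x y)
    have "letter v * x \<in> ?E"
    proof (cases "x \<in> I")
      case True
      then show ?thesis
        by (intro I_E S.I_mult) simp_all
    next
      case False
      then show ?thesis
        using step(1) word unfolding basis_words_def by blast
    qed
    then have "Poly_Mapping.single 0 c * (letter v * x) + letter v * y \<in> ?E"
      using step(2) by (intro free.span_add free.span_scale)
    also have "Poly_Mapping.single 0 c * (letter v * x) + letter v * y =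
        letter v * (Poly_Mapping.single 0 c * x + y)"
      unfolding distrib_left by (metis mult.assoc scalar_comm)
    finally show ?case .
  qed
  have single: "Poly_Mapping.single w 1 \<in> ?E" for w
  proof (induction w)
    case Nil
    show ?case
      by (rule free.span_base) (auto simp: basis_words_def)
  next
    case (Cons v w)
    then show ?case
      using letter_E[of "Poly_Mapping.single w 1" v] by (simp add: letter_mult_single)
  qed
  have "p \<in> ?E" for p
  proof (induction p rule: poly_mapping_single_induct)
    case (single w c)
    have "Poly_Mapping.single 0 c * Poly_Mapping.single w 1 \<in> ?E"
      by (intro free.span_scale \<open>Poly_Mapping.single w 1 \<in> ?E\<close>)
    then show ?case
      by (simp add: mult_single)
  qed (auto intro: free.span_zero free.span_add)
  then show ?thesis
    by blast
qed

text \<open>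
  A linear normal form for \<open>S(V)\<close>: extend a basis of the ideal to a basis of the free algebra
  by words, and project along the ideal. As words are homogeneous, so is the projection.
\<close>

lemma ex_normal_form:
  "\<exists>f. (\<forall>p q. f (p + q) = f p + f q) \<and>
     (\<forall>c p. f (Poly_Mapping.single 0 c * p) = Poly_Mapping.single 0 c * f p) \<and>
     (\<forall>p. f p - p \<in> I) \<and> (\<forall>p\<in>I. f p = 0) \<and> (\<forall>d p. f (hcomp d p) = hcomp d (f p)) \<and>
     (\<forall>p. f p \<in> free.span basis_words)"
proof -
  obtain C where C: "C \<subseteq> I" "free.independent C" "I \<subseteq> free.span C"
    using free.maximal_independent_subset by blast
  obtain B where B: "C \<subseteq> B" "B \<subseteq> I \<union> basis_words" "free.independent B" "I \<union> basis_words \<subseteq> free.span B"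
    using free.maximal_independent_subset_extend[of C "I \<union> basis_words"] C by blast
  have span_B: "free.span B = UNIV"
    using free.span_minimal[OF B(4) free.subspace_span] span_basis_words by blast
  obtain f where f: "Vector_Spaces.linear (\<lambda>c p. Poly_Mapping.single 0 c * p)
      (\<lambda>c p. Poly_Mapping.single 0 c * p) f" "\<And>x. x \<in> B \<Longrightarrow> f x = (if x \<in> I then 0 else x)"
    using free_pair.linear_independent_extend[OF B(3), of "\<lambda>x. if x \<in> I then 0 else x"] by blast
  interpret f: Vector_Spaces.linear "\<lambda>c (p :: 'v list \<Rightarrow>\<^sub>0 'k). Poly_Mapping.single 0 c * p"
      "\<lambda>c (p :: 'v list \<Rightarrow>\<^sub>0 'k). Poly_Mapping.single 0 c * p" f
    by (rule f(1))
  have I_0: "f p = 0" if "p \<in> I" for p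
  proof -
    have "p \<in> free.span C"
      using that C by blast
    then show ?thesis
    proof (induction rule: free.span_induct_alt)
      case (step c x y)
      then have "f x = 0"
        using f(2)[of x] B(1) C(1) by (auto simp: subset_iff)
      with step show ?case
        by (simp add: f.add f.scale)
    qed (simp add: f.zero)
  qed
  have all: "f p - p \<in> I \<and> f p \<in> free.span basis_words \<and> (\<forall>d. f (hcomp d p) = hcomp d (f p))" for p
  proof -
    have "p \<in> free.span B"
      by (simp add: span_B)
    then show ?thesis
    proof (induction rule: free.span_induct_alt)
      case base
      show ?case
        by (simp add: f.zero S.I_0 free.span_zero)
    next
      case (step c x y)
      have x: "f x - x \<in> I \<and> f x \<in> free.span basis_words \<and> (\<forall>d. f (hcomp d x) = hcomp d (f x))"
      proof (cases "x \<in> I")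
        case True
        then show ?thesis
          by (simp add: I_0 S.I_uminus free.span_zero sym_ideal_hcomp)
      next
        case False
        then obtain w where "x = Poly_Mapping.single w 1" "x \<in> basis_words"
          using step(1) B(2) unfolding basis_words_def by blast
        moreover have "f x = x"
          using f(2) step(1) False by simp
        ultimately show ?thesis
          by (simp add: hcomp_single f.zero S.I_0 free.span_base)
      qed
      have "f (Poly_Mapping.single 0 c * x + y) - (Poly_Mapping.single 0 c * x + y) =
          Poly_Mapping.single 0 c * (f x - x) + (f y - y)"
        unfolding f.add f.scale right_diff_distrib by simp
      moreover have "Poly_Mapping.single 0 c * (f x - x) + (f y - y) \<in> I"
        using x step(2) by (intro S.I_add S.I_scalar) auto
      ultimately have "f (Poly_Mapping.single 0 c * x + y) - (Poly_Mapping.single 0 c * x + y) \<in> I"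
        by (simp only:)
      moreover have "f (Poly_Mapping.single 0 c * x + y) \<in> free.span basis_words"
        unfolding f.add f.scale using x step(2) by (intro free.span_add free.span_scale) auto
      ultimately show ?case
        using x step(2) by (simp add: f.add f.scale hcomp_add hcomp_scalar)
    qed
  qed
  show ?thesis
    by (intro exI[of _ f]) (use all I_0 in \<open>auto simp: f.add f.scale\<close>)
qed

definition nf :: "('v list \<Rightarrow>\<^sub>0 'k) \<Rightarrow> 'v list \<Rightarrow>\<^sub>0 'k" where
  "nf = (SOME f. (\<forall>p q. f (p + q) = f p + f q) \<and>
     (\<forall>c p. f (Poly_Mapping.single 0 c * p) = Poly_Mapping.single 0 c * f p) \<and>
     (\<forall>p. f p - p \<in> I) \<and> (\<forall>p\<in>I. f p = 0) \<and> (\<forall>d p. f (hcomp d p) = hcomp d (f p)) \<and>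
     (\<forall>p. f p \<in> free.span basis_words))"

lemma
  shows nf_add: "nf (p + q) = nf p + nf q"
    and nf_scalar: "nf (Poly_Mapping.single 0 c * p) = Poly_Mapping.single 0 c * nf p"
    and nf_diff_mem: "nf p - p \<in> I"
    and nf_I: "p \<in> I \<Longrightarrow> nf p = 0"
    and nf_hcomp: "nf (hcomp d p) = hcomp d (nf p)"
    and nf_span: "nf p \<in> free.span basis_words"
  using someI_ex[OF ex_normal_form] unfolding nf_def[symmetric] by blast+

lemma nf_0 [simp]: "nf 0 = 0"
  by (simp add: nf_I S.I_0)

lemma nf_diff: "nf (p - q) = nf p - nf q"
  using nf_add[of "p - q" q] by simp

lemma nf_eq_iff: "nf p = nf q \<longleftrightarrow> p - q \<in> I"
proof
  assume "nf p = nf q"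
  then have "(nf q - q) - (nf p - p) \<in> I \<longleftrightarrow> p - q \<in> I"
    by simp
  then show "p - q \<in> I"
    using S.I_diff[OF nf_diff_mem nf_diff_mem] by blast
next
  assume "p - q \<in> I"
  then show "nf p = nf q"
    using nf_I[of "p - q"] by (simp add: nf_diff)
qed

end

section \<open>Straightening in the algebra H\<close>

locale skew_setup = sym_space scale Basis + G: group G
  for scale :: "'k::field \<Rightarrow> 'v::ab_group_add \<Rightarrow> 'v" and Basis :: "'v set"
    and G :: "('g, 'm) monoid_scheme" (structure) +
  fixes \<rho> :: "'g \<Rightarrow> 'v \<Rightarrow> 'v"
    and lam :: "('g \<Rightarrow> 'k) \<Rightarrow> 'v \<Rightarrow> ('g \<Rightarrow> 'k)"
    and kap :: "'v \<Rightarrow> 'v \<Rightarrow> ('g \<Rightarrow> 'k)"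
  assumes finite_G: "finite (carrier G)"
    and action: "group_action G (UNIV :: 'v set) \<rho>"
    and linear_\<rho>: "g \<in> carrier G \<Longrightarrow> Vector_Spaces.linear scale scale (\<rho> g)"
begin

abbreviation L :: "('v + 'g) set" where
  "L \<equiv> H_generators G"

abbreviation PL :: "(('v + 'g) list \<Rightarrow>\<^sub>0 'k) set" where
  "PL \<equiv> carrier (free_algebra L)"

abbreviation J :: "(('v + 'g) list \<Rightarrow>\<^sub>0 'k) set" where
  "J \<equiv> H_ideal G scale \<rho> lam kap"

abbreviation vdeg :: "('v + 'g) list \<Rightarrow> nat" where
  "vdeg u \<equiv> length (filter isl u)"

abbreviation gl :: "'g \<Rightarrow> ('v + 'g) list \<Rightarrow>\<^sub>0 'k" where
  "gl g \<equiv> letter (Inr g)"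

abbreviation vl :: "'v \<Rightarrow> ('v + 'g) list \<Rightarrow>\<^sub>0 'k" where
  "vl v \<equiv> letter (Inl v)"

abbreviation emb :: "('v list \<Rightarrow>\<^sub>0 'k) \<Rightarrow> ('v + 'g) list \<Rightarrow>\<^sub>0 'k" where
  "emb \<equiv> free_map Inl"

lemma \<rho>_mult: "g \<in> carrier G \<Longrightarrow> h \<in> carrier G \<Longrightarrow> \<rho> (g \<otimes> h) v = \<rho> g (\<rho> h v)"
  using group_action.composition_rule[OF action] by simp

lemma \<rho>_one: "\<rho> \<one> v = v"
  using group_action.id_eq_one[OF action] by (metis UNIV_I restrict_apply')

lemma \<rho>_inv: "g \<in> carrier G \<Longrightarrow> \<rho> g (\<rho> (inv g) v) = v"
  using \<rho>_mult[of g "inv g" v] by (simp add: \<rho>_one)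

lemma \<rho>_add: "g \<in> carrier G \<Longrightarrow> \<rho> g (v + w) = \<rho> g v + \<rho> g w"
  using linear_\<rho> by (simp add: Vector_Spaces.linear_iff)

lemma \<rho>_scale: "g \<in> carrier G \<Longrightarrow> \<rho> g (scale c v) = scale c (\<rho> g v)"
  using linear_\<rho> by (simp add: Vector_Spaces.linear_iff)

lemma single_PL: "u \<in> lists L \<Longrightarrow> Poly_Mapping.single u c \<in> PL"
  by (auto simp: free_algebra_simps)

lemma vl_PL: "vl v \<in> PL"
  unfolding letter_def by (rule single_PL) (simp add: H_generators_def)

lemma gl_PL: "g \<in> carrier G \<Longrightarrow> gl g \<in> PL"
  unfolding letter_def by (rule single_PL) (simp add: H_generators_def)

lemma PL_diff: "p \<in> PL \<Longrightarrow> q \<in> PL \<Longrightarrow> p - q \<in> PL"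
  using free_algebra_closed(3)[of p L "- q"] free_algebra_closed(4) by auto

lemma PL_sum: "(\<And>i. i \<in> S \<Longrightarrow> f i \<in> PL) \<Longrightarrow> sum f S \<in> PL"
  by (induction S rule: infinite_finite_induct) (auto intro: free_algebra_closed)

lemma free_group_part_PL: "free_group_part G a \<in> PL"
  unfolding free_group_part_def by (intro PL_sum single_PL) (auto simp: H_generators_def)

lemma H_relations_PL: "H_relations G scale \<rho> lam kap \<subseteq> PL"
  unfolding H_relations_def
  by (auto intro!: PL_diff free_algebra_closed vl_PL gl_PL free_group_part_PL)

sublocale H: free_quotient L "H_ideal G scale \<rho> lam kap"
  unfolding H_ideal_def
  by (rule free_quotient.intro) (rule ideal_genideal_free_algebra[OF H_relations_PL])

lemma H_relation_mem:
  "vl (v + w) - vl v - vl w \<in> J"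
  "vl (scale c v) - Poly_Mapping.single 0 c * vl v \<in> J"
  "gl \<one> - 1 \<in> J"
  "g \<in> carrier G \<Longrightarrow> h \<in> carrier G \<Longrightarrow> gl g * gl h - gl (g \<otimes> h) \<in> J"
  "vl v * vl w - vl w * vl v - free_group_part G (kap v w) \<in> J"
  "g \<in> carrier G \<Longrightarrow>
    gl g * vl v - vl (\<rho> g v) * gl g - free_group_part G (lam (group_elt G g) v) \<in> J"
proof -
  have sub: "H_relations G scale \<rho> lam kap \<subseteq> J"
    unfolding H_ideal_def by (rule ring.genideal_self[OF ring_free_algebra H_relations_PL])
  show
    "vl (v + w) - vl v - vl w \<in> J"
    "vl (scale c v) - Poly_Mapping.single 0 c * vl v \<in> J"
    "gl \<one> - 1 \<in> J"
    "g \<in> carrier G \<Longrightarrow> h \<in> carrier G \<Longrightarrow> gl g * gl h - gl (g \<otimes> h) \<in> J"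
    "vl v * vl w - vl w * vl v - free_group_part G (kap v w) \<in> J"
    "g \<in> carrier G \<Longrightarrow>
      gl g * vl v - vl (\<rho> g v) * gl g - free_group_part G (lam (group_elt G g) v) \<in> J"
    by (rule subsetD[OF sub]; unfold H_relations_def; blast)+
qed

section \<open>The filtration by the number of letters from V\<close>

definition PLlt :: "nat \<Rightarrow> (('v + 'g) list \<Rightarrow>\<^sub>0 'k) set" where
  "PLlt d = {p \<in> PL. \<forall>u\<in>Poly_Mapping.keys p. vdeg u < d}"

text \<open>A difference in \<open>JP d\<close> means equality in H up to degrees below d. The
  strict inequality in \<open>PLlt\<close> makes \<open>JP 0\<close> equal to J, in accordance with
  F (-1) = 0.\<close>

definition JP :: "nat \<Rightarrow> (('v + 'g) list \<Rightarrow>\<^sub>0 'k) set" where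
  "JP d = {x + y | x y. x \<in> J \<and> y \<in> PLlt d}"

lemma PLlt_PL: "p \<in> PLlt d \<Longrightarrow> p \<in> PL"
  by (simp add: PLlt_def)

lemma PLlt_zero: "0 \<in> PLlt d"
  by (simp add: PLlt_def free_algebra_closed)

lemma PLlt_0: "PLlt 0 = {0}"
  by (auto simp: PLlt_def free_algebra_closed)

lemma PLlt_add: "p \<in> PLlt d \<Longrightarrow> q \<in> PLlt d \<Longrightarrow> p + q \<in> PLlt d"
  using keys_add[of p q] unfolding PLlt_def by (auto simp: free_algebra_closed)

lemma PLlt_uminus: "p \<in> PLlt d \<Longrightarrow> - p \<in> PLlt d"
  by (simp add: PLlt_def free_algebra_closed in_keys_iff)

lemma PLlt_sum: "(\<And>i. i \<in> S \<Longrightarrow> f i \<in> PLlt d) \<Longrightarrow> sum f S \<in> PLlt d"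
  by (induction S rule: infinite_finite_induct) (auto intro: PLlt_zero PLlt_add)

lemma PLlt_mono: "p \<in> PLlt d \<Longrightarrow> d \<le> e \<Longrightarrow> p \<in> PLlt e"
  by (fastforce simp: PLlt_def)

lemma PLlt_single: "u \<in> lists L \<Longrightarrow> vdeg u < d \<Longrightarrow> Poly_Mapping.single u c \<in> PLlt d"
  by (simp add: PLlt_def single_PL)

text \<open>The bound \<open>Suc i\<close> stands for degree at most i; at most i and less than j
  add up to less than i + j.\<close>

lemma PLlt_mult:
  assumes "p \<in> PLlt (Suc i)" "q \<in> PLlt j"
  shows "p * q \<in> PLlt (i + j)" and "q * p \<in> PLlt (i + j)"
proof -
  have "vdeg w < i + j" if "w \<in> Poly_Mapping.keys (p * q)" for w
    using that keys_mult[of p q] assms by (fastforce simp: plus_list_def PLlt_def)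
  moreover have "vdeg w < i + j" if "w \<in> Poly_Mapping.keys (q * p)" for w
    using that keys_mult[of q p] assms by (fastforce simp: plus_list_def PLlt_def)
  ultimately show "p * q \<in> PLlt (i + j)" "q * p \<in> PLlt (i + j)"
    using assms by (simp_all add: PLlt_def free_algebra_closed)
qed

lemma PL_PLlt:
  assumes "p \<in> PL"
  shows "\<exists>d. p \<in> PLlt d"
proof -
  have "vdeg u < Suc (Max (vdeg ` Poly_Mapping.keys p))" if "u \<in> Poly_Mapping.keys p" for u
    using that by (simp add: less_Suc_eq_le)
  with assms show ?thesis
    unfolding PLlt_def by blast
qed

lemma gl_PLlt: "g \<in> carrier G \<Longrightarrow> gl g \<in> PLlt (Suc 0)"
  unfolding letter_def by (rule PLlt_single) (auto simp: H_generators_def)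

lemma vl_PLlt: "vl v \<in> PLlt (Suc 1)"
  unfolding letter_def by (rule PLlt_single) (auto simp: H_generators_def)

lemma free_group_part_PLlt: "free_group_part G a \<in> PLlt (Suc 0)"
  unfolding free_group_part_def by (intro PLlt_sum PLlt_single) (auto simp: H_generators_def)

lemma emb_hcomp_PLlt: "emb (hcomp d p) \<in> PLlt (Suc d)"
  by (induction p rule: poly_mapping_single_induct)
     (auto simp: hcomp_single hcomp_add free_map_add PLlt_zero H_generators_def filter_map o_def
       intro!: PLlt_add PLlt_single)

lemma map_Inl_L: "map Inl w \<in> lists L"
  by (auto simp: H_generators_def)

lemma emb_PL: "emb p \<in> PL"
  by (induction p rule: poly_mapping_single_induct)
     (simp_all add: free_map_add single_PL[OF map_Inl_L] free_algebra_closed)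

lemma J_PL: "p \<in> J \<Longrightarrow> p \<in> PL"
  by (rule H.I_carrier)

lemma JP_I: "x \<in> J \<Longrightarrow> y \<in> PLlt d \<Longrightarrow> x + y \<in> JP d"
  unfolding JP_def by blast

lemma JP_J: "p \<in> J \<Longrightarrow> p \<in> JP d"
  using JP_I[OF _ PLlt_zero, of p d] by simp

lemma JP_PLlt: "p \<in> PLlt d \<Longrightarrow> p \<in> JP d"
  using JP_I[OF H.I_0, of p d] by simp

lemma JP_zero: "0 \<in> JP d"
  by (rule JP_J) (rule H.I_0)

lemma JP_0: "JP 0 = J"
  by (auto simp: JP_def PLlt_0)

lemma JP_add:
  assumes "p \<in> JP d" "q \<in> JP d"
  shows "p + q \<in> JP d"
proof -
  obtain x y x' y' where "p = x + y" "q = x' + y'" "x \<in> J" "x' \<in> J" "y \<in> PLlt d" "y' \<in> PLlt d"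
    using assms by (auto simp: JP_def)
  moreover from this have "p + q = (x + x') + (y + y')"
    by simp
  ultimately show ?thesis
    by (simp only: JP_I H.I_add PLlt_add)
qed

lemma JP_uminus:
  assumes "p \<in> JP d"
  shows "- p \<in> JP d"
proof -
  obtain x y where "p = x + y" "x \<in> J" "y \<in> PLlt d"
    using assms by (auto simp: JP_def)
  moreover from this have "- p = (- x) + (- y)"
    by simp
  ultimately show ?thesis
    by (simp only: JP_I H.I_uminus PLlt_uminus)
qed

lemma JP_diff: "p \<in> JP d \<Longrightarrow> q \<in> JP d \<Longrightarrow> p - q \<in> JP d"
  using JP_add[of p d "- q"] JP_uminus by simp

lemma JP_sum: "(\<And>i. i \<in> S \<Longrightarrow> f i \<in> JP d) \<Longrightarrow> sum f S \<in> JP d"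
  by (induction S rule: infinite_finite_induct) (auto intro: JP_zero JP_add)

lemma JP_sym: "p - q \<in> JP d \<Longrightarrow> q - p \<in> JP d"
  using JP_uminus[of "p - q"] by simp

lemma JP_trans: "p - q \<in> JP d \<Longrightarrow> q - r \<in> JP d \<Longrightarrow> p - r \<in> JP d"
  using JP_add[of "p - q" d "q - r"] by simp

lemma JP_mult:
  assumes "p \<in> PLlt (Suc i)" "q \<in> JP j"
  shows "p * q \<in> JP (i + j)" and "q * p \<in> JP (i + j)"
proof -
  obtain x y where q: "q = x + y" "x \<in> J" "y \<in> PLlt j"
    using assms(2) by (auto simp: JP_def)
  have "p * x \<in> J" "x * p \<in> J"
    using q assms(1) by (simp_all add: H.I_mult PLlt_PL)
  moreover have "p * y \<in> PLlt (i + j)" "y * p \<in> PLlt (i + j)"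
    using q assms(1) by (simp_all add: PLlt_mult)
  ultimately show "p * q \<in> JP (i + j)" "q * p \<in> JP (i + j)"
    unfolding q distrib_left distrib_right by (simp_all add: JP_add JP_J JP_PLlt)
qed

lemma JP_gl_mult:
  assumes "g \<in> carrier G" "q \<in> JP j"
  shows "gl g * q \<in> JP j" and "q * gl g \<in> JP j"
  using JP_mult[OF gl_PLlt[OF assms(1)] assms(2)] by simp_all

text \<open>The linearity relations hold in H exactly. Letters from V commute only up to a value of
  \<open>kap\<close>, which has degree 0 and is therefore of lower order than the relation of degree
  2. The error is measured against the degree, so p is taken apart into its components.\<close>

lemma emb_sym_ideal:
  assumes "p \<in> I"
  shows "emb (hcomp d p) \<in> JP d"
  using assms
proof (induction p arbitrary: d rule: sym_ideal_induct)
  case (vadd v w)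
  then show ?case
    by (auto simp: hcomp_sym_relation JP_zero free_map_diff H_relation_mem intro!: JP_J)
next
  case (smult c v)
  have "emb (letter (scale c v) - Poly_Mapping.single 0 c * letter v) =
      vl (scale c v) - Poly_Mapping.single 0 c * vl v"
    by (simp add: free_map_diff free_map_mult zero_list_def)
  then show ?case
    by (auto simp: hcomp_sym_relation JP_zero H_relation_mem simp del: free.scale_minus_right intro!: JP_J)
next
  case (commute v w)
  have "(vl v * vl w - vl w * vl v - free_group_part G (kap v w)) + free_group_part G (kap v w) \<in> JP 2"
    by (intro JP_add JP_J H_relation_mem JP_PLlt PLlt_mono[OF free_group_part_PLlt]) simp
  then show ?case
    by (auto simp: hcomp_sym_relation JP_zero free_map_diff free_map_mult)
next
  case (left w c p)
  have "emb (Poly_Mapping.single w c) * emb (hcomp (d - length w) p) \<in> JP (length w + (d - length w))"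
    using emb_hcomp_PLlt[of "length w" "Poly_Mapping.single w c"] left
    by (intro JP_mult) (simp_all add: hcomp_single)
  then show ?case
    by (auto simp: hcomp_single_mult JP_zero free_map_mult)
next
  case (right w c p)
  have "emb (hcomp (d - length w) p) * emb (Poly_Mapping.single w c) \<in> JP (length w + (d - length w))"
    using emb_hcomp_PLlt[of "length w" "Poly_Mapping.single w c"] right
    by (intro JP_mult) (simp_all add: hcomp_single)
  then show ?case
    by (auto simp: hcomp_mult_single JP_zero free_map_mult)
qed (auto simp: hcomp_add free_map_add JP_zero intro: JP_add)

lemma vl_0: "vl 0 \<in> J"
  using H_relation_mem(2)[of 0 0] by simp

text \<open>In degree 1 only the linearity relations are involved, so the congruence holds modulo J
  itself and not just up to lower order.\<close>

lemma emb_hcomp_1: "emb (hcomp 1 p) - vl (letter_sum p) \<in> J"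
proof (induction p rule: poly_mapping_single_induct)
  case (single w c)
  show ?case
  proof (cases "length w = 1")
    case True
    then obtain v where w: "w = [v]"
      by (auto simp: length_Suc_conv)
    have "- (vl (scale c v) - Poly_Mapping.single 0 c * vl v) \<in> J"
      by (intro H.I_uminus H_relation_mem)
    also have "Poly_Mapping.single 0 c * vl v = Poly_Mapping.single [Inl v] c"
      by (simp add: letter_def mult_single)
    finally show ?thesis
      by (simp add: w hcomp_single letter_sum_single)
  qed (use vl_0 H.I_uminus in \<open>auto simp: hcomp_single letter_sum_single\<close>)
next
  case zero
  then show ?case
    using vl_0 H.I_uminus by (auto simp: letter_sum_0)
next
  case (add p q)
  have "emb (hcomp 1 (p + q)) - vl (letter_sum (p + q)) =
      (emb (hcomp 1 p) - vl (letter_sum p)) + (emb (hcomp 1 q) - vl (letter_sum q)) -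
      (vl (letter_sum p + letter_sum q) - vl (letter_sum p) - vl (letter_sum q))"
    by (simp add: hcomp_add free_map_add letter_sum_add)
  also have "\<dots> \<in> J"
    by (intro H.I_diff H.I_add add H_relation_mem)
  finally show ?case .
qed

text \<open>The normal form of a letter need not be that letter, but it stays in degree 1 and by
  \<open>sym_ideal_low\<close> still evaluates to v.\<close>

lemma emb_nf_letter: "emb (nf (letter v)) - vl v \<in> J"
proof -
  have 1: "hcomp 1 (letter v) = letter v"
    by (simp add: letter_def hcomp_single)
  have "letter_sum (nf (letter v) - letter v) = 0"
    using sym_ideal_low nf_diff_mem by blast
  then have "letter_sum (nf (letter v)) = v"
    by (simp add: letter_sum_diff letter_sum_letter)
  moreover have "hcomp 1 (nf (letter v)) = nf (letter v)"
    by (metis 1 nf_hcomp)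
  ultimately show ?thesis
    using emb_hcomp_1[of "nf (letter v)"] by simp
qed

lemma free_map_sym_ideal:
  assumes g: "g \<in> carrier G" and "p \<in> I"
  shows "free_map (\<rho> g) p \<in> I"
  using assms(2)
proof (induction p rule: sym_ideal_induct)
  case (smult c v)
  have "free_map (\<rho> g) (letter (scale c v) - Poly_Mapping.single 0 c * letter v) =
      letter (scale c (\<rho> g v)) - Poly_Mapping.single 0 c * letter (\<rho> g v)"
    using g by (simp add: free_map_diff free_map_mult zero_list_def \<rho>_scale)
  then show ?case
    using sym_relation_mem(2)[of c "\<rho> g v"] by (simp only:)
qed (use g in \<open>auto simp: free_map_diff free_map_mult free_map_add \<rho>_add sym_relation_mem S.I_0
    S.I_mult intro: S.I_add\<close>)

text \<open>When g crosses a letter v, the extra term is a value of \<open>lam\<close>, which puts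
  an element of degree 0 in place of v. The error thus has fewer letters from V than w.\<close>

lemma gl_emb_single:
  assumes g: "g \<in> carrier G"
  shows "gl g * emb (Poly_Mapping.single w c) - emb (free_map (\<rho> g) (Poly_Mapping.single w c)) * gl g
    \<in> JP (length w)"
proof (induction w)
  case Nil
  then show ?case
    by (simp add: letter_def single_mult mult_single plus_list_def mult.commute JP_zero)
next
  case (Cons v w)
  let ?s = "emb (Poly_Mapping.single w c)"
  let ?t = "emb (free_map (\<rho> g) (Poly_Mapping.single w c))"
  let ?l = "free_group_part G (lam (group_elt G g) v)"
  have s: "?s \<in> PLlt (Suc (length w))"
    using emb_hcomp_PLlt[of "length w" "Poly_Mapping.single w c"] by (simp add: hcomp_single)
  have "(gl g * vl v - vl (\<rho> g v) * gl g - ?l) * ?s \<in> JP (Suc (length w))"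
    using g by (intro JP_J H.I_mult H_relation_mem emb_PL)
  moreover have "?l * ?s \<in> JP (Suc (length w))"
    using PLlt_mult(1)[OF free_group_part_PLlt s] by (intro JP_PLlt) simp
  moreover have "vl (\<rho> g v) * (gl g * ?s - ?t * gl g) \<in> JP (Suc (length w))"
    using JP_mult(1)[OF vl_PLlt Cons] by simp
  ultimately have "(gl g * vl v - vl (\<rho> g v) * gl g - ?l) * ?s + ?l * ?s +
      vl (\<rho> g v) * (gl g * ?s - ?t * gl g) \<in> JP (Suc (length w))"
    by (intro JP_add)
  also have "(gl g * vl v - vl (\<rho> g v) * gl g - ?l) * ?s + ?l * ?s +
      vl (\<rho> g v) * (gl g * ?s - ?t * gl g) = gl g * (vl v * ?s) - (vl (\<rho> g v) * ?t) * gl g"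
    by (simp add: left_diff_distrib right_diff_distrib mult.assoc)
  finally show ?case
    by (simp add: letter_mult_single)
qed

lemma gl_emb:
  assumes g: "g \<in> carrier G"
  shows "gl g * emb (hcomp d p) - emb (free_map (\<rho> g) (hcomp d p)) * gl g \<in> JP d"
proof (induction p rule: poly_mapping_single_induct)
  case (single w c)
  then show ?case
    using gl_emb_single[OF g, of w c] by (auto simp: hcomp_single JP_zero)
next
  case (add p q)
  have "gl g * emb (hcomp d (p + q)) - emb (free_map (\<rho> g) (hcomp d (p + q))) * gl g =
      (gl g * emb (hcomp d p) - emb (free_map (\<rho> g) (hcomp d p)) * gl g) +
      (gl g * emb (hcomp d q) - emb (free_map (\<rho> g) (hcomp d q)) * gl g)"
    by (simp add: hcomp_add free_map_add distrib_left distrib_right)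
  with add show ?case
    by (simp only: JP_add)
qed (simp add: JP_zero)

text \<open>The word is built from its right end. A new vector is prepended to w; a new group
  element crosses w up to lower order, acting on its letters, and merges with the group element at
  the end.\<close>

lemma word_straighten:
  "u \<in> lists L \<Longrightarrow> \<exists>w g. g \<in> carrier G \<and> length w = vdeg u \<and>
    Poly_Mapping.single u 1 - emb (Poly_Mapping.single w 1) * gl g \<in> JP (vdeg u)"
proof (induction u)
  case Nil
  have "- (gl \<one> - 1) \<in> J"
    by (intro H.I_uminus H_relation_mem)
  then have "Poly_Mapping.single [] 1 - emb (Poly_Mapping.single [] 1) * gl \<one> \<in> JP 0"
    by (simp add: one_eq_single[symmetric] JP_0)
  then show ?case
    by (intro exI[of _ "[]"] exI[of _ \<one>]) simp
next
  case (Cons x u)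
  then obtain w h where h: "h \<in> carrier G" and w: "length w = vdeg u"
    and IH: "Poly_Mapping.single u 1 - emb (Poly_Mapping.single w 1) * gl h \<in> JP (vdeg u)"
    by auto
  let ?e = "emb (Poly_Mapping.single w 1)"
  show ?case
  proof (cases x)
    case (Inl v)
    have "vl v * (Poly_Mapping.single u 1 - ?e * gl h) \<in> JP (Suc (vdeg u))"
      using JP_mult(1)[OF vl_PLlt IH] by simp
    also have "vl v * (Poly_Mapping.single u 1 - ?e * gl h) =
        Poly_Mapping.single (x # u) 1 - emb (Poly_Mapping.single (v # w) 1) * gl h"
      unfolding right_diff_distrib mult.assoc[symmetric] by (simp add: Inl letter_mult_single)
    finally show ?thesis
      using h w Inl by (intro exI[of _ "v # w"] exI[of _ h]) simp
  next
    case (Inr g)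
    then have g: "g \<in> carrier G"
      using Cons.prems by (auto simp: H_generators_def)
    let ?t = "emb (free_map (\<rho> g) (Poly_Mapping.single w 1))"
    have t: "?t \<in> PLlt (Suc (vdeg u))"
      using emb_hcomp_PLlt[of "vdeg u" "Poly_Mapping.single (map (\<rho> g) w) 1"] w
      by (simp add: hcomp_single)
    have 1: "gl g * Poly_Mapping.single u 1 - gl g * (?e * gl h) \<in> JP (vdeg u)"
      using JP_gl_mult(1)[OF g IH] by (simp add: right_diff_distrib)
    have 2: "gl g * (?e * gl h) - ?t * gl g * gl h \<in> JP (vdeg u)"
      using JP_gl_mult(2)[OF h gl_emb_single[OF g, of w 1]]
      by (simp add: left_diff_distrib mult.assoc w)
    have "?t * (gl g * gl h - gl (g \<otimes> h)) \<in> J"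
      using g h by (intro H.I_mult H_relation_mem emb_PL)
    then have 3: "?t * gl g * gl h - ?t * gl (g \<otimes> h) \<in> JP (vdeg u)"
      by (intro JP_J) (simp add: right_diff_distrib mult.assoc)
    have "Poly_Mapping.single (x # u) 1 - emb (Poly_Mapping.single (map (\<rho> g) w) 1) * gl (g \<otimes> h) \<in> JP (vdeg u)"
      using JP_trans[OF 1 JP_trans[OF 2 3]] by (simp add: Inr letter_mult_single)
    then show ?thesis
      using g h w Inr by (intro exI[of _ "map (\<rho> g) w"] exI[of _ "g \<otimes> h"]) simp
  qed
qed

end

section \<open>The linear section into words and its span\<close>

context skew_setup
begin

text \<open>The section on families of representatives. As \<open>nf\<close> depends only on residue
  classes, it descends to A.\<close>

definition \<theta>\<^sub>0 :: "('g \<Rightarrow> 'v list \<Rightarrow>\<^sub>0 'k) \<Rightarrow> ('v + 'g) list \<Rightarrow>\<^sub>0 'k" where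
  "\<theta>\<^sub>0 r = (\<Sum>g\<in>carrier G. emb (nf (r g)) * gl g)"

abbreviation hcomps :: "nat \<Rightarrow> ('g \<Rightarrow> 'v list \<Rightarrow>\<^sub>0 'k) \<Rightarrow> 'g \<Rightarrow> 'v list \<Rightarrow>\<^sub>0 'k" where
  "hcomps d r \<equiv> (\<lambda>g. hcomp d (r g))"

definition low :: "nat \<Rightarrow> ('g \<Rightarrow> 'v list \<Rightarrow>\<^sub>0 'k) \<Rightarrow> bool" where
  "low d r \<longleftrightarrow> (\<forall>g\<in>carrier G. \<forall>m\<ge>d. hcomp m (r g) = 0)"

lemma \<theta>0_cong: "(\<And>g. g \<in> carrier G \<Longrightarrow> nf (r g) = nf (s g)) \<Longrightarrow> \<theta>\<^sub>0 r = \<theta>\<^sub>0 s"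
  by (simp add: \<theta>\<^sub>0_def)

lemma \<theta>0_add: "\<theta>\<^sub>0 (\<lambda>g. r g + s g) = \<theta>\<^sub>0 r + \<theta>\<^sub>0 s"
  by (simp add: \<theta>\<^sub>0_def nf_add free_map_add distrib_right sum.distrib)

lemma \<theta>0_diff: "\<theta>\<^sub>0 (\<lambda>g. r g - s g) = \<theta>\<^sub>0 r - \<theta>\<^sub>0 s"
  by (simp add: \<theta>\<^sub>0_def nf_diff free_map_diff left_diff_distrib sum_subtractf)

lemma \<theta>0_scalar: "\<theta>\<^sub>0 (\<lambda>g. Poly_Mapping.single 0 c * r g) = Poly_Mapping.single 0 c * \<theta>\<^sub>0 r"
proof -
  have "emb (Poly_Mapping.single 0 c * p) = Poly_Mapping.single 0 c * emb p" for p
    by (simp add: free_map_mult zero_list_def)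
  then show ?thesis
    by (simp add: \<theta>\<^sub>0_def nf_scalar mult.assoc sum_distrib_left)
qed

lemma \<theta>0_0: "\<theta>\<^sub>0 (\<lambda>g. 0) = 0"
  by (simp add: \<theta>\<^sub>0_def)

lemma \<theta>0_sum: "\<theta>\<^sub>0 (\<lambda>g. \<Sum>i\<in>S. r i g) = (\<Sum>i\<in>S. \<theta>\<^sub>0 (r i))"
  by (induction S rule: infinite_finite_induct) (auto simp: \<theta>0_0 \<theta>0_add)

lemma lookup_emb_gl:
  "Poly_Mapping.lookup (emb p * gl g) (map Inl w @ [Inr h]) = (if g = h then Poly_Mapping.lookup p w else 0)"
proof (induction p rule: poly_mapping_single_induct)
  case (single u c)
  have "inj (Inl :: 'v \<Rightarrow> 'v + 'g)"
    by simp
  then have "map (Inl :: 'v \<Rightarrow> 'v + 'g) u = map Inl w \<longleftrightarrow> u = w"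
    by (rule inj_map_eq_map)
  then show ?case
    by (auto simp: letter_def single_mult lookup_single when_def)
qed (simp_all add: free_map_add distrib_right lookup_add)

text \<open>The words \<open>map Inl w @ [Inr h]\<close> are distinct for distinct w and h, so the
  normal forms can be read off as coefficients. This is injectivity in the free algebra, before
  reduction modulo J.\<close>

lemma \<theta>0_inj:
  assumes "\<theta>\<^sub>0 r = \<theta>\<^sub>0 s" and h: "h \<in> carrier G"
  shows "nf (r h) = nf (s h)"
proof -
  have *: "Poly_Mapping.lookup (\<theta>\<^sub>0 r) (map Inl w @ [Inr h]) = Poly_Mapping.lookup (nf (r h)) w" for r w
    using h finite_G by (simp add: \<theta>\<^sub>0_def lookup_sum lookup_emb_gl)
  show ?thesis
    by (rule poly_mapping_eqI) (simp add: *[symmetric] assms(1))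
qed

lemma \<theta>0_hcomps_cong:
  assumes "\<theta>\<^sub>0 r = \<theta>\<^sub>0 s"
  shows "\<theta>\<^sub>0 (hcomps d r) = \<theta>\<^sub>0 (hcomps d s)"
  by (rule \<theta>0_cong) (simp add: nf_hcomp \<theta>0_inj[OF assms])

lemma \<theta>0_PL: "\<theta>\<^sub>0 r \<in> PL"
  unfolding \<theta>\<^sub>0_def by (intro PL_sum free_algebra_closed emb_PL gl_PL)

lemma gl_mult_PLlt: "g \<in> carrier G \<Longrightarrow> p \<in> PLlt d \<Longrightarrow> p * gl g \<in> PLlt d"
  using PLlt_mult(2)[OF gl_PLlt, of g p d] by simp

lemma \<theta>0_hcomps_PLlt: "\<theta>\<^sub>0 (hcomps d r) \<in> PLlt (Suc d)"
  unfolding \<theta>\<^sub>0_def by (intro PLlt_sum gl_mult_PLlt) (simp_all add: nf_hcomp emb_hcomp_PLlt)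

lemma hcomp_sum_eq:
  assumes "\<And>m. d \<le> m \<Longrightarrow> hcomp m p = 0"
  shows "p = (\<Sum>m<d. hcomp m p)"
proof (rule poly_mapping_eqI)
  fix w
  have "Poly_Mapping.lookup (hcomp (length w) p) w = 0" if "d \<le> length w"
    using assms[OF that] by simp
  then show "Poly_Mapping.lookup p w = Poly_Mapping.lookup (\<Sum>m<d. hcomp m p) w"
    by (auto simp: lookup_sum)
qed

lemma \<theta>0_low_sum:
  assumes "low d r"
  shows "\<theta>\<^sub>0 r = (\<Sum>m<d. \<theta>\<^sub>0 (hcomps m r))"
proof -
  have "\<theta>\<^sub>0 r = \<theta>\<^sub>0 (\<lambda>g. \<Sum>m<d. hcomp m (r g))"
  proof (rule \<theta>0_cong)
    fix g
    assume "g \<in> carrier G"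
    with assms show "nf (r g) = nf (\<Sum>m<d. hcomp m (r g))"
      by (subst hcomp_sum_eq[of d "r g"]) (auto simp: low_def)
  qed
  then show ?thesis
    by (simp only: \<theta>0_sum)
qed

lemma \<theta>0_low_PLlt: "low d r \<Longrightarrow> \<theta>\<^sub>0 r \<in> PLlt d"
  by (simp add: \<theta>0_low_sum) (auto intro!: PLlt_sum PLlt_mono[OF \<theta>0_hcomps_PLlt])

lemma ex_low: "\<exists>d. low d r"
proof -
  let ?S = "\<Union>g\<in>carrier G. length ` Poly_Mapping.keys (r g)"
  have "finite ?S"
    using finite_G by simp
  then obtain d where "?S \<subseteq> {..<d}"
    by (meson finite_nat_iff_bounded)
  then have "hcomp m (r g) = 0" if "g \<in> carrier G" "d \<le> m" for g m
    using that by (intro poly_mapping_eqI) (fastforce simp: in_keys_iff)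
  then show ?thesis
    unfolding low_def by blast
qed

text \<open>The section without \<open>nf\<close>: up to lower order it is the same, and it can be
  multiplied without normalizing the factors.\<close>

definition symb :: "('g \<Rightarrow> 'v list \<Rightarrow>\<^sub>0 'k) \<Rightarrow> ('v + 'g) list \<Rightarrow>\<^sub>0 'k" where
  "symb r = (\<Sum>g\<in>carrier G. emb (r g) * gl g)"

lemma symb_PLlt: "symb (hcomps d r) \<in> PLlt (Suc d)"
  unfolding symb_def by (intro PLlt_sum gl_mult_PLlt emb_hcomp_PLlt)

lemma \<theta>0_symb: "\<theta>\<^sub>0 (hcomps d r) - symb (hcomps d r) \<in> JP d"
proof -
  have "\<theta>\<^sub>0 (hcomps d r) - symb (hcomps d r) =
      (\<Sum>g\<in>carrier G. emb (hcomp d (nf (r g) - r g)) * gl g)"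
    by (simp add: \<theta>\<^sub>0_def symb_def sum_subtractf[symmetric] hcomp_diff nf_hcomp free_map_diff
        left_diff_distrib)
  also have "\<dots> \<in> JP d"
    by (intro JP_sum JP_gl_mult emb_sym_ideal nf_diff_mem)
  finally show ?thesis .
qed

text \<open>A word with exactly d letters from V is straightened to a single term; a word with fewer
  is absorbed by \<open>JP d\<close>.\<close>

lemma span_step:
  assumes "p \<in> PLlt (Suc d)"
  shows "\<exists>r. p - \<theta>\<^sub>0 (hcomps d r) \<in> JP d"
proof -
  have "Poly_Mapping.keys p \<subseteq> {u \<in> lists L. vdeg u < Suc d}"
    using assms by (auto simp: PLlt_def free_algebra_simps)
  then show ?thesis
  proof (induction rule: poly_mapping_words_induct)
    case (single u c)
    show ?case
    proof (cases "vdeg u < d")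
      case True
      then have "Poly_Mapping.single u c - \<theta>\<^sub>0 (hcomps d (\<lambda>g. 0)) \<in> JP d"
        using single by (simp add: \<theta>0_0 JP_PLlt PLlt_single)
      then show ?thesis
        by (rule exI[of _ "\<lambda>g. 0"])
    next
      case False
      then have d: "vdeg u = d"
        using single by simp
      obtain w g where g: "g \<in> carrier G" and w: "length w = d"
        and wg: "Poly_Mapping.single u 1 - emb (Poly_Mapping.single w 1) * gl g \<in> JP d"
        using word_straighten[of u] single d by auto
      define r where "r = (\<lambda>h. if h = g then Poly_Mapping.single w c else 0)"
      have r: "hcomps d r = r"
        by (auto simp: r_def hcomp_single w)
      have "symb r = (\<Sum>h\<in>carrier G. if h = g then emb (Poly_Mapping.single w c) * gl g else 0)"
        unfolding symb_def by (rule sum.cong) (auto simp: r_def)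
      then have symb: "symb r = emb (Poly_Mapping.single w c) * gl g"
        using g finite_G by simp
      \<comment> \<open>A scalar is a multiple of the empty word, of degree at most 0, so
        multiplying by it keeps the error in \<open>JP d\<close>.\<close>
      have "Poly_Mapping.single [] c \<in> PLlt (Suc 0)"
        by (rule PLlt_single) auto
      from JP_mult(1)[OF this wg]
      have "Poly_Mapping.single u c - symb r \<in> JP d"
        unfolding symb by (simp add: right_diff_distrib mult.assoc[symmetric] single_mult)
      from JP_trans[OF this JP_sym[OF \<theta>0_symb[of d r, unfolded r]]]
      have "Poly_Mapping.single u c - \<theta>\<^sub>0 (hcomps d r) \<in> JP d"
        unfolding r .
      then show ?thesis
        by blast
    qed
  next
    case zero
    have "0 - \<theta>\<^sub>0 (hcomps d (\<lambda>g. 0)) \<in> JP d"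
      by (simp add: \<theta>0_0 JP_zero)
    then show ?case
      by (rule exI[of _ "\<lambda>g. 0"])
  next
    case (add p q)
    then obtain r s where "p - \<theta>\<^sub>0 (hcomps d r) \<in> JP d" "q - \<theta>\<^sub>0 (hcomps d s) \<in> JP d"
      by blast
    then have "(p - \<theta>\<^sub>0 (hcomps d r)) + (q - \<theta>\<^sub>0 (hcomps d s)) \<in> JP d"
      by (rule JP_add)
    then have "p + q - \<theta>\<^sub>0 (hcomps d (\<lambda>g. r g + s g)) \<in> JP d"
      by (simp add: hcomp_add \<theta>0_add add_diff_add)
    then show ?case
      by (rule exI[of _ "\<lambda>g. r g + s g"])
  qed
qed

text \<open>Subtracting the leading part leaves a member of J and a remainder of smaller degree.
  This is the existence of normal forms in H; their uniqueness is the content of the PBW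
  property.\<close>

lemma span_all: "p \<in> PLlt d \<Longrightarrow> \<exists>r. low d r \<and> p - \<theta>\<^sub>0 r \<in> J"
proof (induction d arbitrary: p)
  case 0
  then have "low 0 (\<lambda>g. 0) \<and> p - \<theta>\<^sub>0 (\<lambda>g. 0) \<in> J"
    by (simp add: PLlt_0 low_def \<theta>0_0 H.I_0)
  then show ?case
    by blast
next
  case (Suc d)
  obtain r where "p - \<theta>\<^sub>0 (hcomps d r) \<in> JP d"
    using span_step[OF Suc.prems] by blast
  then obtain x y where xy: "p - \<theta>\<^sub>0 (hcomps d r) = x + y" "x \<in> J" "y \<in> PLlt d"
    by (auto simp: JP_def)
  obtain s where s: "low d s" "y - \<theta>\<^sub>0 s \<in> J"
    using Suc.IH[OF xy(3)] by blast
  have "p - \<theta>\<^sub>0 (\<lambda>g. hcomp d (r g) + s g) = x + (y - \<theta>\<^sub>0 s)"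
    using xy(1) by (simp add: \<theta>0_add algebra_simps)
  then have "p - \<theta>\<^sub>0 (\<lambda>g. hcomp d (r g) + s g) \<in> J"
    using xy(2) s(2) by (simp only: H.I_add)
  moreover have "low (Suc d) (\<lambda>g. hcomp d (r g) + s g)"
    using s(1) by (simp add: low_def hcomp_add hcomp_hcomp)
  ultimately show ?case
    by blast
qed

subsection \<open>The skew group algebra\<close>

abbreviation A :: "('k, 'g \<Rightarrow> ('v list \<Rightarrow>\<^sub>0 'k) set) module" where
  "A \<equiv> skew_group_algebra G scale \<rho>"

definition mk :: "('g \<Rightarrow> 'v list \<Rightarrow>\<^sub>0 'k) \<Rightarrow> 'g \<Rightarrow> ('v list \<Rightarrow>\<^sub>0 'k) set" where
  "mk r = (\<lambda>x\<in>carrier G. S.cls (r x))"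

lemma sym_algebra_eq: "sym_algebra scale = quotient_algebra (free_algebra UNIV) I"
  by (simp add: sym_algebra_def)

lemma mk_eq: "mk r = mk s \<longleftrightarrow> (\<forall>x\<in>carrier G. r x - s x \<in> I)"
  by (auto simp: mk_def fun_eq_iff S.cls_eq)

lemma A_carrier: "carrier A = range mk"
proof
  show "carrier A \<subseteq> range mk"
  proof
    fix a
    assume "a \<in> carrier A"
    then have a: "a \<in> carrier G \<rightarrow>\<^sub>E range S.cls"
      by (auto simp: skew_group_algebra_def Let_def sym_algebra_eq S.quotient_simps(1) free_algebra_simps)
    then have "\<forall>x\<in>carrier G. \<exists>p. a x = S.cls p"
      by (fastforce simp: PiE_iff)
    then obtain r where "\<forall>x\<in>carrier G. a x = S.cls (r x)"
      by metis
    with a have "a = mk r"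
      by (auto simp: mk_def fun_eq_iff PiE_iff extensional_def)
    then show "a \<in> range mk"
      by blast
  qed
qed (auto simp: skew_group_algebra_def Let_def sym_algebra_eq S.quotient_simps(1) free_algebra_simps mk_def)

lemma mk_A: "mk r \<in> carrier A"
  by (simp add: A_carrier)

lemma A_add: "mk r \<oplus>\<^bsub>A\<^esub> mk s = mk (\<lambda>g. r g + s g)"
  unfolding skew_group_algebra_def Let_def mk_def sym_algebra_eq
  by (auto simp: S.quotient_add intro!: restrict_ext)

lemma A_zero: "\<zero>\<^bsub>A\<^esub> = mk (\<lambda>g. 0)"
  unfolding skew_group_algebra_def Let_def mk_def sym_algebra_eq S.quotient_zero by simp

lemma A_one: "\<one>\<^bsub>A\<^esub> = mk (\<lambda>g. if g = \<one> then 1 else 0)"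
  unfolding skew_group_algebra_def Let_def mk_def sym_algebra_eq S.quotient_zero S.quotient_one
  by (auto intro!: restrict_ext)

lemma A_smult: "c \<odot>\<^bsub>A\<^esub> mk r = mk (\<lambda>g. Poly_Mapping.single 0 c * r g)"
  unfolding skew_group_algebra_def Let_def mk_def sym_algebra_eq
  by (auto simp: S.quotient_smult intro!: restrict_ext)

text \<open>The inverse of g preserves the ideal too, so the image of a residue class is a whole
  residue class and not just a part of one.\<close>

lemma free_map_cls:
  assumes g: "g \<in> carrier G"
  shows "free_map (\<rho> g) ` S.cls p = S.cls (free_map (\<rho> g) p)"
proof
  show "free_map (\<rho> g) ` S.cls p \<subseteq> S.cls (free_map (\<rho> g) p)"
    using free_map_sym_ideal[OF g] by (auto simp: S.mem_cls free_map_diff[symmetric])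
  show "S.cls (free_map (\<rho> g) p) \<subseteq> free_map (\<rho> g) ` S.cls p"
  proof
    fix q
    assume q: "q \<in> S.cls (free_map (\<rho> g) p)"
    have inv: "free_map (\<rho> g) (free_map (\<rho> (inv g)) q) = q"
      "free_map (\<rho> (inv g)) (free_map (\<rho> g) p) = p"
      using g \<rho>_inv[of g] \<rho>_inv[of "inv g"] by (simp_all add: free_map_compose)
    have "free_map (\<rho> (inv g)) (q - free_map (\<rho> g) p) \<in> I"
      using q g by (intro free_map_sym_ideal) (simp_all add: S.mem_cls)
    then have "free_map (\<rho> (inv g)) q \<in> S.cls p"
      by (simp add: S.mem_cls free_map_diff inv)
    then show "q \<in> free_map (\<rho> g) ` S.cls p"
      using inv(1) by (metis imageI)
  qed
qed

definition conv :: "('g \<Rightarrow> 'v list \<Rightarrow>\<^sub>0 'k) \<Rightarrow> ('g \<Rightarrow> 'v list \<Rightarrow>\<^sub>0 'k) \<Rightarrow> 'g \<Rightarrow> 'v list \<Rightarrow>\<^sub>0 'k" where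
  "conv r s x = (\<Sum>g\<in>carrier G. r g * free_map (\<rho> g) (s (inv g \<otimes> x)))"

lemma A_mult: "mk r \<otimes>\<^bsub>A\<^esub> mk s = mk (conv r s)"
proof -
  interpret S': abelian_group "sym_algebra scale"
    unfolding sym_algebra_eq by (rule S.quotient_abelian_group)
  have mult: "mk r g \<otimes>\<^bsub>sym_algebra scale\<^esub> (free_map (\<rho> g) ` mk s (inv g \<otimes> x)) =
      S.cls (r g * free_map (\<rho> g) (s (inv g \<otimes> x)))" if "g \<in> carrier G" "x \<in> carrier G" for g x
    using that by (simp add: mk_def free_map_cls sym_algebra_eq S.quotient_mult)
  have "(\<Oplus>\<^bsub>sym_algebra scale\<^esub>g\<in>carrier G. mk r g \<otimes>\<^bsub>sym_algebra scale\<^esub> (free_map (\<rho> g) ` mk s (inv g \<otimes> x))) =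
      S.cls (conv r s x)" if x: "x \<in> carrier G" for x
  proof -
    have "(\<Oplus>\<^bsub>sym_algebra scale\<^esub>g\<in>carrier G. mk r g \<otimes>\<^bsub>sym_algebra scale\<^esub> (free_map (\<rho> g) ` mk s (inv g \<otimes> x))) =
        (\<Oplus>\<^bsub>sym_algebra scale\<^esub>g\<in>carrier G. S.cls (r g * free_map (\<rho> g) (s (inv g \<otimes> x))))"
      by (rule S'.finsum_cong')
         (use x in \<open>auto simp: mult, simp add: sym_algebra_eq S.quotient_simps(1)\<close>)
    then show ?thesis
      by (simp add: sym_algebra_eq S.quotient_finsum conv_def)
  qed
  then show ?thesis
    unfolding skew_group_algebra_def Let_def
    by (auto simp: mk_def[of "conv r s"] intro!: restrict_ext)
qed

lemma abelian_group_A: "abelian_group A"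
proof (rule abelian_groupI)
  fix x
  assume "x \<in> carrier A"
  then obtain r where "x = mk r"
    by (auto simp: A_carrier)
  then show "\<exists>y\<in>carrier A. y \<oplus>\<^bsub>A\<^esub> x = \<zero>\<^bsub>A\<^esub>"
    by (intro bexI[of _ "mk (\<lambda>g. - r g)"]) (simp_all add: A_add A_zero mk_A)
qed (auto simp: A_carrier A_add A_zero add_ac)

lemma skew_component_eq: "skew_component G scale d = range (\<lambda>r. mk (hcomps d r))"
proof
  show "skew_component G scale d \<subseteq> range (\<lambda>r. mk (hcomps d r))"
  proof
    fix a
    assume a: "a \<in> skew_component G scale d"
    then have "\<forall>x\<in>carrier G. \<exists>p. a x = S.cls p \<and> hcomp d p = p"
      by (fastforce simp: skew_component_def PiE_iff sym_component_def S_cls intro: hcomp_eq_self)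
    then obtain r where "\<forall>x\<in>carrier G. a x = S.cls (r x) \<and> hcomp d (r x) = r x"
      by metis
    with a have "a = mk (hcomps d r)"
      by (auto simp: skew_component_def mk_def fun_eq_iff PiE_iff extensional_def)
    then show "a \<in> range (\<lambda>r. mk (hcomps d r))"
      by blast
  qed
  show "range (\<lambda>r. mk (hcomps d r)) \<subseteq> skew_component G scale d"
    by (auto simp: skew_component_def mk_def sym_component_def S_cls keys_hcomp)
qed

text \<open>By \<open>\<theta>_mk\<close> the choice of representatives does not affect the
  value.\<close>

definition \<theta> :: "('g \<Rightarrow> ('v list \<Rightarrow>\<^sub>0 'k) set) \<Rightarrow> ('v + 'g) list \<Rightarrow>\<^sub>0 'k" where
  "\<theta> a = \<theta>\<^sub>0 (\<lambda>g. SOME p. p \<in> a g)"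

lemma \<theta>_mk: "\<theta> (mk r) = \<theta>\<^sub>0 r"
  unfolding \<theta>_def
proof (rule \<theta>0_cong)
  fix g
  assume g: "g \<in> carrier G"
  have "(SOME p. p \<in> S.cls (r g)) \<in> S.cls (r g)"
    by (rule someI) (rule S.cls_self)
  with g show "nf (SOME p. p \<in> mk r g) = nf (r g)"
    by (simp add: mk_def nf_eq_iff S.mem_cls)
qed

lemma hcomp_conv: "hcomp m (conv r s x) = (\<Sum>d\<le>m. conv (hcomps d r) (hcomps (m - d) s) x)"
proof -
  have "hcomp m (conv r s x) =
      (\<Sum>g\<in>carrier G. \<Sum>d\<le>m. hcomp d (r g) * free_map (\<rho> g) (hcomp (m - d) (s (inv g \<otimes> x))))"
    by (simp add: conv_def hcomp_sum hcomp_mult hcomp_free_map)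
  also have "\<dots> = (\<Sum>d\<le>m. conv (hcomps d r) (hcomps (m - d) s) x)"
    unfolding conv_def by (rule sum.swap)
  finally show ?thesis .
qed

lemma hcomp_mult_homogeneous: "hcomp m (hcomp d p * hcomp e q) = (if m = d + e then hcomp d p * hcomp e q else 0)"
proof -
  have "hcomp m (hcomp d p * hcomp e q) =
      (\<Sum>i\<le>m. if i = d then (if m = d + e then hcomp d p * hcomp e q else 0) else 0)"
    unfolding hcomp_mult by (rule sum.cong) (auto simp: hcomp_hcomp)
  also have "\<dots> = (if m = d + e then hcomp d p * hcomp e q else 0)"
    by auto
  finally show ?thesis .
qed

lemma hcomp_conv_homogeneous:
  "hcomp (d + e) (conv (hcomps d r) (hcomps e s) x) = conv (hcomps d r) (hcomps e s) x"
  by (simp add: conv_def hcomp_sum hcomp_free_map[symmetric] hcomp_mult_homogeneous)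

text \<open>In a product of terms (r g)(s h) the element g crosses s at the cost of lower order
  terms, which gives the twisted factor, and then g and h merge modulo J. This is the product of the
  skew group algebra.\<close>

lemma symb_conv:
  "symb (hcomps d r) * symb (hcomps e s) - symb (conv (hcomps d r) (hcomps e s)) \<in> JP (d + e)"
proof -
  let ?r = "\<lambda>g. emb (hcomp d (r g))" and ?s = "\<lambda>h. emb (hcomp e (s h))"
  let ?t = "\<lambda>g h. emb (free_map (\<rho> g) (hcomp e (s h)))"
  have "symb (conv (hcomps d r) (hcomps e s)) =
      (\<Sum>x\<in>carrier G. \<Sum>g\<in>carrier G. ?r g * ?t g (inv g \<otimes> x) * gl x)"
    by (simp add: symb_def conv_def free_map_sum free_map_mult sum_distrib_right)
  also have "\<dots> = (\<Sum>g\<in>carrier G. \<Sum>x\<in>carrier G. ?r g * ?t g (inv g \<otimes> x) * gl x)"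
    by (rule sum.swap)
  also have "\<dots> = (\<Sum>g\<in>carrier G. \<Sum>h\<in>carrier G. ?r g * ?t g h * gl (g \<otimes> h))"
  proof (rule sum.cong)
    fix g
    assume g: "g \<in> carrier G"
    show "(\<Sum>x\<in>carrier G. ?r g * ?t g (inv g \<otimes> x) * gl x) = (\<Sum>h\<in>carrier G. ?r g * ?t g h * gl (g \<otimes> h))"
      by (rule sum.reindex_bij_witness[where i = "\<lambda>h. g \<otimes> h" and j = "\<lambda>x. inv g \<otimes> x"])
         (use g in \<open>auto simp: G.m_assoc[symmetric]\<close>)
  qed simp
  finally have c: "symb (conv (hcomps d r) (hcomps e s)) =
      (\<Sum>g\<in>carrier G. \<Sum>h\<in>carrier G. ?r g * ?t g h * gl (g \<otimes> h))" .
  have "symb (hcomps d r) * symb (hcomps e s) - symb (conv (hcomps d r) (hcomps e s)) =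
      (\<Sum>g\<in>carrier G. \<Sum>h\<in>carrier G. ?r g * gl g * (?s h * gl h) - ?r g * ?t g h * gl (g \<otimes> h))"
    unfolding c by (simp add: symb_def sum_product sum_subtractf)
  also have "\<dots> \<in> JP (d + e)"
  proof (intro JP_sum)
    fix g h
    assume g: "g \<in> carrier G" and h: "h \<in> carrier G"
    have "?r g * ((gl g * ?s h - ?t g h * gl g) * gl h) \<in> JP (d + e)"
      by (intro JP_mult(1) emb_hcomp_PLlt JP_gl_mult gl_emb g h)
    moreover have "?r g * ?t g h * (gl g * gl h - gl (g \<otimes> h)) \<in> JP (d + e)"
      using g h by (intro JP_J H.I_mult H_relation_mem free_algebra_closed emb_PL)
    ultimately have "?r g * ((gl g * ?s h - ?t g h * gl g) * gl h) +
        ?r g * ?t g h * (gl g * gl h - gl (g \<otimes> h)) \<in> JP (d + e)"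
      by (rule JP_add)
    then show "?r g * gl g * (?s h * gl h) - ?r g * ?t g h * gl (g \<otimes> h) \<in> JP (d + e)"
      by (simp add: left_diff_distrib right_diff_distrib mult.assoc)
  qed
  finally show ?thesis .
qed

text \<open>Leading terms multiply in H as in A: \<open>symb\<close> does so by
  \<open>symb_conv\<close>, and exchanging it for the section costs lower order terms in each
  factor.\<close>

lemma \<theta>0_conv:
  "\<theta>\<^sub>0 (hcomps d r) * \<theta>\<^sub>0 (hcomps e s) - \<theta>\<^sub>0 (conv (hcomps d r) (hcomps e s)) \<in> JP (d + e)"
proof -
  let ?t = "conv (hcomps d r) (hcomps e s)"
  have t: "hcomps (d + e) ?t = ?t"
    by (simp add: hcomp_conv_homogeneous)
  have 1: "\<theta>\<^sub>0 (hcomps d r) * (\<theta>\<^sub>0 (hcomps e s) - symb (hcomps e s)) \<in> JP (d + e)"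
    by (rule JP_mult(1)[OF \<theta>0_hcomps_PLlt \<theta>0_symb])
  have 2: "(\<theta>\<^sub>0 (hcomps d r) - symb (hcomps d r)) * symb (hcomps e s) \<in> JP (d + e)"
    using JP_mult(2)[OF symb_PLlt[of e s] \<theta>0_symb[of d r]] by (simp add: add.commute)
  have "\<theta>\<^sub>0 (hcomps d r) * \<theta>\<^sub>0 (hcomps e s) - symb (hcomps d r) * symb (hcomps e s) \<in> JP (d + e)"
    using JP_add[OF 1 2] by (simp add: left_diff_distrib right_diff_distrib)
  from JP_trans[OF this JP_trans[OF symb_conv JP_sym[OF \<theta>0_symb[of "d + e" ?t, unfolded t]]]]
  show ?thesis .
qed

end

section \<open>Consequences of the PBW property\<close>

text \<open>
  If \<open>\<gamma>\<close> killed some \<open>w \<noteq> 0\<close>, then a basis through \<open>w\<close> would be mapped to a spanning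
  set with fewer elements.
\<close>

lemma (in vector_space) surjective_endomorphism_injective:
  assumes W: "subspace W" "W \<subseteq> span S" "finite S"
    and \<gamma>: "\<And>x y. x \<in> W \<Longrightarrow> y \<in> W \<Longrightarrow> \<gamma> (x + y) = \<gamma> x + \<gamma> y"
      "\<And>c x. x \<in> W \<Longrightarrow> \<gamma> (scale c x) = scale c (\<gamma> x)" "W \<subseteq> \<gamma> ` W"
    and w: "w \<in> W" "\<gamma> w = 0"
  shows "w = 0"
proof (rule ccontr)
  assume "w \<noteq> 0"
  then have "independent {w}"
    by simp
  then obtain B where B: "{w} \<subseteq> B" "B \<subseteq> W" "independent B" "W \<subseteq> span B"
    using maximal_independent_subset_extend[of "{w}" W] w by blast
  have fin: "finite B"
    using independent_span_bound[OF W(3) B(3)] B(2) W(2) by blast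
  have "\<gamma> 0 = 0"
    using \<gamma>(1)[of 0 0] subspace_0[OF W(1)] by simp
  \<comment> \<open>Linearity of \<gamma> is known on W alone, so membership in W is carried through
    the induction.\<close>
  have "\<gamma> y \<in> span (\<gamma> ` (B - {w})) \<and> y \<in> W" if "y \<in> W" for y
  proof -
    have "y \<in> span B"
      using that B(4) by blast
    then show ?thesis
    proof (induction rule: span_induct_alt)
      case base
      show ?case
        using \<open>\<gamma> 0 = 0\<close> subspace_0[OF W(1)] by (simp add: span_zero)
    next
      case (step c b y)
      then have b: "b \<in> W" and y: "y \<in> W"
        using B(2) by auto
      have "\<gamma> b \<in> span (\<gamma> ` (B - {w}))"
        using step(1) w(2) by (cases "b = w") (auto simp: span_zero intro: span_base)
      then show ?case
        using b y step(2) subspace_scale[OF W(1)] subspace_add[OF W(1)]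
        by (simp add: \<gamma> span_add span_scale)
    qed
  qed
  then have "W \<subseteq> span (\<gamma> ` (B - {w}))"
    using \<gamma>(3) by blast
  then have "card B \<le> card (\<gamma> ` (B - {w}))"
    using independent_span_bound[of "\<gamma> ` (B - {w})" B] fin B by blast
  also have "\<dots> \<le> card (B - {w})"
    using fin by (intro card_image_le) auto
  also have "\<dots> < card B"
    using fin B(1) by (intro psubset_card_mono) auto
  finally show False
    by simp
qed

locale pbw_setup = skew_setup scale Basis G \<rho> lam kap
  for scale :: "'k::field \<Rightarrow> 'v::ab_group_add \<Rightarrow> 'v" and Basis :: "'v set"
    and G :: "('g, 'm) monoid_scheme" (structure) and \<rho> :: "'g \<Rightarrow> 'v \<Rightarrow> 'v"
    and lam :: "('g \<Rightarrow> 'k) \<Rightarrow> 'v \<Rightarrow> ('g \<Rightarrow> 'k)" and kap :: "'v \<Rightarrow> 'v \<Rightarrow> ('g \<Rightarrow> 'k)" +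
  assumes PBW: "PBW_property G scale \<rho> lam kap"
begin

section \<open>The associated graded algebra of H in terms of words\<close>

abbreviation Hal :: "('k, (('v + 'g) list \<Rightarrow>\<^sub>0 'k) set) module" where
  "Hal \<equiv> H_algebra G scale \<rho> lam kap"

abbreviation F :: "nat \<Rightarrow> (('v + 'g) list \<Rightarrow>\<^sub>0 'k) set set" where
  "F \<equiv> H_filtration G scale \<rho> lam kap"

abbreviation gr :: "('k, nat \<Rightarrow> (('v + 'g) list \<Rightarrow>\<^sub>0 'k) set set) module" where
  "gr \<equiv> assoc_graded Hal F"

lemma Hal_eq: "Hal = quotient_algebra (free_algebra L) J"
  by (simp add: H_algebra_def)

lemma Hal_add: "p \<in> PL \<Longrightarrow> q \<in> PL \<Longrightarrow> H.cls p \<oplus>\<^bsub>Hal\<^esub> H.cls q = H.cls (p + q)"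
  by (simp add: Hal_eq H.quotient_add)

lemma Hal_smult: "c \<odot>\<^bsub>Hal\<^esub> H.cls p = H.cls (Poly_Mapping.single 0 c * p)"
  by (simp add: Hal_eq H.quotient_smult)

lemma Hal_mult: "p \<in> PL \<Longrightarrow> q \<in> PL \<Longrightarrow> H.cls p \<otimes>\<^bsub>Hal\<^esub> H.cls q = H.cls (p * q)"
  by (simp add: Hal_eq H.quotient_mult)

lemma Hal_one: "\<one>\<^bsub>Hal\<^esub> = H.cls 1"
  by (simp add: Hal_eq H.quotient_one)

lemma Hal_carrier: "carrier Hal = H.cls ` PL"
  by (simp add: Hal_eq H.quotient_simps(1))

lemma F_eq: "F d = H.cls ` PLlt (Suc d)"
  by (auto simp: H_filtration_def H.cls_def PLlt_def less_Suc_eq_le)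

lemma filt_below_eq: "filt_below Hal F d = H.cls ` PLlt d"
  by (cases d) (simp_all add: filt_below_def F_eq Hal_eq H.quotient_zero PLlt_0)

text \<open>The class of p in F d / F (d - 1). It is a set of elements of H, which are themselves
  cosets of J.\<close>

definition symbol_coset :: "nat \<Rightarrow> (('v + 'g) list \<Rightarrow>\<^sub>0 'k) \<Rightarrow> (('v + 'g) list \<Rightarrow>\<^sub>0 'k) set set" where
  "symbol_coset d p = (\<lambda>y. H.cls (y + p)) ` PLlt d"

lemma filt_below_coset:
  assumes "p \<in> PL"
  shows "filt_below Hal F d +>\<^bsub>Hal\<^esub> H.cls p = symbol_coset d p"
  using assms by (auto simp: a_r_coset_def' filt_below_eq Hal_add PLlt_PL symbol_coset_def)

lemma symbol_coset_0: "symbol_coset d 0 = filt_below Hal F d"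
  by (simp add: symbol_coset_def filt_below_eq)

lemma symbol_coset_cong:
  assumes "p - q \<in> JP d"
  shows "symbol_coset d p = symbol_coset d q"
proof -
  have sub: "symbol_coset d p \<subseteq> symbol_coset d q" if pq: "p - q \<in> JP d" for p q
  proof
    fix c
    assume "c \<in> symbol_coset d p"
    then obtain y where y: "c = H.cls (y + p)" "y \<in> PLlt d"
      by (auto simp: symbol_coset_def)
    obtain x z where xz: "p - q = x + z" "x \<in> J" "z \<in> PLlt d"
      using pq by (auto simp: JP_def)
    have "(y + p) - ((y + z) + q) = x"
      using xz(1) by (simp add: algebra_simps)
    then have "c = H.cls ((y + z) + q)"
      using xz(2) unfolding y(1) H.cls_eq by simp
    then show "c \<in> symbol_coset d q"
      unfolding symbol_coset_def using PLlt_add[OF y(2) xz(3)] by blast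
  qed
  show ?thesis
    using sub[OF assms] sub[OF JP_sym[OF assms]] by blast
qed

lemma symbol_coset_add:
  assumes "p \<in> PL" "q \<in> PL"
  shows "symbol_coset d p <+>\<^bsub>Hal\<^esub> symbol_coset d q = symbol_coset d (p + q)"
proof (intro equalityI subsetI)
  fix c
  assume "c \<in> symbol_coset d p <+>\<^bsub>Hal\<^esub> symbol_coset d q"
  then obtain y z where "y \<in> PLlt d" "z \<in> PLlt d"
      "c = H.cls (y + p) \<oplus>\<^bsub>Hal\<^esub> H.cls (z + q)"
    by (auto simp: set_add_def' symbol_coset_def)
  moreover from this have "c = H.cls ((y + z) + (p + q))"
    using assms by (simp add: Hal_add PLlt_PL free_algebra_closed add_ac)
  ultimately show "c \<in> symbol_coset d (p + q)"
    unfolding symbol_coset_def using PLlt_add by blast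
next
  fix c
  assume "c \<in> symbol_coset d (p + q)"
  then obtain y where y: "y \<in> PLlt d" "c = H.cls (y + (p + q))"
    by (auto simp: symbol_coset_def)
  then have "c = H.cls (y + p) \<oplus>\<^bsub>Hal\<^esub> H.cls (0 + q)"
    using assms by (simp add: Hal_add PLlt_PL free_algebra_closed add_ac)
  then show "c \<in> symbol_coset d p <+>\<^bsub>Hal\<^esub> symbol_coset d q"
    unfolding set_add_def' symbol_coset_def using y(1) PLlt_zero by blast
qed

lemma PLlt_scalar: "p \<in> PLlt d \<Longrightarrow> Poly_Mapping.single 0 c * p \<in> PLlt d"
proof -
  assume "p \<in> PLlt d"
  moreover have "Poly_Mapping.single 0 c \<in> PLlt (Suc 0)"
    unfolding zero_list_def by (rule PLlt_single) auto
  ultimately show ?thesis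
    using PLlt_mult(1) by fastforce
qed

lemma symbol_coset_scalar:
  assumes p: "p \<in> PL"
  shows "filt_below Hal F d <+>\<^bsub>Hal\<^esub> {c \<odot>\<^bsub>Hal\<^esub> a | a. a \<in> symbol_coset d p} =
    symbol_coset d (Poly_Mapping.single 0 c * p)"
proof (intro equalityI subsetI)
  fix x
  assume "x \<in> filt_below Hal F d <+>\<^bsub>Hal\<^esub> {c \<odot>\<^bsub>Hal\<^esub> a | a. a \<in> symbol_coset d p}"
  then obtain y z where yz: "y \<in> PLlt d" "z \<in> PLlt d"
      "x = H.cls y \<oplus>\<^bsub>Hal\<^esub> (c \<odot>\<^bsub>Hal\<^esub> H.cls (z + p))"
    by (auto simp: set_add_def' symbol_coset_def filt_below_eq)
  then have "x = H.cls ((y + Poly_Mapping.single 0 c * z) + Poly_Mapping.single 0 c * p)"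
    using p by (simp add: Hal_add Hal_smult PLlt_PL free_algebra_closed
        distrib_left add_ac)
  then show "x \<in> symbol_coset d (Poly_Mapping.single 0 c * p)"
    unfolding symbol_coset_def using PLlt_add[OF yz(1) PLlt_scalar[OF yz(2)]] by blast
next
  fix x
  assume "x \<in> symbol_coset d (Poly_Mapping.single 0 c * p)"
  then obtain y where y: "y \<in> PLlt d" "x = H.cls (y + Poly_Mapping.single 0 c * p)"
    by (auto simp: symbol_coset_def)
  then have "x = H.cls y \<oplus>\<^bsub>Hal\<^esub> (c \<odot>\<^bsub>Hal\<^esub> H.cls (0 + p))"
    using p by (simp add: Hal_add Hal_smult PLlt_PL free_algebra_closed)
  then show "x \<in> filt_below Hal F d <+>\<^bsub>Hal\<^esub> {c \<odot>\<^bsub>Hal\<^esub> a | a. a \<in> symbol_coset d p}"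
    unfolding set_add_def' symbol_coset_def filt_below_eq using y(1) PLlt_zero by blast
qed

definition gr_symbol :: "nat \<Rightarrow> (('v + 'g) list \<Rightarrow>\<^sub>0 'k) \<Rightarrow> nat \<Rightarrow> (('v + 'g) list \<Rightarrow>\<^sub>0 'k) set set" where
  "gr_symbol d p = (\<lambda>e. symbol_coset e (if e = d then p else 0))"

lemma gr_symbol_component:
  assumes p: "p \<in> PLlt (Suc d)"
  shows "gr_symbol d p \<in> assoc_graded_component Hal F d"
proof -
  have "gr_symbol d p e \<in> {filt_below Hal F e +>\<^bsub>Hal\<^esub> a | a. a \<in> F e}" for e
  proof -
    let ?q = "if e = d then p else 0"
    have "?q \<in> PLlt (Suc e)"
      using p by (simp add: PLlt_zero)
    then have "gr_symbol d p e = filt_below Hal F e +>\<^bsub>Hal\<^esub> H.cls ?q" "H.cls ?q \<in> F e"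
      by (simp_all only: gr_symbol_def filt_below_coset PLlt_PL F_eq[of e] imageI)
    then show ?thesis
      by blast
  qed
  moreover have "{e. gr_symbol d p e \<noteq> filt_below Hal F e} \<subseteq> {d}"
    by (auto simp: gr_symbol_def symbol_coset_0)
  then have "finite {e. gr_symbol d p e \<noteq> filt_below Hal F e}"
    using finite_subset by blast
  ultimately show ?thesis
    unfolding assoc_graded_component_def assoc_graded_def
    by (auto simp: gr_symbol_def symbol_coset_0)
qed

lemma gr_symbol_add:
  assumes "p \<in> PL" "q \<in> PL"
  shows "gr_symbol d p \<oplus>\<^bsub>gr\<^esub> gr_symbol d q = gr_symbol d (p + q)"
  unfolding assoc_graded_def gr_symbol_def
  using assms by (auto simp: symbol_coset_add free_algebra_closed fun_eq_iff)

lemma gr_symbol_smult: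
  assumes "p \<in> PL"
  shows "c \<odot>\<^bsub>gr\<^esub> gr_symbol d p = gr_symbol d (Poly_Mapping.single 0 c * p)"
proof -
  have "(c \<odot>\<^bsub>gr\<^esub> gr_symbol d p) e = gr_symbol d (Poly_Mapping.single 0 c * p) e" for e
    using assms symbol_coset_scalar[of "if e = d then p else 0" e c]
    by (simp add: assoc_graded_def gr_symbol_def free_algebra_closed split: if_splits)
  then show ?thesis
    by blast
qed

text \<open>By \<open>span_step\<close> the symbols of section values already fill the component of
  degree d, which is half of the comparison of that component with A.\<close>

lemma gr_symbol_surj:
  assumes x: "x \<in> assoc_graded_component Hal F d"
  shows "\<exists>r. x = gr_symbol d (\<theta>\<^sub>0 (hcomps d r))"
proof -
  have xe: "x e = filt_below Hal F e" if "e \<noteq> d" for e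
    using x that by (simp add: assoc_graded_component_def)
  have "x d \<in> {filt_below Hal F d +>\<^bsub>Hal\<^esub> a | a. a \<in> F d}"
    using x by (simp add: assoc_graded_component_def assoc_graded_def)
  then obtain p where p: "p \<in> PLlt (Suc d)" "x d = filt_below Hal F d +>\<^bsub>Hal\<^esub> H.cls p"
    by (auto simp: F_eq)
  obtain r where "p - \<theta>\<^sub>0 (hcomps d r) \<in> JP d"
    using span_step[OF p(1)] by blast
  then have "x d = symbol_coset d (\<theta>\<^sub>0 (hcomps d r))"
    using p by (simp add: filt_below_coset PLlt_PL symbol_coset_cong)
  then have "x e = gr_symbol d (\<theta>\<^sub>0 (hcomps d r)) e" for e
    using xe by (cases "e = d") (auto simp: gr_symbol_def symbol_coset_0)
  then have "x = gr_symbol d (\<theta>\<^sub>0 (hcomps d r))" ..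
  then show ?thesis
    by blast
qed

text \<open>A copy of the degree d part of A inside the free algebra. It serves as the common space
  on which that part is compared with the associated graded algebra.\<close>

definition W :: "nat \<Rightarrow> (('v + 'g) list \<Rightarrow>\<^sub>0 'k) set" where
  "W d = range (\<lambda>r. \<theta>\<^sub>0 (hcomps d r))"

lemma W_subspace: "free.subspace (W d)"
proof (rule free.subspaceI)
  have "0 = \<theta>\<^sub>0 (hcomps d (\<lambda>g. 0))"
    by (simp add: \<theta>0_0)
  then show "0 \<in> W d"
    unfolding W_def by (rule range_eqI[where x = "\<lambda>g. 0"])
next
  fix x y
  assume "x \<in> W d" "y \<in> W d"
  then obtain r s where "x = \<theta>\<^sub>0 (hcomps d r)" "y = \<theta>\<^sub>0 (hcomps d s)"
    by (auto simp: W_def)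
  then have "x + y = \<theta>\<^sub>0 (hcomps d (\<lambda>g. r g + s g))"
    by (simp add: hcomp_add \<theta>0_add)
  then show "x + y \<in> W d"
    unfolding W_def by (rule range_eqI[where x = "\<lambda>g. r g + s g"])
next
  fix c x
  assume "x \<in> W d"
  then obtain r where "x = \<theta>\<^sub>0 (hcomps d r)"
    by (auto simp: W_def)
  then have "Poly_Mapping.single 0 c * x = \<theta>\<^sub>0 (hcomps d (\<lambda>g. Poly_Mapping.single 0 c * r g))"
    by (simp add: hcomp_scalar \<theta>0_scalar)
  then show "Poly_Mapping.single 0 c * x \<in> W d"
    unfolding W_def by (rule range_eqI[where x = "\<lambda>g. Poly_Mapping.single 0 c * r g"])
qed

text \<open>Normal forms of degree d are combinations of words of length d over the finite set
  \<open>Basis\<close>, and each is followed by one of finitely many group elements.\<close>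

lemma W_finite_span: "\<exists>S. finite S \<and> W d \<subseteq> free.span S"
proof -
  let ?S = "(\<lambda>(w, g). emb (Poly_Mapping.single w 1) * gl g) `
    ({w. set w \<subseteq> Basis \<and> length w = d} \<times> carrier G)"
  have fin: "finite ?S"
    using finite_G finite_lists_length_eq[OF finite_Basis, of d] by (intro finite_imageI finite_cartesian_product)
  have *: "emb (hcomp d p) * gl g \<in> free.span ?S" if "p \<in> free.span basis_words" "g \<in> carrier G" for p g
    using that(1)
  proof (induction rule: free.span_induct_alt)
    case base
    show ?case
      by (simp add: free.span_zero)
  next
    case (step c x y)
    then obtain w where w: "w \<in> lists Basis" "x = Poly_Mapping.single w 1"
      by (auto simp: basis_words_def)
    have "emb (hcomp d x) * gl g \<in> free.span ?S"
    proof (cases "length w = d")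
      case True
      then have "emb (hcomp d x) * gl g \<in> ?S"
        using w that(2) by (force simp: hcomp_single)
      then show ?thesis
        by (rule free.span_base)
    qed (simp add: w hcomp_single free.span_zero)
    then have "Poly_Mapping.single 0 c * (emb (hcomp d x) * gl g) + emb (hcomp d y) * gl g \<in> free.span ?S"
      using step(2) by (intro free.span_add free.span_scale)
    also have "Poly_Mapping.single 0 c * (emb (hcomp d x) * gl g) + emb (hcomp d y) * gl g =
        emb (hcomp d (Poly_Mapping.single 0 c * x + y)) * gl g"
      by (simp add: hcomp_add hcomp_scalar free_map_add free_map_scalar distrib_right mult.assoc)
    finally show ?case .
  qed
  have "W d \<subseteq> free.span ?S"
    unfolding W_def \<theta>\<^sub>0_def nf_hcomp
    by (rule subsetI, elim rangeE, simp only:) (intro free.span_sum * nf_span)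
  with fin show ?thesis
    by blast
qed

text \<open>
  The PBW property only provides some graded isomorphism between the associated graded algebra
  and \<open>A\<close>. Composed with the symbol map \<open>W d \<rightarrow> gr\<^sub>d\<close> it gives a surjective endomorphism of the
  finite-dimensional space \<open>W d\<close>; hence the symbol map is injective.
\<close>

lemma symbol_injective:
  assumes w: "w \<in> W d" "w \<in> JP d"
  shows "w = 0"
proof -
  obtain f where f: "f \<in> alg_iso gr A"
    "\<And>d. f ` assoc_graded_component Hal F d = skew_component G scale d"
    using PBW unfolding PBW_property_def graded_alg_isomorphic_def by blast
  have f_hom: "f \<in> ring_hom gr A" and f_smult: "\<And>c x. x \<in> carrier gr \<Longrightarrow> f (c \<odot>\<^bsub>gr\<^esub> x) = c \<odot>\<^bsub>A\<^esub> f x"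
    using f(1) by (auto simp: alg_iso_def ring_iso_def)
  define \<gamma> where "\<gamma> p = \<theta> (f (gr_symbol d p))" for p
  have W_PLlt: "p \<in> PLlt (Suc d)" if "p \<in> W d" for p
    using that \<theta>0_hcomps_PLlt by (auto simp: W_def)
  have W_PL: "p \<in> PL" if "p \<in> W d" for p
    using PLlt_PL[OF W_PLlt[OF that]] .
  have comp: "gr_symbol d p \<in> assoc_graded_component Hal F d" if "p \<in> W d" for p
    using gr_symbol_component[OF W_PLlt[OF that]] .
  have carr: "gr_symbol d p \<in> carrier gr" if "p \<in> W d" for p
    using comp[OF that] by (simp add: assoc_graded_component_def)
  have fA: "\<exists>r. f (gr_symbol d p) = mk r" if "p \<in> W d" for p
    using f(2)[of d] comp[OF that] by (fastforce simp: skew_component_eq)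
  have add: "\<gamma> (p + q) = \<gamma> p + \<gamma> q" if p: "p \<in> W d" and q: "q \<in> W d" for p q
  proof -
    have "f (gr_symbol d (p + q)) = f (gr_symbol d p) \<oplus>\<^bsub>A\<^esub> f (gr_symbol d q)"
      using ring_hom_add[OF f_hom carr[OF p] carr[OF q]]
      unfolding gr_symbol_add[OF W_PL[OF p] W_PL[OF q]] .
    moreover obtain r s where "f (gr_symbol d p) = mk r" "f (gr_symbol d q) = mk s"
      using fA p q by blast
    ultimately show ?thesis
      by (simp add: \<gamma>_def A_add \<theta>_mk \<theta>0_add)
  qed
  have smult: "\<gamma> (Poly_Mapping.single 0 c * p) = Poly_Mapping.single 0 c * \<gamma> p" if p: "p \<in> W d" for c p
  proof -
    have "f (gr_symbol d (Poly_Mapping.single 0 c * p)) = c \<odot>\<^bsub>A\<^esub> f (gr_symbol d p)"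
      using f_smult[OF carr[OF p], of c] unfolding gr_symbol_smult[OF W_PL[OF p]] .
    moreover obtain r where "f (gr_symbol d p) = mk r"
      using fA p by blast
    ultimately show ?thesis
      by (simp add: \<gamma>_def A_smult \<theta>_mk \<theta>0_scalar)
  qed
  have surj: "W d \<subseteq> \<gamma> ` W d"
  proof
    fix p
    assume "p \<in> W d"
    then obtain r where r: "p = \<theta>\<^sub>0 (hcomps d r)"
      by (auto simp: W_def)
    have "mk (hcomps d r) \<in> f ` assoc_graded_component Hal F d"
      unfolding f(2) skew_component_eq by blast
    then obtain x where x: "x \<in> assoc_graded_component Hal F d" "mk (hcomps d r) = f x"
      by blast
    obtain s where "x = gr_symbol d (\<theta>\<^sub>0 (hcomps d s))"
      using gr_symbol_surj[OF x(1)] by blast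
    with x(2) r have "p = \<gamma> (\<theta>\<^sub>0 (hcomps d s))"
      by (simp add: \<gamma>_def \<theta>_mk[symmetric])
    then show "p \<in> \<gamma> ` W d"
      by (auto simp: W_def)
  qed
  have W_0: "0 \<in> W d"
    using W_subspace free.subspace_0 by blast
  have "symbol_coset d w = symbol_coset d 0"
    using w(2) by (intro symbol_coset_cong) simp
  then have "gr_symbol d w e = gr_symbol d 0 e" for e
    by (simp add: gr_symbol_def)
  then have "gr_symbol d w = gr_symbol d 0" ..
  then have "\<gamma> w = \<gamma> 0"
    by (simp add: \<gamma>_def)
  also have "\<dots> = 0"
    using add[OF W_0 W_0] by simp
  finally have "\<gamma> w = 0" .
  obtain S where "finite S" "W d \<subseteq> free.span S"
    using W_finite_span by blast
  then show ?thesis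
    using free.surjective_endomorphism_injective[OF W_subspace _ _ add smult surj w(1) \<open>\<gamma> w = 0\<close>] by blast
qed

text \<open>If the section value lies in J, its top part is congruent to minus the lower parts and
  so lies in \<open>JP d\<close>. By \<open>symbol_injective\<close> it vanishes, and the degree
  bound drops.\<close>

lemma \<theta>0_J_low: "low d r \<Longrightarrow> \<theta>\<^sub>0 r \<in> J \<Longrightarrow> \<theta>\<^sub>0 r = 0"
proof (induction d arbitrary: r)
  case 0
  then show ?case
    by (simp add: \<theta>0_low_sum[OF 0(1)])
next
  case (Suc d)
  let ?r = "\<lambda>g. r g - hcomp d (r g)"
  have low: "low d ?r"
    using Suc.prems(1) by (auto simp: low_def hcomp_diff hcomp_hcomp not_less_eq_eq le_Suc_eq
        dest: le_antisym)
  have eq: "\<theta>\<^sub>0 ?r = \<theta>\<^sub>0 r - \<theta>\<^sub>0 (hcomps d r)"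
    by (rule \<theta>0_diff)
  have "\<theta>\<^sub>0 r - \<theta>\<^sub>0 ?r \<in> JP d"
    by (intro JP_diff JP_J JP_PLlt \<theta>0_low_PLlt low Suc.prems)
  then have "\<theta>\<^sub>0 (hcomps d r) = 0"
    by (intro symbol_injective[of _ d]) (auto simp: eq W_def)
  with Suc.IH[OF low] Suc.prems(2) eq show ?case
    by simp
qed

lemma \<theta>0_J: "\<theta>\<^sub>0 r \<in> J \<Longrightarrow> \<theta>\<^sub>0 r = 0"
  using \<theta>0_J_low ex_low by blast

section \<open>Components of normal forms in H\<close>

definition normal :: "(('v + 'g) list \<Rightarrow>\<^sub>0 'k) \<Rightarrow> 'g \<Rightarrow> 'v list \<Rightarrow>\<^sub>0 'k" where
  "normal p = (SOME r. p - \<theta>\<^sub>0 r \<in> J)"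

definition \<nu> :: "nat \<Rightarrow> (('v + 'g) list \<Rightarrow>\<^sub>0 'k) \<Rightarrow> ('v + 'g) list \<Rightarrow>\<^sub>0 'k" where
  "\<nu> m p = \<theta>\<^sub>0 (hcomps m (normal p))"

lemma normal_mem: "p \<in> PL \<Longrightarrow> p - \<theta>\<^sub>0 (normal p) \<in> J"
  unfolding normal_def using span_all PL_PLlt by (metis (mono_tags, lifting) someI_ex)

text \<open>Two normal forms of p differ by a section value in J, which is 0 by
  \<open>\<theta>0_J\<close>. Any of them may therefore be used to compute components.\<close>

lemma \<nu>_eq:
  assumes "p \<in> PL" "p - \<theta>\<^sub>0 r \<in> J"
  shows "\<nu> m p = \<theta>\<^sub>0 (hcomps m r)"
proof -
  have "\<theta>\<^sub>0 (\<lambda>g. normal p g - r g) \<in> J"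
    unfolding \<theta>0_diff using H.I_trans[OF H.I_sym[OF normal_mem[OF assms(1)]] assms(2)] .
  then have "\<theta>\<^sub>0 (normal p) = \<theta>\<^sub>0 r"
    using \<theta>0_J[of "\<lambda>g. normal p g - r g"] by (simp add: \<theta>0_diff)
  then show ?thesis
    unfolding \<nu>_def by (rule \<theta>0_hcomps_cong)
qed

lemma \<nu>_\<theta>0: "\<nu> m (\<theta>\<^sub>0 r) = \<theta>\<^sub>0 (hcomps m r)"
  by (rule \<nu>_eq) (simp_all add: \<theta>0_PL H.I_0)

text \<open>By \<open>span_all\<close> a member of \<open>JP d\<close> has a normal form whose
  components all have degree below d.\<close>

lemma \<nu>_JP:
  assumes "p \<in> JP d" "d \<le> m"
  shows "\<nu> m p = 0"
proof -
  obtain x y where xy: "p = x + y" "x \<in> J" "y \<in> PLlt d"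
    using assms(1) by (auto simp: JP_def)
  obtain r where r: "low d r" "y - \<theta>\<^sub>0 r \<in> J"
    using span_all[OF xy(3)] by blast
  have "p - \<theta>\<^sub>0 r = x + (y - \<theta>\<^sub>0 r)"
    using xy(1) by simp
  then have "p - \<theta>\<^sub>0 r \<in> J"
    using xy(2) r(2) by (simp only: H.I_add)
  moreover have "p \<in> PL"
    using xy J_PL PLlt_PL by (simp add: free_algebra_closed)
  ultimately have "\<nu> m p = \<theta>\<^sub>0 (hcomps m r)"
    by (intro \<nu>_eq)
  also have "\<dots> = \<theta>\<^sub>0 (\<lambda>g. 0)"
    using r(1) assms(2) by (intro \<theta>0_cong) (simp add: low_def)
  finally show ?thesis
    by (simp add: \<theta>0_0)
qed

lemma \<nu>_PLlt: "p \<in> PLlt d \<Longrightarrow> d \<le> m \<Longrightarrow> \<nu> m p = 0"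
  by (rule \<nu>_JP[OF JP_PLlt])

lemma \<nu>_add_PL:
  assumes "p \<in> PL" "q \<in> PL"
  shows "\<nu> m (p + q) = \<nu> m p + \<nu> m q"
proof -
  have "(p - \<theta>\<^sub>0 (normal p)) + (q - \<theta>\<^sub>0 (normal q)) \<in> J"
    by (intro H.I_add normal_mem assms)
  then have "p + q - \<theta>\<^sub>0 (\<lambda>g. normal p g + normal q g) \<in> J"
    by (simp add: \<theta>0_add add_diff_add)
  then have "\<nu> m (p + q) = \<theta>\<^sub>0 (hcomps m (\<lambda>g. normal p g + normal q g))"
    using assms by (intro \<nu>_eq) (simp_all add: free_algebra_closed)
  then show ?thesis
    by (simp add: hcomp_add \<theta>0_add \<nu>_def)
qed

lemma \<nu>_scalar_PL:
  assumes "p \<in> PL"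
  shows "\<nu> m (Poly_Mapping.single 0 c * p) = Poly_Mapping.single 0 c * \<nu> m p"
proof -
  have "Poly_Mapping.single 0 c * (p - \<theta>\<^sub>0 (normal p)) \<in> J"
    by (intro H.I_scalar normal_mem assms)
  then have "Poly_Mapping.single 0 c * p - \<theta>\<^sub>0 (\<lambda>g. Poly_Mapping.single 0 c * normal p g) \<in> J"
    by (simp only: \<theta>0_scalar right_diff_distrib)
  then have "\<nu> m (Poly_Mapping.single 0 c * p) = \<theta>\<^sub>0 (hcomps m (\<lambda>g. Poly_Mapping.single 0 c * normal p g))"
    using assms by (intro \<nu>_eq) (simp_all add: free_algebra_closed)
  then show ?thesis
    by (simp add: hcomp_scalar \<theta>0_scalar \<nu>_def)
qed

lemma \<nu>_sum_mem:
  assumes p: "p \<in> PL"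
  shows "finite {m. \<nu> m p \<noteq> 0}" and "p - (\<Sum>m | \<nu> m p \<noteq> 0. \<nu> m p) \<in> J"
proof -
  obtain d where d: "low d (normal p)"
    using ex_low by blast
  have high: "\<nu> m p = 0" if "d \<le> m" for m
  proof -
    have "\<nu> m p = \<theta>\<^sub>0 (\<lambda>g. 0)"
      unfolding \<nu>_def using d that by (intro \<theta>0_cong) (simp add: low_def)
    then show ?thesis
      by (simp add: \<theta>0_0)
  qed
  have sub: "{m. \<nu> m p \<noteq> 0} \<subseteq> {..<d}"
    using high not_le by blast
  then show "finite {m. \<nu> m p \<noteq> 0}"
    using finite_subset by blast
  have "(\<Sum>m | \<nu> m p \<noteq> 0. \<nu> m p) = (\<Sum>m<d. \<nu> m p)"
    by (rule sum.mono_neutral_left) (use sub in auto)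
  also have "\<dots> = \<theta>\<^sub>0 (normal p)"
    using \<theta>0_low_sum[OF d] by (simp add: \<nu>_def)
  finally show "p - (\<Sum>m | \<nu> m p \<noteq> 0. \<nu> m p) \<in> J"
    using normal_mem[OF p] by simp
qed

text \<open>By \<open>\<theta>0_conv\<close> each product of components differs from the section of
  the corresponding product in A by a member of \<open>JP m\<close>, and \<open>\<nu> m\<close>
  kills it.\<close>

lemma \<nu>_mult:
  "\<nu> m (\<theta>\<^sub>0 (conv r s)) = (\<Sum>d\<le>m. \<nu> m (\<nu> d (\<theta>\<^sub>0 r) * \<nu> (m - d) (\<theta>\<^sub>0 s)))"
proof -
  have "\<nu> m (\<theta>\<^sub>0 (conv r s)) = (\<Sum>d\<le>m. \<theta>\<^sub>0 (conv (hcomps d r) (hcomps (m - d) s)))"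
    by (simp add: \<nu>_\<theta>0 hcomp_conv \<theta>0_sum)
  also have "\<dots> = (\<Sum>d\<le>m. \<nu> m (\<nu> d (\<theta>\<^sub>0 r) * \<nu> (m - d) (\<theta>\<^sub>0 s)))"
  proof (rule sum.cong)
    fix d
    assume "d \<in> {..m}"
    then have d: "d + (m - d) = m"
      by simp
    let ?t = "conv (hcomps d r) (hcomps (m - d) s)"
    let ?p = "\<theta>\<^sub>0 (hcomps d r) * \<theta>\<^sub>0 (hcomps (m - d) s)"
    have "\<nu> m (?p - \<theta>\<^sub>0 ?t) = 0"
      using \<theta>0_conv[of d r "m - d" s] unfolding d by (rule \<nu>_JP) simp
    moreover have "\<nu> m ?p = \<nu> m (?p - \<theta>\<^sub>0 ?t) + \<nu> m (\<theta>\<^sub>0 ?t)"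
      using \<nu>_add_PL[of "?p - \<theta>\<^sub>0 ?t" "\<theta>\<^sub>0 ?t" m] \<theta>0_PL by (simp add: PL_diff free_algebra_closed)
    moreover have "\<nu> m (\<theta>\<^sub>0 ?t) = \<theta>\<^sub>0 ?t"
      using hcomp_conv_homogeneous[of d "m - d" r s] unfolding d by (simp add: \<nu>_\<theta>0)
    ultimately show "\<theta>\<^sub>0 ?t = \<nu> m (\<nu> d (\<theta>\<^sub>0 r) * \<nu> (m - d) (\<theta>\<^sub>0 s))"
      by (simp add: \<nu>_\<theta>0)
  qed simp
  finally show ?thesis .
qed

text \<open>The ideal contains nothing with a constant term, so in degree 0 there is nothing to
  normalize. This makes the section exact on kG, without passing to classes modulo J.\<close>

lemma nf_degree_0:
  assumes "hcomp 0 p = p"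
  shows "nf p = p"
proof (rule poly_mapping_eqI)
  fix w
  have "hcomp 0 (nf p - p) = nf p - p"
    using nf_hcomp[of 0 p] assms by (simp add: hcomp_diff)
  then have "Poly_Mapping.lookup (nf p - p) w = (if w = [] then Poly_Mapping.lookup (nf p - p) w else 0)"
    by (metis length_0_conv lookup_hcomp)
  moreover have "Poly_Mapping.lookup (nf p - p) [] = 0"
    using sym_ideal_low nf_diff_mem by blast
  ultimately have "Poly_Mapping.lookup (nf p - p) w = 0"
    by (auto split: if_splits)
  then show "Poly_Mapping.lookup (nf p) w = Poly_Mapping.lookup p w"
    by (simp add: lookup_minus)
qed

lemma nf_scalar_one: "nf (Poly_Mapping.single [] c) = Poly_Mapping.single [] c"
  by (rule nf_degree_0) (simp add: hcomp_single)

lemma \<theta>0_group: "\<theta>\<^sub>0 (\<lambda>x. Poly_Mapping.single [] (a x)) = free_group_part G a"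
  by (simp add: \<theta>\<^sub>0_def free_group_part_def nf_scalar_one letter_def single_mult)

lemma \<theta>0_at_one: "\<theta>\<^sub>0 (\<lambda>x. if x = \<one> then p else 0) = emb (nf p) * gl \<one>"
proof -
  have "\<theta>\<^sub>0 (\<lambda>x. if x = \<one> then p else 0) = (\<Sum>x\<in>carrier G. if x = \<one> then emb (nf p) * gl \<one> else 0)"
    unfolding \<theta>\<^sub>0_def by (rule sum.cong) auto
  then show ?thesis
    using finite_G by simp
qed

lemma emb_gl_one: "emb p * gl \<one> - emb p \<in> J"
proof -
  have "emb p * (gl \<one> - 1) \<in> J"
    by (intro H.I_mult H_relation_mem emb_PL)
  then show ?thesis
    by (simp add: right_diff_distrib)
qed

sublocale R: filtered_presentation A PL J "\<lambda>c. Poly_Mapping.single 0 c" \<theta> \<nu> Hal H.cls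
proof (intro filtered_presentation.intro filtered_section.intro filtered_presentation_axioms.intro)
  show "abelian_group A"
    by (rule abelian_group_A)
  show "\<exists>a\<in>carrier A. \<theta> a - p \<in> J" if "p \<in> PL" for p
    using H.I_sym[OF normal_mem[OF that]] by (intro bexI[of _ "mk (normal p)"]) (simp_all add: \<theta>_mk mk_A)
  \<comment> \<open>Two injectivity statements combine: \<open>\<theta>0_J\<close> passes from J to
    0, and \<open>\<theta>0_inj\<close> passes from 0 to the normal forms of the
    representatives.\<close>
  show "a = \<zero>\<^bsub>A\<^esub>" if a: "a \<in> carrier A" "\<theta> a \<in> J" for a
  proof -
    obtain r where r: "a = mk r"
      using a(1) by (auto simp: A_carrier)
    then have "\<theta>\<^sub>0 r = \<theta>\<^sub>0 (\<lambda>g. 0)"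
      using a(2) \<theta>0_J by (simp add: \<theta>_mk \<theta>0_0)
    then have "nf (r g) = nf 0" if "g \<in> carrier G" for g
      by (rule \<theta>0_inj) (rule that)
    then show ?thesis
      unfolding r A_zero mk_eq nf_eq_iff by blast
  qed
  show "\<theta> \<one>\<^bsub>A\<^esub> - 1 \<in> J"
    using H_relation_mem(3) nf_scalar_one[of 1]
    by (simp add: A_one \<theta>_mk \<theta>0_at_one one_eq_single[symmetric])
  show "\<nu> m (\<nu> d p) = (if m = d then \<nu> d p else 0)" for m d p
    by (simp add: \<nu>_def[of d] \<nu>_\<theta>0 hcomp_hcomp \<theta>0_0)
  \<comment> \<open>The unit is the empty word, which has degree 0.\<close>
  show "\<nu> m 1 = 0" if "m \<noteq> 0" for m
    using that by (intro \<nu>_PLlt[of _ "Suc 0"]) (auto simp: one_eq_single intro: PLlt_single)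
  show "\<nu> m (\<nu> d p * \<nu> e q) = 0" if "d + e < m" for p q d e m
  proof (rule \<nu>_PLlt)
    show "\<nu> d p * \<nu> e q \<in> PLlt (d + Suc e)"
      unfolding \<nu>_def by (intro PLlt_mult(1) \<theta>0_hcomps_PLlt)
  qed (use that in simp)
  show "\<nu> m (\<theta> (a \<otimes>\<^bsub>A\<^esub> b)) = (\<Sum>d\<le>m. \<nu> m (\<nu> d (\<theta> a) * \<nu> (m - d) (\<theta> b)))"
    if "a \<in> carrier A" "b \<in> carrier A" for a b m
    using that by (auto simp: A_carrier A_mult \<theta>_mk \<nu>_mult)
  show "Poly_Mapping.single 0 c * p = p * Poly_Mapping.single 0 c" for c and p :: "('v + 'g) list \<Rightarrow>\<^sub>0 'k"
    by (rule scalar_comm)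
  show "\<nu> m p = 0" if "p \<in> J" for m p
    using \<nu>_JP[OF JP_J[OF that, of 0]] by simp
  show "H.cls p = H.cls q \<longleftrightarrow> p - q \<in> J" for p q
    by (rule H.cls_eq)
  show "p - (\<Sum>m | \<nu> m p \<noteq> 0. \<nu> m p) \<in> J" if "p \<in> PL" for p
    by (rule \<nu>_sum_mem(2)[OF that])
qed (auto simp: A_carrier A_smult A_add A_mult A_one \<theta>_mk \<theta>0_add \<theta>0_scalar \<theta>0_PL
    free_algebra_closed H.I_0 H.I_add H.I_uminus H.I_mult J_PL single_add mult_single
    \<nu>_add_PL \<nu>_scalar_PL \<nu>_sum_mem(1) Hal_add Hal_smult Hal_mult Hal_one Hal_carrier,
    auto simp: \<nu>_def \<theta>0_PL)

section \<open>The grading of the deformation and the commutators of its multiplication maps\<close>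

lemma comp_mk: "R.comp m (mk r) = \<theta>\<^sub>0 (hcomps m r)"
  by (simp add: R.comp_def \<theta>_mk \<nu>_\<theta>0)

lemma skew_component_A: "a \<in> skew_component G scale d \<Longrightarrow> a \<in> carrier A"
  by (auto simp: skew_component_eq mk_A)

lemma comp_skew_component:
  "a \<in> skew_component G scale d \<Longrightarrow> R.comp m a = (if m = d then \<theta> a else 0)"
  by (auto simp: skew_component_eq comp_mk \<theta>_mk hcomp_hcomp \<theta>0_0)

lemma skew_componentI:
  assumes a: "a \<in> carrier A" and "\<And>m. m \<noteq> d \<Longrightarrow> R.comp m a = 0"
  shows "a \<in> skew_component G scale d"
proof -
  obtain r where r: "a = mk r"
    using a by (auto simp: A_carrier)
  have "a = mk (hcomps d r)"
  proof (rule R.comp_eqI[OF a mk_A])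
    fix m
    show "R.comp m a = R.comp m (mk (hcomps d r))"
      using assms(2)[of m] by (cases "m = d") (simp_all add: r comp_mk hcomp_hcomp \<theta>0_0)
  qed
  then show ?thesis
    by (auto simp: skew_component_eq)
qed

lemma comp_\<mu>_component:
  assumes "a \<in> skew_component G scale d" "b \<in> skew_component G scale e"
  shows "R.comp m (R.\<mu> j a b) = (if m + j = d + e then \<nu> m (\<theta> a * \<theta> b) else 0)"
  using R.comp_\<mu>_homogeneous[of a b d e m j] assms by (simp add: skew_component_A comp_skew_component)

text \<open>Homogeneous arguments leave a single component, in degree d + e - j; for j > d + e there
  is no such degree and all components vanish.\<close>

lemma graded_deformation_\<mu>: "graded_deformation A (skew_component G scale) R.\<mu>"
proof -
  have "if j \<le> d + e then R.\<mu> j a b \<in> skew_component G scale (d + e - j) else R.\<mu> j a b = \<zero>\<^bsub>A\<^esub>"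
    if a: "a \<in> skew_component G scale d" and b: "b \<in> skew_component G scale e" for j d e a b
  proof -
    have \<mu>: "R.\<mu> j a b \<in> carrier A"
      using a b by (simp add: R.\<mu>_A skew_component_A)
    have "R.\<mu> j a b \<in> skew_component G scale (d + e - j)" if "j \<le> d + e"
      by (rule skew_componentI[OF \<mu>]) (use that in \<open>auto simp: comp_\<mu>_component[OF a b]\<close>)
    moreover have "R.\<mu> j a b = \<zero>\<^bsub>A\<^esub>" if "\<not> j \<le> d + e"
      by (rule R.comp_eqI[OF \<mu>]) (use that in \<open>simp_all add: comp_\<mu>_component[OF a b]\<close>)
    ultimately show ?thesis
      by simp
  qed
  then show ?thesis
    by (simp add: graded_deformation_def R.deformation_\<mu>)
qed

lemma skew_group_eq: "skew_group G scale a = mk (\<lambda>x. Poly_Mapping.single [] (a x))"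
  unfolding skew_group_def mk_def sym_algebra_eq S.quotient_one S.quotient_smult
  by (simp add: zero_list_def)

lemma skew_vector_eq: "skew_vector G scale v = mk (\<lambda>x. if x = \<one> then letter v else 0)"
  unfolding skew_vector_def mk_def sym_algebra_eq S.quotient_zero
  by (auto simp: S_cls intro!: restrict_ext)

lemma skew_group_component: "skew_group G scale a \<in> skew_component G scale 0"
proof -
  have "skew_group G scale a = mk (hcomps 0 (\<lambda>x. Poly_Mapping.single [] (a x)))"
    by (simp add: skew_group_eq hcomp_single)
  then show ?thesis
    unfolding skew_component_eq by (rule range_eqI[where x = "\<lambda>x. Poly_Mapping.single [] (a x)"])
qed

lemma skew_vector_component: "skew_vector G scale v \<in> skew_component G scale 1"
proof -
  have "skew_vector G scale v = mk (hcomps 1 (\<lambda>x. if x = \<one> then letter v else 0))"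
    unfolding skew_vector_eq by (rule arg_cong[of _ _ mk]) (auto simp: letter_def hcomp_single)
  then show ?thesis
    unfolding skew_component_eq by (rule range_eqI[where x = "\<lambda>x. if x = \<one> then letter v else 0"])
qed

lemma \<theta>_skew_group: "\<theta> (skew_group G scale a) = free_group_part G a"
  by (simp add: skew_group_eq \<theta>_mk \<theta>0_group)

lemma free_group_part_elt: "g \<in> carrier G \<Longrightarrow> free_group_part G (group_elt G g) = gl g"
proof -
  assume g: "g \<in> carrier G"
  have "free_group_part G (group_elt G g) = (\<Sum>h\<in>carrier G. if h = g then gl g else 0)"
    unfolding free_group_part_def by (rule sum.cong) (auto simp: group_elt_def letter_def)
  then show ?thesis
    using g finite_G by simp
qed

text \<open>Two corrections modulo J are needed: the letter of the unit of G is replaced by 1, and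
  the normal form of v by v.\<close>

lemma \<theta>_skew_vector: "\<theta> (skew_vector G scale v) - vl v \<in> J"
  using H.I_trans[OF emb_gl_one emb_nf_letter] by (simp add: skew_vector_eq \<theta>_mk \<theta>0_at_one)

lemma \<theta>_skew_vector_PL: "\<theta> (skew_vector G scale v) \<in> PL"
  by (simp add: skew_vector_eq \<theta>_mk \<theta>0_PL)

text \<open>If the degrees of a and b add up to j, then \<open>\<mu> j a b\<close> lies in degree 0
  and is given by \<open>\<nu> 0\<close> of the product of the section values. A relation of H whose
  right-hand side c has degree 0 is thus turned by \<open>\<nu> 0\<close> into a commutator formula.
  The products of g with v have total degree 1, those of v with w total degree 2.\<close>

lemma \<mu>_commutator:
  assumes a: "a \<in> skew_component G scale d" "b \<in> skew_component G scale e"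
    and a': "a' \<in> skew_component G scale d'" "b' \<in> skew_component G scale e'"
    and j: "d + e = j" "d' + e' = j" and c: "c \<in> skew_component G scale 0"
    and J: "\<theta> a * \<theta> b - \<theta> a' * \<theta> b' - \<theta> c \<in> J"
  shows "c = R.\<mu> j a b \<ominus>\<^bsub>A\<^esub> R.\<mu> j a' b'"
proof (rule R.comp_eqI)
  note A = assms(1-4,7)[THEN skew_component_A]
  show "c \<in> carrier A" "R.\<mu> j a b \<ominus>\<^bsub>A\<^esub> R.\<mu> j a' b' \<in> carrier A"
    using A by (simp_all add: R.\<mu>_A R.A.minus_closed)
  fix m
  have "\<nu> 0 (\<theta> a * \<theta> b) - \<nu> 0 (\<theta> a' * \<theta> b') = \<nu> 0 (\<theta> c)"
    using R.\<nu>_cong[OF _ _ J] A by (simp add: R.\<nu>_diff[symmetric] R.\<theta>_P R.P_mult R.P_diff)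
  moreover have "\<nu> 0 (\<theta> c) = \<theta> c"
    using comp_skew_component[OF c, of 0] by (simp add: R.comp_def)
  ultimately show "R.comp m c = R.comp m (R.\<mu> j a b \<ominus>\<^bsub>A\<^esub> R.\<mu> j a' b')"
    using A a a' c j by (simp add: R.comp_minus R.\<mu>_A comp_\<mu>_component comp_skew_component)
qed

lemma \<mu>_lam:
  assumes g: "g \<in> carrier G"
  shows "skew_group G scale (lam (group_elt G g) v) =
    R.\<mu> 1 (skew_group G scale (group_elt G g)) (skew_vector G scale v) \<ominus>\<^bsub>A\<^esub>
    R.\<mu> 1 (skew_vector G scale (\<rho> g v)) (skew_group G scale (group_elt G g))"
proof (rule \<mu>_commutator)
  let ?v = "\<theta> (skew_vector G scale v)" and ?w = "\<theta> (skew_vector G scale (\<rho> g v))"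
  let ?l = "free_group_part G (lam (group_elt G g) v)"
  \<comment> \<open>The section is exact on g, so only the vectors need a correction modulo J in
    passing from the relation between letters to section values.\<close>
  have "gl g * (?v - vl v) - (?w - vl (\<rho> g v)) * gl g + (gl g * vl v - vl (\<rho> g v) * gl g - ?l) \<in> J"
    by (intro H.I_add H.I_diff H.I_mult \<theta>_skew_vector H_relation_mem gl_PL g)
  then show "\<theta> (skew_group G scale (group_elt G g)) * ?v - ?w * \<theta> (skew_group G scale (group_elt G g)) -
      \<theta> (skew_group G scale (lam (group_elt G g) v)) \<in> J"
    by (simp add: \<theta>_skew_group free_group_part_elt[OF g] left_diff_distrib right_diff_distrib)
qed (auto intro: skew_group_component skew_vector_component)

lemma \<mu>_kap:
  "skew_group G scale (kap v w) =
    R.\<mu> 2 (skew_vector G scale v) (skew_vector G scale w) \<ominus>\<^bsub>A\<^esub>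
    R.\<mu> 2 (skew_vector G scale w) (skew_vector G scale v)"
proof (rule \<mu>_commutator)
  let ?v = "\<theta> (skew_vector G scale v)" and ?w = "\<theta> (skew_vector G scale w)"
  let ?k = "free_group_part G (kap v w)"
  \<comment> \<open>In each product one factor at a time is exchanged for its letter. Every
    correction is then a member of J times an element of the free algebra, and together they
    telescope to the difference of the commutators.\<close>
  have "(?v - vl v) * ?w + vl v * (?w - vl w) - ((?w - vl w) * ?v + vl w * (?v - vl v)) +
      (vl v * vl w - vl w * vl v - ?k) \<in> J"
    by (intro H.I_add H.I_diff H.I_mult \<theta>_skew_vector H_relation_mem vl_PL \<theta>_skew_vector_PL)
  then show "?v * ?w - ?w * ?v - \<theta> (skew_group G scale (kap v w)) \<in> J"
    by (simp add: \<theta>_skew_group left_diff_distrib right_diff_distrib)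
qed (auto intro: skew_group_component skew_vector_component)

end

theorem proposition6p5:
  fixes G :: "('g, 'm) monoid_scheme"
    and scale :: "'k::field \<Rightarrow> 'v::ab_group_add \<Rightarrow> 'v"
    and Basis :: "'v set"
    and \<rho> :: "'g \<Rightarrow> 'v \<Rightarrow> 'v"
    and lam :: "('g \<Rightarrow> 'k) \<Rightarrow> 'v \<Rightarrow> ('g \<Rightarrow> 'k)"
    and kap :: "'v \<Rightarrow> 'v \<Rightarrow> ('g \<Rightarrow> 'k)"
  defines "A \<equiv> skew_group_algebra G scale \<rho>"
  assumes "group G" and "finite (carrier G)"
    and "finite_dimensional_vector_space scale Basis"
    and "group_action G (UNIV :: 'v set) \<rho>"
    and "\<And>g. g \<in> carrier G \<Longrightarrow> Vector_Spaces.linear scale scale (\<rho> g)"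
    and "bilinear_map (group_algebra G) (vector_module scale) (group_algebra G) lam"
    and "bilinear_map (vector_module scale) (vector_module scale) (group_algebra G) kap"
    and "\<And>v. kap v v = \<zero>\<^bsub>group_algebra G\<^esub>"
    and "PBW_property G scale \<rho> lam kap"
  shows "\<exists>\<mu>. graded_deformation A (skew_component G scale) \<mu> \<and>
     alg_isomorphic (H_algebra G scale \<rho> lam kap) (fiber_at_one (deformation_algebra A \<mu>)) \<and>
     (\<forall>g\<in>carrier G. \<forall>v.
        skew_group G scale (lam (group_elt G g) v) =
          \<mu> 1 (skew_group G scale (group_elt G g)) (skew_vector G scale v) \<ominus>\<^bsub>A\<^esub>
          \<mu> 1 (skew_vector G scale (\<rho> g v)) (skew_group G scale (group_elt G g))) \<and>
     (\<forall>v w.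
        skew_group G scale (kap v w) =
          \<mu> 2 (skew_vector G scale v) (skew_vector G scale w) \<ominus>\<^bsub>A\<^esub>
          \<mu> 2 (skew_vector G scale w) (skew_vector G scale v))"
proof -
  interpret pbw_setup scale Basis G \<rho> lam kap
    by (intro pbw_setup.intro skew_setup.intro sym_space.intro skew_setup_axioms.intro
        pbw_setup_axioms.intro assms(2-6,10))
  show ?thesis
    unfolding A_def
    by (intro exI[of _ R.\<mu>] conjI ballI allI graded_deformation_\<mu> R.H_isomorphic_fiber \<mu>_lam \<mu>_kap)
qed

end
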